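(* Let $m,n,a,b,c\in\mathbb Z_{\ge0}$ with $m\ge c$, $n-b+c\ge0$, and put $\beta:=n-m+a-2b+3c+\varsigma_1$. Assume $\beta>0$, $\beta$ is odd, and $b>a+c$. Then in $L(m,n)$ $$B^{(a)}_{1}B^{(b)}_{2}B^{(c)}_{1}\eta=[\beta]\sum_{\substack{0\le k\le a\\ k\ \mathrm{odd}}}\frac{[\beta-k+2][\beta-k+4]\cdots[\beta+k-2]}{[k]!}\mathfrak{B}^{(a-k,b-k,c)}_{2}+\sum_{\substack{0\le k\le a\\ k\ \mathrm{even}}}\frac{[\beta-k+1][\beta-k+3]\cdots[\beta+k-1]}{[k]!}\mathfrak{B}^{(a-k,b-k,c)}_{2}$$ and $$\mathfrak{B}_{2}^{(a,b,c)}=\sum_{k=0}^{a}(-1)^{k}[\beta+k-1]\frac{[\beta+1][\beta+3]\cdots[\beta+2k-3]}{[k]!}B_{1}^{(a-k)}B^{(b-k)}_{2}B^{(c)}_{1}\eta.$$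
   Context: Conventions: products written with dots run in steps of $2$ ($[\beta-k+2]\cdots[\beta+k-2]$ and $[\beta+1]\cdots[\beta+2k-3]$ have $k-1$ factors), and the full coefficient of each $k=0$ term (including the prefactor $[\beta+k-1]$) is $1$. For $r\in\mathbb Z$: $[r]=\frac{q^r-q^{-r}}{q-q^{-1}}$; $[r]!=[1]\cdots[r]$, $[0]!=1$; $X^{(r)}=X^r/[r]!$ for $r\ge0$ and $X^{(r)}=0$ for $r<0$. $\mathbf U=U_q(\mathfrak{sl}_3)$ is the $\mathbb Q(q)$-algebra generated by $E_i,F_i,K_i^{\pm1}$, $i\in\{1,2\}$, with $K_1K_2=K_2K_1$, $K_iE_jK_i^{-1}=q^{a_{ij}}E_j$, $K_iF_jK_i^{-1}=q^{-a_{ij}}F_j$ ($a_{ii}=2$, $a_{12}=a_{21}=-1$), $E_iF_j-F_jE_i=\delta_{ij}\frac{K_i-K_i^{-1}}{q-q^{-1}}$, and for $i\ne j$ the Serre relations $E_jE_i^{(2)}-E_iE_jE_i+E_i^{(2)}E_j=0$, $F_jF_i^{(2)}-F_iF_jF_i+F_i^{(2)}F_j=0$. $\tau$ swaps $1$ and $2$. The parameter is $\varsigma=(\varsigma_1,\varsigma_2)\in\{(1,0),(0,1)\}$. $\mathbf U^\imath$ is the subalgebra of $\mathbf U$ generated by $B_i=F_i+q^{\varsigma_i}E_{\tau i}K_i^{-1}$, $k_i=K_iK_{\tau i}^{-1}$. $\psi^\imath$ is the $\mathbb Q$-algebra automorphism of $\mathbf U^\imath$ with $q\mapsto q^{-1}$,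 $B_i\mapsto B_i$, $k_i\mapsto k_i^{-1}$. $L(m,n)$ is the simple $\mathbf U$-module of highest weight $m\omega_1+n\omega_2$ with highest weight vector $\eta$; $\psi^\imath$ also denotes the anti-linear involution of $L(m,n)=\mathbf U^\imath\eta$ with $\psi^\imath(u\eta)=\psi^\imath(u)\eta$. iCanonical basis: for $a,b,c\ge0$, $b\ge a+c$ with $F_1^{(a)}F_2^{(b)}F_1^{(c)}\eta\neq0$ (equivalently $c\le m$, $b-c\le n$), $\mathfrak B_2^{(a,b,c)}\in L(m,n)$ is the unique $\psi^\imath$-invariant element of $F_1^{(a)}F_2^{(b)}F_1^{(c)}\eta+\sum_{x,y\ge0,(x,y)\ne(0,0)}q^{-1}\mathbb Z[q^{-1}]F_1^{(a-x)}F_2^{(b-x-y)}F_1^{(c-y)}\eta$. *)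

theory Defs
  imports
    "HOL-Computational_Algebra.Polynomial_Factorial"
    "HOL-Library.Poly_Mapping"
begin

section \<open>The field of rational functions, quantum integers and the bar involution\<close>

type_synonym Qq = "rat poly fract"

definition qq :: Qq where
  "qq = to_fract [:0, 1:]"

definition const_Qq :: "rat \<Rightarrow> Qq" where
  "const_Qq c = to_fract [:c:]"

lemma qq_nonzero [simp]: "qq \<noteq> 0"
  by (simp add: qq_def)

lemma const_Qq_0 [simp]: "const_Qq 0 = 0"
  by (simp add: const_Qq_def)

lemma const_Qq_eq_0_iff [simp]: "const_Qq c = 0 \<longleftrightarrow> c = 0"
  by (simp add: const_Qq_def)

lemma const_Qq_add: "const_Qq (a + b) = const_Qq a + const_Qq b"
  by (simp add: const_Qq_def flip: to_fract_add)

lemma const_Qq_mult: "const_Qq (a * b) = const_Qq a * const_Qq b"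
  by (simp add: const_Qq_def flip: to_fract_mult)

text \<open>Substitution of the inverse of \<open>q\<close> for the variable of a polynomial.\<close>

definition subst_inv :: "rat poly \<Rightarrow> Qq" where
  "subst_inv p = poly (map_poly const_Qq p) (inverse qq)"

lemma subst_inv_0 [simp]: "subst_inv 0 = 0"
  by (simp add: subst_inv_def)

lemma subst_inv_pCons [simp]: "subst_inv (pCons c p) = const_Qq c + inverse qq * subst_inv p"
  by (simp add: subst_inv_def map_poly_pCons)

lemma subst_inv_add: "subst_inv (p + r) = subst_inv p + subst_inv r"
  by (induction p r rule: poly_induct2) (simp_all add: const_Qq_add algebra_simps)

lemma subst_inv_smult: "subst_inv (smult c p) = const_Qq c * subst_inv p"
  by (induction p) (simp_all add: const_Qq_mult algebra_simps)

lemma subst_inv_mult: "subst_inv (p * r) = subst_inv p * subst_inv r"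
  by (induction p) (simp_all add: subst_inv_add subst_inv_smult algebra_simps)

lemma poly_map_const_Qq: "poly (map_poly const_Qq p) qq = to_fract p"
proof (induction p)
  case (pCons c p)
  have "to_fract (pCons c p) = to_fract ([:c:] + [:0, 1:] * p)"
    by simp
  then show ?case
    using pCons.IH
    by (simp only: to_fract_add to_fract_mult)
       (simp add: map_poly_pCons const_Qq_def qq_def)
qed simp

lemma subst_inv_nonzero:
  assumes "p \<noteq> 0"
  shows "subst_inv p \<noteq> 0"
proof
  assume *: "subst_inv p = 0"
  define P where "P = map_poly const_Qq p"
  have deg: "degree P = degree p"
    unfolding P_def by (rule degree_map_poly) simp
  have "reflect_poly P = map_poly const_Qq (reflect_poly p)"
    by (rule poly_eqI) (simp add: coeff_reflect_poly deg[unfolded P_def] coeff_map_poly P_def)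
  then have "to_fract (reflect_poly p) = poly (reflect_poly P) qq"
    by (simp add: poly_map_const_Qq)
  also have "\<dots> = qq ^ degree P * poly P (inverse qq)"
    by (rule poly_reflect_poly_nz) simp
  also have "\<dots> = 0"
    using * by (simp add: subst_inv_def P_def)
  finally show False
    using assms by simp
qed

definition bar :: "Qq \<Rightarrow> Qq" where
  "bar x = (THE y. \<exists>f g. g \<noteq> 0 \<and> x = Fract f g \<and> y = subst_inv f / subst_inv g)"

lemma bar_Fract: "g \<noteq> 0 \<Longrightarrow> bar (Fract f g) = subst_inv f / subst_inv g"
  unfolding bar_def
proof (rule the_equality)
  fix y
  assume g: "g \<noteq> 0" and "\<exists>f' g'. g' \<noteq> 0 \<and> Fract f g = Fract f' g' \<and> y = subst_inv f' / subst_inv g'"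
  then obtain f' g' where *: "g' \<noteq> 0" "Fract f g = Fract f' g'" "y = subst_inv f' / subst_inv g'"
    by blast
  then have "f * g' = f' * g"
    using g by (simp add: eq_fract)
  then have "subst_inv f * subst_inv g' = subst_inv f' * subst_inv g"
    by (metis subst_inv_mult)
  then show "y = subst_inv f / subst_inv g"
    using g * subst_inv_nonzero by (simp add: frac_eq_eq)
qed auto

lemma bar_const [simp]: "bar (const_Qq c) = const_Qq c"
  using bar_Fract[of 1 "[:c:]"] by (simp add: const_Qq_def to_fract_def one_pCons flip: One_fract_def)

lemma bar_qq [simp]: "bar qq = inverse qq"
proof -
  have "const_Qq 1 = 1"
    by (simp add: const_Qq_def flip: one_pCons)
  then show ?thesis
    using bar_Fract[of 1 "[:0, 1:]"] by (simp add: qq_def to_fract_def one_pCons)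
qed

lemma bar_add: "bar (x + y) = bar x + bar y"
  by (cases x; cases y)
     (simp add: bar_Fract subst_inv_add subst_inv_mult subst_inv_nonzero add_frac_eq)

lemma bar_mult: "bar (x * y) = bar x * bar y"
  by (cases x; cases y) (simp add: bar_Fract subst_inv_mult)

definition qint :: "int \<Rightarrow> Qq" where
  "qint r = (qq powi r - qq powi (- r)) / (qq - inverse qq)"

definition qfact :: "int \<Rightarrow> Qq" where
  "qfact r = (\<Prod>j\<in>{1..r}. qint j)"

text \<open>\<open>qprod r s\<close> is \<open>[r][r + 2]\<dots>[s]\<close> in steps of two, for \<open>s\<close> congruent to \<open>r\<close> modulo two;
  it is the empty product 1 when \<open>s < r\<close>.\<close>

definition qprod :: "int \<Rightarrow> int \<Rightarrow> Qq" where
  "qprod r s = (\<Prod>j | r \<le> j \<and> j \<le> s \<and> even (j - r). qint j)"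

text \<open>\<open>q\<inverse>\<int>[q\<inverse>]\<close>\<close>

definition qinv_Z :: "Qq set" where
  "qinv_Z = {inverse qq * poly (map_poly of_int p) (inverse qq) | p :: int poly. True}"


section \<open>The free algebra on the Chevalley generators\<close>

datatype idx = I1 | I2

fun tau :: "idx \<Rightarrow> idx" where
  "tau I1 = I2"
| "tau I2 = I1"

definition cartan :: "idx \<Rightarrow> idx \<Rightarrow> int" where
  "cartan i j = (if i = j then 2 else -1)"

datatype gen = GE idx | GF idx | GK idx | GKinv idx

text \<open>Words in the generators, as a monoid written additively, since that is the convention of
  the convolution product on finitely supported functions in \<^theory>\<open>HOL-Library.Poly_Mapping\<close>.\<close>

datatype word = Word (letters: "gen list")

instantiation word :: monoid_add
begin

definition zero_word :: word where
  "zero_word = Word []"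

definition plus_word :: "word \<Rightarrow> word \<Rightarrow> word" where
  "plus_word u v = Word (letters u @ letters v)"

instance
  by standard (simp_all add: zero_word_def plus_word_def)

end

type_synonym free_alg = "word \<Rightarrow>\<^sub>0 Qq"

definition fgen :: "gen \<Rightarrow> free_alg" where
  "fgen g = Poly_Mapping.single (Word [g]) 1"

definition fconst :: "Qq \<Rightarrow> free_alg" where
  "fconst c = Poly_Mapping.single 0 c"

text \<open>Each defining relation \<open>l = r\<close> is represented by the element \<open>l - r\<close>.\<close>

definition serre :: "free_alg \<Rightarrow> free_alg \<Rightarrow> free_alg" where
  "serre x y = (let x2 = fconst (inverse (qfact 2)) * x ^ 2 in y * x2 - x * y * x + x2 * y)"

definition Uq_rels :: "free_alg set" where
  "Uq_rels =
     {fgen (GK i) * fgen (GKinv i) - 1 | i. True}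
   \<union> {fgen (GKinv i) * fgen (GK i) - 1 | i. True}
   \<union> {fgen (GK I1) * fgen (GK I2) - fgen (GK I2) * fgen (GK I1)}
   \<union> {fgen (GK i) * fgen (GE j) * fgen (GKinv i)
        - fconst (qq powi cartan i j) * fgen (GE j) | i j. True}
   \<union> {fgen (GK i) * fgen (GF j) * fgen (GKinv i)
        - fconst (qq powi (- cartan i j)) * fgen (GF j) | i j. True}
   \<union> {fgen (GE i) * fgen (GF j) - fgen (GF j) * fgen (GE i)
        - (if i = j then fconst (inverse (qq - inverse qq)) * (fgen (GK i) - fgen (GKinv i)) else 0)
        | i j. True}
   \<union> {serre (fgen (GE i)) (fgen (GE j)) | i j. i \<noteq> j}
   \<union> {serre (fgen (GF i)) (fgen (GF j)) | i j. i \<noteq> j}"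

inductive_set Uq_ideal :: "free_alg set" where
  zero: "0 \<in> Uq_ideal"
| rel: "r \<in> Uq_rels \<Longrightarrow> x * r * y \<in> Uq_ideal"
| add: "u \<in> Uq_ideal \<Longrightarrow> v \<in> Uq_ideal \<Longrightarrow> u + v \<in> Uq_ideal"

lemma Uq_ideal_mult_left: "u \<in> Uq_ideal \<Longrightarrow> z * u \<in> Uq_ideal"
proof (induction rule: Uq_ideal.induct)
  case (rel r x y)
  then show ?case
    using Uq_ideal.rel[of r "z * x" y] by (simp add: mult.assoc)
qed (simp_all add: Uq_ideal.zero Uq_ideal.add distrib_left)

lemma Uq_ideal_mult_right: "u \<in> Uq_ideal \<Longrightarrow> u * z \<in> Uq_ideal"
proof (induction rule: Uq_ideal.induct)
  case (rel r x y)
  then show ?case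
    using Uq_ideal.rel[of r x "y * z"] by (simp add: mult.assoc)
qed (simp_all add: Uq_ideal.zero Uq_ideal.add distrib_right)

lemma Uq_ideal_uminus: "u \<in> Uq_ideal \<Longrightarrow> - u \<in> Uq_ideal"
  using Uq_ideal_mult_left[of u "- 1"] by simp


section \<open>The quantum group of type \<open>A\<^sub>2\<close>\<close>

definition Uq_eq :: "free_alg \<Rightarrow> free_alg \<Rightarrow> bool" where
  "Uq_eq x y \<longleftrightarrow> x - y \<in> Uq_ideal"

quotient_type Uq = free_alg / Uq_eq
proof (rule equivpI)
  show "reflp Uq_eq"
    by (simp add: reflp_def Uq_eq_def Uq_ideal.zero)
  show "symp Uq_eq"
    using Uq_ideal_uminus by (fastforce simp: symp_def Uq_eq_def)
  show "transp Uq_eq"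
    using Uq_ideal.add by (fastforce simp: transp_def Uq_eq_def)
qed

instantiation Uq :: "{ring, monoid_mult}"
begin

lift_definition zero_Uq :: Uq is "0" .

lift_definition one_Uq :: Uq is "1" .

lift_definition plus_Uq :: "Uq \<Rightarrow> Uq \<Rightarrow> Uq" is "(+)"
  using Uq_ideal.add by (fastforce simp: Uq_eq_def algebra_simps)

lift_definition uminus_Uq :: "Uq \<Rightarrow> Uq" is uminus
  using Uq_ideal_uminus by (fastforce simp: Uq_eq_def)

lift_definition minus_Uq :: "Uq \<Rightarrow> Uq \<Rightarrow> Uq" is "(-)"
proof -
  fix a b c d
  assume "Uq_eq a b" "Uq_eq c d"
  then have "(a - b) + - (c - d) \<in> Uq_ideal"
    unfolding Uq_eq_def by (intro Uq_ideal.add Uq_ideal_uminus)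
  then show "Uq_eq (a - c) (b - d)"
    by (simp add: Uq_eq_def algebra_simps)
qed

lift_definition times_Uq :: "Uq \<Rightarrow> Uq \<Rightarrow> Uq" is "(*)"
proof -
  fix a b c d
  assume "Uq_eq a b" "Uq_eq c d"
  then have "(a - b) * c + b * (c - d) \<in> Uq_ideal"
    unfolding Uq_eq_def by (intro Uq_ideal.add Uq_ideal_mult_left Uq_ideal_mult_right)
  then show "Uq_eq (a * c) (b * d)"
    by (simp add: Uq_eq_def algebra_simps)
qed

instance
  by standard (transfer; simp add: Uq_eq_def Uq_ideal.zero algebra_simps)+

end

lift_definition scal :: "Qq \<Rightarrow> Uq" is fconst .

lift_definition E :: "idx \<Rightarrow> Uq" is "\<lambda>i. fgen (GE i)" .
lift_definition F :: "idx \<Rightarrow> Uq" is "\<lambda>i. fgen (GF i)" .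
lift_definition K :: "idx \<Rightarrow> Uq" is "\<lambda>i. fgen (GK i)" .
lift_definition Kinv :: "idx \<Rightarrow> Uq" is "\<lambda>i. fgen (GKinv i)" .

definition dpow :: "Uq \<Rightarrow> int \<Rightarrow> Uq" where
  "dpow x r = (if r < 0 then 0 else scal (inverse (qfact r)) * x ^ nat r)"


section \<open>The iquantum group\<close>

definition B :: "(idx \<Rightarrow> int) \<Rightarrow> idx \<Rightarrow> Uq" where
  "B \<sigma> i = F i + scal (qq powi \<sigma> i) * E (tau i) * Kinv i"

definition kk :: "idx \<Rightarrow> Uq" where
  "kk i = K i * Kinv (tau i)"

definition kkinv :: "idx \<Rightarrow> Uq" where
  "kkinv i = K (tau i) * Kinv i"

inductive_set Ui :: "(idx \<Rightarrow> int) \<Rightarrow> Uq set" for \<sigma> :: "idx \<Rightarrow> int" where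
  scal: "scal c \<in> Ui \<sigma>"
| B: "B \<sigma> i \<in> Ui \<sigma>"
| k: "kk i \<in> Ui \<sigma>"
| add: "x \<in> Ui \<sigma> \<Longrightarrow> y \<in> Ui \<sigma> \<Longrightarrow> x + y \<in> Ui \<sigma>"
| mult: "x \<in> Ui \<sigma> \<Longrightarrow> y \<in> Ui \<sigma> \<Longrightarrow> x * y \<in> Ui \<sigma>"

text \<open>The anti-linear automorphism of the iquantum group; a map with these properties is uniquely
  determined on \<^term>\<open>Ui \<sigma>\<close> (its values elsewhere are irrelevant).\<close>

definition is_psi_Ui :: "(idx \<Rightarrow> int) \<Rightarrow> (Uq \<Rightarrow> Uq) \<Rightarrow> bool" where
  "is_psi_Ui \<sigma> \<psi> \<longleftrightarrow>
     bij_betw \<psi> (Ui \<sigma>) (Ui \<sigma>)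
   \<and> (\<forall>x \<in> Ui \<sigma>. \<forall>y \<in> Ui \<sigma>. \<psi> (x + y) = \<psi> x + \<psi> y)
   \<and> (\<forall>x \<in> Ui \<sigma>. \<forall>y \<in> Ui \<sigma>. \<psi> (x * y) = \<psi> x * \<psi> y)
   \<and> (\<forall>c. \<psi> (scal c) = scal (bar c))
   \<and> (\<forall>i. \<psi> (B \<sigma> i) = B \<sigma> i)
   \<and> (\<forall>i. \<psi> (kk i) = kkinv i)"


section \<open>Modules\<close>

text \<open>A left module over the quantum group; its structure of vector space over the field of rational
  functions is the one induced by the scalars \<^const>\<open>scal\<close>.\<close>

locale Uq_module =
  fixes act :: "Uq \<Rightarrow> 'v::ab_group_add \<Rightarrow> 'v"
  assumes act_add_left: "act (x + y) v = act x v + act y v"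
    and act_add_right: "act x (v + w) = act x v + act x w"
    and act_mult: "act (x * y) v = act x (act y v)"
    and act_one: "act 1 v = v"

definition submodule :: "(Uq \<Rightarrow> 'v::ab_group_add \<Rightarrow> 'v) \<Rightarrow> 'v set \<Rightarrow> bool" where
  "submodule act W \<longleftrightarrow>
     0 \<in> W \<and> (\<forall>v \<in> W. \<forall>w \<in> W. v + w \<in> W) \<and> (\<forall>x. \<forall>v \<in> W. act x v \<in> W)"

text \<open>The module \<open>L(m, n)\<close> (unique up to isomorphism), with highest weight vector \<open>\<eta>\<close>.\<close>

locale simple_highest_weight_module = Uq_module act
  for act :: "Uq \<Rightarrow> 'v::ab_group_add \<Rightarrow> 'v" +
  fixes m n :: int and \<eta> :: 'v
  assumes simple: "submodule act W \<Longrightarrow> W = {0} \<or> W = UNIV"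
    and hw_nonzero: "\<eta> \<noteq> 0"
    and hw_E: "act (E i) \<eta> = 0"
    and hw_K1: "act (K I1) \<eta> = act (scal (qq powi m)) \<eta>"
    and hw_K2: "act (K I2) \<eta> = act (scal (qq powi n)) \<eta>"

definition is_psi_module ::
  "(idx \<Rightarrow> int) \<Rightarrow> (Uq \<Rightarrow> Uq) \<Rightarrow> (Uq \<Rightarrow> 'v::ab_group_add \<Rightarrow> 'v) \<Rightarrow> 'v \<Rightarrow> ('v \<Rightarrow> 'v) \<Rightarrow> bool" where
  "is_psi_module \<sigma> \<psi> act \<eta> \<psi>L \<longleftrightarrow>
     (\<forall>v w. \<psi>L (v + w) = \<psi>L v + \<psi>L w)
   \<and> (\<forall>c v. \<psi>L (act (scal c) v) = act (scal (bar c)) (\<psi>L v))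
   \<and> (\<forall>v. \<psi>L (\<psi>L v) = v)
   \<and> (\<forall>u \<in> Ui \<sigma>. \<psi>L (act u \<eta>) = act (\<psi> u) \<eta>)"


section \<open>The icanonical basis\<close>

definition F_mon :: "(Uq \<Rightarrow> 'v::ab_group_add \<Rightarrow> 'v) \<Rightarrow> 'v \<Rightarrow> int \<Rightarrow> int \<Rightarrow> int \<Rightarrow> 'v" where
  "F_mon act \<eta> a b c = act (dpow (F I1) a * dpow (F I2) b * dpow (F I1) c) \<eta>"

definition B_mon ::
  "(idx \<Rightarrow> int) \<Rightarrow> (Uq \<Rightarrow> 'v::ab_group_add \<Rightarrow> 'v) \<Rightarrow> 'v \<Rightarrow> int \<Rightarrow> int \<Rightarrow> int \<Rightarrow> 'v" where
  "B_mon \<sigma> act \<eta> a b c = act (dpow (B \<sigma> I1) a * dpow (B \<sigma> I2) b * dpow (B \<sigma> I1) c) \<eta>"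

text \<open>Only finitely many of the summands below are nonzero, since divided powers with negative
  exponent vanish; so it is enough to take finite index sets \<open>S\<close>.\<close>

definition icanonical_coset ::
  "(Uq \<Rightarrow> 'v::ab_group_add \<Rightarrow> 'v) \<Rightarrow> 'v \<Rightarrow> int \<Rightarrow> int \<Rightarrow> int \<Rightarrow> 'v set" where
  "icanonical_coset act \<eta> a b c =
     {F_mon act \<eta> a b c
        + (\<Sum>(x, y)\<in>S. act (scal (g (x, y))) (F_mon act \<eta> (a - x) (b - x - y) (c - y))) | S g.
      finite S \<and> S \<subseteq> {(x, y). 0 \<le> x \<and> 0 \<le> y \<and> (x, y) \<noteq> (0, 0)} \<and> g ` S \<subseteq> qinv_Z}"

text \<open>Meaningful for \<open>a, b, c \<ge> 0\<close>, \<open>b \<ge> a + c\<close>, \<open>c \<le> m\<close>, \<open>b - c \<le> n\<close>.\<close>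

definition icanonical ::
  "(Uq \<Rightarrow> 'v::ab_group_add \<Rightarrow> 'v) \<Rightarrow> 'v \<Rightarrow> ('v \<Rightarrow> 'v) \<Rightarrow> int \<Rightarrow> int \<Rightarrow> int \<Rightarrow> 'v" where
  "icanonical act \<eta> \<psi>L a b c = (THE v. \<psi>L v = v \<and> v \<in> icanonical_coset act \<eta> a b c)"

end

theory Submission
  imports Defs
begin

text \<open>Write \<open>p = q\<inverse>\<close>. Expanding \<open>B\<^sub>1\<close> and \<open>B\<^sub>2\<close> by the \<open>q\<close>-binomial theorem gives the coefficients of
  \<open>B\<^sub>1\<^sup>(\<^sup>a\<^sup>) B\<^sub>2\<^sup>(\<^sup>b\<^sup>) B\<^sub>1\<^sup>(\<^sup>c\<^sup>) \<eta>\<close> on the monomials \<open>F\<^sub>1\<^sup>(\<^sup>a\<^sup>-\<^sup>x\<^sup>) F\<^sub>2\<^sup>(\<^sup>b\<^sup>-\<^sup>x\<^sup>-\<^sup>y\<^sup>) F\<^sub>1\<^sup>(\<^sup>c\<^sup>-\<^sup>y\<^sup>) \<eta>\<close> as a factor depending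
  on \<open>x\<close>, times \<open>p\<^sup>x\<^sup>y\<close>, times a factor depending on \<open>y\<close> that lies in \<open>p\<int>[p]\<close> for \<open>y > 0\<close>. In the alternating
  sum of the theorem only the \<open>x\<close>-factor changes. Its value is determined by contiguity relations
  between the sums for even and odd \<open>\<beta>\<close> and, up to a Pascal rule which preserves integrality, is a power
  of \<open>p\<close> times a Gaussian binomial coefficient in \<open>p\<^sup>4\<close>. Hence the alternating sum is the icanonical basis
  element, where uniqueness of the latter comes from the linear independence of the monomials, the
  unitriangularity of \<open>\<psi>L\<close> on them and the fact that an element of \<open>p\<int>[p]\<close> fixed by the bar involution
  vanishes. Replacing \<open>(a, b)\<close> by \<open>(a - k, b - k)\<close> replaces \<open>\<beta>\<close> by \<open>\<beta> + k\<close>, so the inverse formula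
  mixes both parities; it follows from a telescoping identity.\<close>

section \<open>Quantum integers\<close>

text \<open>The contiguity relations mix neighbouring values of \<open>\<beta>\<close> and so leave
  the parity for which each family of coefficients is meant. Hence both families are evaluated
  together and for every integer \<open>\<beta>\<close>; parity enters only through integrality,
  since the Gaussian binomial has argument \<open>\<beta>\<close> for \<open>can_even\<close> and
  \<open>\<beta> + 1\<close> for \<open>can_odd\<close> and lies in \<open>Z_qinv\<close> when that
  argument is even and nonnegative. The relations lead from \<open>\<delta> = 0\<close> to
  \<open>\<delta> = - 1\<close>, where all sums of odd index vanish; the Pascal rule leads back to
  \<open>0\<close> and then up to the required \<open>\<delta> \<ge> 0\<close>, each step adding a
  negative power of \<open>q\<close> times an earlier value. Independence is asserted only for
  monomials with \<open>c \<le> m\<close> and \<open>b - c \<le> n\<close>, so its induction has to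
  carry a support condition, and this decides which operators may be applied.\<close>

lemma qq_power_neq_1: "n > 0 \<Longrightarrow> qq ^ n \<noteq> 1"
proof
  assume n: "n > 0" and "qq ^ n = 1"
  have "qq ^ n = to_fract ([:0, 1:] ^ n)"
    by (induction n) (simp_all add: qq_def del: mult_pCons_left flip: to_fract_mult)
  with \<open>qq ^ n = 1\<close> have "to_fract ([:0, 1:] ^ n) = (to_fract 1 :: Qq)"
    by simp
  then have "[:0, 1:] ^ n = (1 :: rat poly)"
    by (simp only: to_fract_eq_iff)
  then have "degree ([:0, 1:] ^ n :: rat poly) = degree (1 :: rat poly)"
    by simp
  with n show False
    by (simp add: degree_power_eq)
qed

lemma qq_powi_eq_1_iff: "qq powi z = 1 \<longleftrightarrow> z = 0"
proof (cases "z \<ge> 0")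
  case True
  then show ?thesis
    using qq_power_neq_1[of "nat z"] by (cases "z = 0") (auto simp: power_int_def)
next
  case False
  then have "inverse qq ^ nat (- z) \<noteq> 1"
    using qq_power_neq_1[of "nat (- z)"] by (simp add: power_inverse)
  with False show ?thesis
    by (auto simp: power_int_def)
qed

lemma qq_powi_add: "qq powi (x + y) = qq powi x * qq powi y"
  by (simp add: power_int_add)

lemma qq_powi_eq_iff: "qq powi x = qq powi y \<longleftrightarrow> x = y"
  using qq_powi_eq_1_iff[of "x - y"] by (auto simp: power_int_diff)

lemma qq_diff_nonzero: "qq - inverse qq \<noteq> 0"
  using qq_powi_eq_iff[of 1 "- 1"] by simp

lemma qint_0 [simp]: "qint 0 = 0"
  by (simp add: qint_def)

lemma qint_1 [simp]: "qint 1 = 1"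
  using qq_diff_nonzero by (simp add: qint_def)

lemma qint_eq_0_iff [simp]: "qint r = 0 \<longleftrightarrow> r = 0"
  using qq_powi_eq_iff[of r "- r"] qq_diff_nonzero by (auto simp: qint_def)

lemma qint_times: "qint z * (qq - inverse qq) = qq powi z - qq powi (- z)"
  using qq_diff_nonzero by (simp add: qint_def)

text \<open>Multiplied by \<open>(qq - inverse qq) ^ 2\<close>, a product
  \<open>qint u * qint v\<close> becomes \<open>\<phi> (u + v) - \<phi> (u - v)\<close> with
  \<open>\<phi>\<close> even, and the terms cancel. This rule is behind the shift relations, the
  telescoping sum, the commutation of \<open>E\<close> with powers of \<open>F\<close> and the
  determinant in the independence proof.\<close>

lemma qint_exchange: "qint x * qint (y + k) = qint k * qint (x + y) + qint (x - k) * qint y"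
proof -
  define \<phi> where "\<phi> z = qq powi z + qq powi (- z)" for z
  have mult: "qint u * qint v * (qq - inverse qq) ^ 2 = \<phi> (u + v) - \<phi> (u - v)" for u v
  proof -
    have "qint u * qint v * (qq - inverse qq) ^ 2 =
        (qint u * (qq - inverse qq)) * (qint v * (qq - inverse qq))"
      by (simp add: power2_eq_square)
    also have "\<dots> = (qq powi u * qq powi v + qq powi (- u) * qq powi (- v))
        - (qq powi u * qq powi (- v) + qq powi (- u) * qq powi v)"
      unfolding qint_times by (simp add: algebra_simps)
    also have "\<dots> = \<phi> (u + v) - \<phi> (u - v)"
      by (simp add: \<phi>_def flip: qq_powi_add)
    finally show ?thesis .
  qed
  have "\<phi> (- z) = \<phi> z" for z
    by (simp add: \<phi>_def)
  from this[of "x - k + y"] have \<phi>: "\<phi> (k - (x + y)) = \<phi> (x - k + y)"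
    by (simp add: algebra_simps)
  have "(qint x * qint (y + k)) * (qq - inverse qq) ^ 2 = \<phi> (k + (x + y)) - \<phi> (x - k - y)"
    unfolding mult by (simp add: algebra_simps)
  also have "\<dots> = (qint k * qint (x + y) + qint (x - k) * qint y) * (qq - inverse qq) ^ 2"
    unfolding distrib_right mult \<phi> by simp
  finally show ?thesis
    using qq_diff_nonzero by simp
qed

lemma qint_exchange_eqI:
  "y' = y + k \<Longrightarrow> z = x + y \<Longrightarrow> w = x - k \<Longrightarrow>
     qint x * qint y' = qint k * qint z + qint w * qint y"
  by (hypsubst, rule qint_exchange)

lemma qint_add: "qint (r + s) = qq powi s * qint r + qq powi (- r) * qint s"
proof -
  have "(qq powi s * qint r + qq powi (- r) * qint s) * (qq - inverse qq) =
      qq powi s * (qint r * (qq - inverse qq)) + qq powi (- r) * (qint s * (qq - inverse qq))"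
    by (simp only: distrib_right mult.assoc)
  also have "\<dots> = qq powi (s + r) - qq powi (s + - r) + (qq powi (- r + s) - qq powi (- r + - s))"
    unfolding qint_times by (simp only: right_diff_distrib qq_powi_add)
  also have "\<dots> = qint (r + s) * (qq - inverse qq)"
    unfolding qint_times by (simp add: algebra_simps)
  finally show ?thesis
    using qq_diff_nonzero by simp
qed

lemma qint_add': "qint (r + s) = qq powi (- s) * qint r + qq powi r * qint s"
  using qint_add[of s r] by (simp add: add.commute)

lemma qfact_0 [simp]: "qfact 0 = 1"
  by (simp add: qfact_def)

lemma qfact_1 [simp]: "qfact 1 = 1"
  by (simp add: qfact_def)

lemma qfact_nonzero [simp]: "qfact r \<noteq> 0"
  by (simp add: qfact_def)

lemma qfact_rec: "r > 0 \<Longrightarrow> qfact r = qint r * qfact (r - 1)"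
proof -
  assume "r > 0"
  then have "{1..r} = insert r {1..r - 1}"
    by auto
  then show ?thesis
    by (simp add: qfact_def)
qed

lemma qfact_Suc: "qfact (1 + int k) = qint (1 + int k) * qfact (int k)"
  using qfact_rec[of "1 + int k"] by simp

text \<open>Recording the length instead of the last factor lets runs be split and joined by
  recursion; \<open>qprod\<close> is translated only in the final theorem.\<close>

definition qprod_len :: "int \<Rightarrow> nat \<Rightarrow> Qq" where
  "qprod_len x l = (\<Prod>j<l. qint (x + 2 * int j))"

lemma qprod_len_0 [simp]: "qprod_len x 0 = 1"
  by (simp add: qprod_len_def)

lemma qprod_len_Suc: "qprod_len x (Suc l) = qprod_len x l * qint (x + 2 * int l)"
  by (simp add: qprod_len_def)

lemma qprod_len_Suc_left: "qprod_len x (Suc l) = qint x * qprod_len (x + 2) l"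
  by (simp add: qprod_len_def prod.lessThan_Suc_shift algebra_simps del: prod.lessThan_Suc)

lemma qprod_len_add: "qprod_len x (k + l) = qprod_len x k * qprod_len (x + 2 * int k) l"
  by (induction l) (simp_all add: qprod_len_Suc algebra_simps)

lemma qprod_eq_qprod_len:
  assumes "s = r + 2 * int l - 2"
  shows "qprod r s = qprod_len r l"
  unfolding qprod_def qprod_len_def
  by (rule prod.reindex_bij_witness[where j = "\<lambda>j. nat ((j - r) div 2)" and i = "\<lambda>j. r + 2 * int j"])
     (auto simp: assms elim!: evenE)

section \<open>Coefficients\<close>

text \<open>Coefficients of the icanonical basis elements on the \<open>B\<close>-monomials, for even and odd \<open>\<beta>\<close>. The
  recurrences below hold for every integer \<open>\<beta>\<close>.\<close>

definition can_even :: "int \<Rightarrow> nat \<Rightarrow> Qq" where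
  "can_even \<beta> k = qprod_len \<beta> k / qfact (int k)"

definition can_odd :: "int \<Rightarrow> nat \<Rightarrow> Qq" where
  "can_odd \<beta> k = (if k = 0 then 1
     else qint (\<beta> + int k - 1) * qprod_len (\<beta> + 1) (k - 1) / qfact (int k))"

lemma can_even_0 [simp]: "can_even \<beta> 0 = 1"
  by (simp add: can_even_def)

lemma can_odd_0 [simp]: "can_odd \<beta> 0 = 1"
  by (simp add: can_odd_def)

text \<open>The value 0 in front lets the relations below cover \<open>k = 0\<close> and keeps all
  their terms as sequences in the same index.\<close>

definition shift_seq :: "(nat \<Rightarrow> Qq) \<Rightarrow> nat \<Rightarrow> Qq" where
  "shift_seq d k = (case k of 0 \<Rightarrow> 0 | Suc k \<Rightarrow> d k)"

lemma shift_seq_simps [simp]: "shift_seq d 0 = 0" "shift_seq d (Suc k) = d k"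
  by (simp_all add: shift_seq_def)

text \<open>These relations express that multiplication by \<open>B\<^sub>1\<close> sends an icanonical basis element to a
  combination of icanonical basis elements of the same or the opposite parity.\<close>

lemma can_even_shift:
  "can_even \<beta> k * qint (i - int k) =
     qint i * can_odd (\<beta> + 1) k - qint (i + \<beta>) * shift_seq (can_even (\<beta> + 2)) k"
proof (cases k)
  case (Suc l)
  have "qint \<beta> * qint (i - int k) =
      qint i * qint (\<beta> + int k) - qint (int k) * qint (i + \<beta>)"
    using qint_exchange[of i \<beta> "int k"] by (simp add: algebra_simps)
  then have "qint \<beta> * qint (i - int k) * qprod_len (\<beta> + 2) l / qfact (int k) =
      (qint i * qint (\<beta> + int k) - qint (int k) * qint (i + \<beta>)) * qprod_len (\<beta> + 2) l / qfact (int k)"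
    by simp
  then show ?thesis
    by (simp add: Suc can_even_def can_odd_def qprod_len_Suc_left qfact_Suc field_simps)
qed simp

lemma can_odd_shift:
  "can_odd \<beta> k * qint (i - int k) =
     qint i * can_even (\<beta> + 1) k - qint (i + \<beta>) * shift_seq (can_odd (\<beta> + 2)) k
     + qint (i - 1) * shift_seq (shift_seq (can_even (\<beta> + 3))) k"
proof (cases k)
  case (Suc l)
  show ?thesis
  \<comment> \<open>For \<open>k \<ge> 2\<close> all products share a run of length
    \<open>k - 2\<close> starting at \<open>[\<beta> + 3]\<close>, called \<open>G\<close> below;
    \<open>k = 1\<close> has no such run.\<close>
  proof (cases l)
    case 0
    have "qint i * qint (\<beta> + 1) = qint (i + \<beta>) + qint \<beta> * qint (i - 1)"
      using qint_exchange[of i \<beta> 1] by (simp add: algebra_simps)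
    with Suc 0 show ?thesis
      by (simp add: can_even_def can_odd_def qprod_len_Suc qfact_Suc algebra_simps)
  next
    case l: (Suc j)
    define \<kappa> where "\<kappa> = int k"
    have 1: "qint i * qint (\<beta> + 2 * \<kappa> - 1) =
        qint \<kappa> * qint (i + \<beta> + \<kappa> - 1) + qint (i - \<kappa>) * qint (\<beta> + \<kappa> - 1)"
      by (rule qint_exchange_eqI) simp_all
    have 2: "qint (i + \<beta>) * qint (\<beta> + \<kappa>) =
        qint (\<beta> + 1) * qint (i + \<beta> + \<kappa> - 1) + qint (i - 1) * qint (\<kappa> - 1)"
      by (rule qint_exchange_eqI) simp_all
    define G where "G = qprod_len (\<beta> + 3) j"
    have k: "int k = 2 + int j" "\<kappa> = 2 + int j"
      by (simp_all add: Suc l \<kappa>_def)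
    have G1: "qprod_len (\<beta> + 1) (Suc j) = qint (\<beta> + 1) * G"
      by (simp only: qprod_len_Suc_left G_def) (simp add: add.assoc)
    have G2: "qprod_len (\<beta> + 1) (Suc (Suc j)) = qint (\<beta> + 1) * G * qint (\<beta> + 2 * \<kappa> - 1)"
      by (simp only: qprod_len_Suc[of "\<beta> + 1" "Suc j"] G1 k) (simp add: algebra_simps)
    have f: "qfact (int k) = qint \<kappa> * (qint (\<kappa> - 1) * qfact (int j))"
      using qfact_rec[of \<kappa>] qfact_rec[of "\<kappa> - 1"] by (simp add: k)
    have nz: "qint \<kappa> \<noteq> 0" "qint (\<kappa> - 1) \<noteq> 0"
      by (simp_all add: k)
    have e1: "can_odd \<beta> k = qint (\<beta> + \<kappa> - 1) * qint (\<beta> + 1) * G / qfact (int k)"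
      using G1 by (simp add: can_odd_def Suc l \<kappa>_def)
    have e2: "can_even (\<beta> + 1) k = qint (\<beta> + 1) * G * qint (\<beta> + 2 * \<kappa> - 1) / qfact (int k)"
      using G2 by (simp add: can_even_def Suc l \<kappa>_def)
    have e3: "shift_seq (can_odd (\<beta> + 2)) k = qint (\<beta> + \<kappa>) * G * qint \<kappa> / qfact (int k)"
    proof -
      have "qfact (1 + int j) = qint (\<kappa> - 1) * qfact (int j)"
        using qfact_rec[of "1 + int j"] by (simp add: k)
      then show ?thesis
        unfolding f using nz by (simp add: can_odd_def Suc l k G_def algebra_simps)
    qed
    have e4: "shift_seq (shift_seq (can_even (\<beta> + 3))) k = G * qint \<kappa> * qint (\<kappa> - 1) / qfact (int k)"
      unfolding f using nz by (simp add: can_even_def Suc l G_def)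
    \<comment> \<open>The claim without the common factor \<open>G / qfact (int k)\<close>: fact 1
      times \<open>[\<beta> + 1]\<close> minus fact 2 times \<open>[\<kappa>]\<close>.\<close>
    have "qint (\<beta> + \<kappa> - 1) * qint (\<beta> + 1) * qint (i - \<kappa>) =
        qint i * qint (\<beta> + 1) * qint (\<beta> + 2 * \<kappa> - 1) - qint (i + \<beta>) * qint (\<beta> + \<kappa>) * qint \<kappa>
        + qint (i - 1) * qint \<kappa> * qint (\<kappa> - 1)"
      using 1 2 by algebra
    then have "(qint (\<beta> + \<kappa> - 1) * qint (\<beta> + 1) * qint (i - \<kappa>)) * (G / qfact (int k)) =
        (qint i * qint (\<beta> + 1) * qint (\<beta> + 2 * \<kappa> - 1) - qint (i + \<beta>) * qint (\<beta> + \<kappa>) * qint \<kappa>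
        + qint (i - 1) * qint \<kappa> * qint (\<kappa> - 1)) * (G / qfact (int k))"
      by simp
    then show ?thesis
      unfolding e1 e2 e3 e4 \<kappa>_def[symmetric] by (simp add: algebra_simps diff_divide_distrib add_divide_distrib)
  qed
qed simp

section \<open>Expansion coefficients of divided powers of \<open>B\<close>, and their alternating
  sums\<close>

lemma qq_powi_mult_eqI: "a + b = c \<Longrightarrow> qq powi a * qq powi b = qq powi c"
  by (metis qq_powi_add)

lemma qq_powi_mult_eq_multI: "a + b = c + d \<Longrightarrow> qq powi a * qq powi b = qq powi c * qq powi d"
  by (metis qq_powi_add)

text \<open>This is \<open>q\<^sup>-\<^sup>r\<^sup>\<delta>\<^sup>-\<^sup>r\<^sup>(\<^sup>r\<^sup>+\<^sup>1\<^sup>)\<^sup>/\<^sup>2\<close> times the quantum binomial coefficient of \<open>\<beta> + \<delta> + r\<close> over \<open>r\<close>, the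
  coefficient of \<open>F\<^sub>1\<^sup>(\<^sup>a\<^sup>-\<^sup>r\<^sup>) F\<^sub>2\<^sup>(\<^sup>b\<^sup>-\<^sup>r\<^sup>)\<close> in \<open>B\<^sub>1\<^sup>(\<^sup>a\<^sup>) F\<^sub>2\<^sup>(\<^sup>b\<^sup>)\<close> on a highest weight vector.\<close>

definition gcoeff :: "int \<Rightarrow> int \<Rightarrow> nat \<Rightarrow> Qq" where
  "gcoeff \<delta> \<beta> r = (\<Prod>l<r. qq powi (- \<delta> - int l - 1) * qint (\<beta> + \<delta> + 1 + int l) / qint (1 + int l))"

lemma gcoeff_0 [simp]: "gcoeff \<delta> \<beta> 0 = 1"
  by (simp add: gcoeff_def)

lemma gcoeff_Suc:
  "gcoeff \<delta> \<beta> (Suc r) =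
     gcoeff \<delta> \<beta> r * (qq powi (- \<delta> - int r - 1) * qint (\<beta> + \<delta> + 1 + int r) / qint (1 + int r))"
  by (simp add: gcoeff_def)

text \<open>The numerators of \<open>gcoeff (\<delta> - 1) \<beta> (Suc r)\<close> are those of
  \<open>gcoeff \<delta> \<beta> r\<close> with \<open>q^(-\<delta>) [\<beta> + \<delta>]\<close>
  put in front.\<close>

lemma gcoeff_Suc_minus_1:
  "qint (1 + int r) * gcoeff (\<delta> - 1) \<beta> (Suc r) = qq powi (- \<delta>) * qint (\<beta> + \<delta>) * gcoeff \<delta> \<beta> r"
proof (induction r)
  case (Suc r)
  have nz: "qint (1 + int r) \<noteq> 0" "qint (2 + int r) \<noteq> 0"
    by simp_all
  have "qint (1 + int (Suc r)) * gcoeff (\<delta> - 1) \<beta> (Suc (Suc r)) =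
      gcoeff (\<delta> - 1) \<beta> (Suc r) * (qq powi (- \<delta> - int r - 1) * qint (\<beta> + \<delta> + 1 + int r))"
    using nz by (subst gcoeff_Suc) (simp add: field_simps)
  also have "\<dots> = (qint (1 + int r) * gcoeff (\<delta> - 1) \<beta> (Suc r)) *
      (qq powi (- \<delta> - int r - 1) * qint (\<beta> + \<delta> + 1 + int r) / qint (1 + int r))"
    using nz by (simp add: field_simps)
  also have "\<dots> = qq powi (- \<delta>) * qint (\<beta> + \<delta>) * gcoeff \<delta> \<beta> (Suc r)"
    unfolding Suc.IH by (simp add: gcoeff_Suc)
  finally show ?case .
qed (simp add: gcoeff_Suc)

text \<open>Obtained by splitting the last numerator \<open>[\<beta> + \<delta> + 1 + r]\<close>
  with \<open>qint_add\<close>. The power of \<open>q\<close> is negative wherever integrality is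
  derived from this rule.\<close>

lemma gcoeff_pascal:
  "gcoeff \<delta> \<beta> (Suc r) = gcoeff (\<delta> - 1) \<beta> (Suc r) + qq powi (- \<beta> - 2 * \<delta> - int r - 1) * gcoeff \<delta> \<beta> r"
proof -
  have nz: "qint (1 + int r) \<noteq> 0"
    by simp
  have "qq powi (- \<delta> - int r - 1) * qint (\<beta> + \<delta> + 1 + int r) =
      qq powi (- \<delta> - int r - 1) * (qq powi (1 + int r) * qint (\<beta> + \<delta>) + qq powi (- \<beta> - \<delta>) * qint (1 + int r))"
    using qint_add[of "\<beta> + \<delta>" "1 + int r"] by (simp add: algebra_simps)
  also have "\<dots> = qq powi (- \<delta>) * qint (\<beta> + \<delta>) + qq powi (- \<beta> - 2 * \<delta> - int r - 1) * qint (1 + int r)"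
    unfolding distrib_left mult.assoc[symmetric] qq_powi_add[symmetric] by (simp add: algebra_simps)
  finally have "qint (1 + int r) * gcoeff \<delta> \<beta> (Suc r) =
      qint (1 + int r) * gcoeff (\<delta> - 1) \<beta> (Suc r)
      + qq powi (- \<beta> - 2 * \<delta> - int r - 1) * qint (1 + int r) * gcoeff \<delta> \<beta> r"
    unfolding gcoeff_Suc_minus_1 using nz by (simp add: gcoeff_Suc field_simps)
  also have "\<dots> = qint (1 + int r) *
      (gcoeff (\<delta> - 1) \<beta> (Suc r) + qq powi (- \<beta> - 2 * \<delta> - int r - 1) * gcoeff \<delta> \<beta> r)"
    by (simp add: algebra_simps)
  finally show ?thesis
    using nz by simp
qed

text \<open>The quantum integers depend on \<open>\<beta> + \<delta>\<close> only, so just the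
  powers of \<open>q\<close> change.\<close>

lemma gcoeff_translate: "gcoeff (\<delta> + s) (\<beta> - s) r = qq powi (- s * int r) * gcoeff \<delta> \<beta> r"
proof (induction r)
  case (Suc r)
  have "qq powi (- \<delta> - s - int r - 1) = qq powi (- s) * qq powi (- \<delta> - int r - 1)"
    "qq powi (- s * int (Suc r)) = qq powi (- s) * qq powi (- s * int r)"
    by (simp_all add: algebra_simps flip: qq_powi_add)
  with Suc show ?case
    by (simp add: gcoeff_Suc algebra_simps)
qed simp

text \<open>Both sides have the numerators \<open>[\<beta> + 1], ..., [\<beta> + 1 + r]\<close>, and
  the powers of \<open>q\<close> balance; from any other starting value of \<open>\<delta>\<close> a
  power of \<open>q\<close> would remain.\<close>

lemma gcoeff_step:
  "qint (\<beta> + 1 + int r) * gcoeff 0 \<beta> r = qint (1 + int r) * gcoeff (- 1) (\<beta> + 1) (Suc r)"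
proof (induction r)
  case (Suc r)
  have nz: "qint (1 + int r) \<noteq> 0" "qint (2 + int r) \<noteq> 0"
    by simp_all
  have "qint (2 + int r) * gcoeff (- 1) (\<beta> + 1) (Suc (Suc r)) =
      gcoeff (- 1) (\<beta> + 1) (Suc r) * (qq powi (- int r - 1) * qint (\<beta> + 2 + int r))"
    using nz by (subst gcoeff_Suc) (simp add: field_simps)
  also have "\<dots> = (qint (1 + int r) * gcoeff (- 1) (\<beta> + 1) (Suc r)) *
      (qq powi (- int r - 1) * qint (\<beta> + 2 + int r) / qint (1 + int r))"
    using nz by (simp add: field_simps)
  also have "\<dots> = qint (\<beta> + 1 + int (Suc r)) * gcoeff 0 \<beta> (Suc r)"
    unfolding Suc.IH[symmetric] by (simp add: gcoeff_Suc algebra_simps)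
  finally show ?case
    by simp
qed (simp add: gcoeff_Suc)

text \<open>The coefficient of \<open>F\<^sub>1\<^sup>(\<^sup>a\<^sup>-\<^sup>i\<^sup>) F\<^sub>2\<^sup>(\<^sup>b\<^sup>-\<^sup>i\<^sup>) F\<^sub>1\<^sup>(\<^sup>c\<^sup>) \<eta>\<close> in the alternating sum with coefficients \<open>d\<close>, where
  \<open>\<beta> + \<delta> = n - b + c\<close>.\<close>

definition excoeff :: "(nat \<Rightarrow> Qq) \<Rightarrow> int \<Rightarrow> int \<Rightarrow> nat \<Rightarrow> Qq" where
  "excoeff d \<delta> \<beta> i = (\<Sum>k\<le>i. (- 1) ^ k * d k * gcoeff \<delta> (\<beta> + int k) (i - k))"

lemma excoeff_0 [simp]: "excoeff d \<delta> \<beta> 0 = d 0"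
  by (simp add: excoeff_def)

text \<open>In the power of \<open>q\<close> for the summand \<open>k\<close>, taken at
  \<open>\<beta> + k\<close> and \<open>i - k\<close>, the index \<open>k\<close> cancels, so
  \<open>gcoeff_pascal\<close> passes to the whole sum. The summand \<open>k = Suc i\<close> agrees
  on both sides.\<close>

lemma excoeff_pascal:
  "excoeff d \<delta> \<beta> (Suc i) = excoeff d (\<delta> - 1) \<beta> (Suc i) + qq powi (- \<beta> - 2 * \<delta> - int i - 1) * excoeff d \<delta> \<beta> i"
proof -
  have "gcoeff \<delta> (\<beta> + int k) (Suc i - k) = gcoeff (\<delta> - 1) (\<beta> + int k) (Suc i - k)
      + qq powi (- \<beta> - 2 * \<delta> - int i - 1) * gcoeff \<delta> (\<beta> + int k) (i - k)" if "k \<le> i" for k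
    using that gcoeff_pascal[of \<delta> "\<beta> + int k" "i - k"]
    by (simp add: Suc_diff_le of_nat_diff algebra_simps)
  then show ?thesis
    unfolding excoeff_def sum.atMost_Suc sum_distrib_left
    by (simp add: sum.distrib[symmetric] algebra_simps)
qed

text \<open>The left factor of \<open>gcoeff_step\<close> is the same for all \<open>k\<close>. The
  right one depends on \<open>k\<close> and moves into the coefficients, where it vanishes at the
  additional index \<open>k = Suc i\<close>.\<close>

lemma excoeff_step:
  "qint (\<beta> + 1 + int i) * excoeff d 0 \<beta> i =
     excoeff (\<lambda>k. d k * qint (1 + int i - int k)) (- 1) (\<beta> + 1) (Suc i)"
proof -
  have "qint (\<beta> + 1 + int i) * gcoeff 0 (\<beta> + int k) (i - k) =
      qint (1 + int i - int k) * gcoeff (- 1) (\<beta> + 1 + int k) (Suc i - k)" if "k \<le> i" for k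
    using that gcoeff_step[of "\<beta> + int k" "i - k"]
    by (simp add: Suc_diff_le of_nat_diff algebra_simps)
  then show ?thesis
    unfolding excoeff_def sum.atMost_Suc sum_distrib_left
    by (simp add: mult.left_commute[of "qint (\<beta> + 1 + int i)"] mult.assoc)
qed

lemma excoeff_linear:
  "excoeff (\<lambda>k. x * d k + y * d' k) \<delta> \<beta> i = x * excoeff d \<delta> \<beta> i + y * excoeff d' \<delta> \<beta> i"
  by (simp add: excoeff_def sum_distrib_left sum.distrib algebra_simps)

lemma excoeff_shift: "excoeff (shift_seq d) \<delta> \<beta> (Suc i) = - excoeff d \<delta> (\<beta> + 1) i"
  by (simp add: excoeff_def sum.atMost_Suc_shift algebra_simps sum_negf del: sum.atMost_Suc)

text \<open>\<open>can_even_shift\<close> at \<open>1 + i\<close> rewrites the coefficients produced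
  by \<open>excoeff_step\<close>; its minus sign cancels against that of
  \<open>excoeff_shift\<close>.\<close>

lemma excoeff_can_even_rec:
  "qint (\<beta> + 1 + int i) * excoeff (can_even \<beta>) 0 \<beta> i =
     qint (1 + int i) * excoeff (can_odd (\<beta> + 1)) (- 1) (\<beta> + 1) (Suc i)
     + qint (\<beta> + 1 + int i) * excoeff (can_even (\<beta> + 2)) (- 1) (\<beta> + 2) i"
proof -
  have "(\<lambda>k. can_even \<beta> k * qint (1 + int i - int k)) =
      (\<lambda>k. qint (1 + int i) * can_odd (\<beta> + 1) k + (- qint (\<beta> + 1 + int i)) * shift_seq (can_even (\<beta> + 2)) k)"
    by (simp add: can_even_shift algebra_simps)
  then show ?thesis
    unfolding excoeff_step by (simp only: excoeff_linear excoeff_shift) (simp add: add.assoc)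
qed

lemma excoeff_can_odd_rec_Suc:
  "qint (\<beta> + 2 + int i) * excoeff (can_odd \<beta>) 0 \<beta> (Suc i) =
     qint (2 + int i) * excoeff (can_even (\<beta> + 1)) (- 1) (\<beta> + 1) (Suc (Suc i))
     + qint (\<beta> + 2 + int i) * excoeff (can_odd (\<beta> + 2)) (- 1) (\<beta> + 2) (Suc i)
     + qint (1 + int i) * excoeff (can_even (\<beta> + 3)) (- 1) (\<beta> + 3) i"
proof -
  have "(\<lambda>k. can_odd \<beta> k * qint (1 + int (Suc i) - int k)) =
      (\<lambda>k. 1 * (qint (2 + int i) * can_even (\<beta> + 1) k + (- qint (\<beta> + 2 + int i)) * shift_seq (can_odd (\<beta> + 2)) k)
        + qint (1 + int i) * shift_seq (shift_seq (can_even (\<beta> + 3))) k)"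
    by (simp add: can_odd_shift algebra_simps)
  then show ?thesis
    using excoeff_step[of \<beta> "Suc i" "can_odd \<beta>"]
    by (simp only: excoeff_linear excoeff_shift) (simp add: excoeff_shift algebra_simps)
qed

lemma excoeff_can_even_rec':
  "qint (\<beta> + int i) * excoeff (can_even (\<beta> - 1)) 0 (\<beta> - 1) i =
     qint (1 + int i) * excoeff (can_odd \<beta>) (- 1) \<beta> (Suc i)
     + qint (\<beta> + int i) * excoeff (can_even (\<beta> + 1)) (- 1) (\<beta> + 1) i"
  using excoeff_can_even_rec[of "\<beta> - 1" i] by (simp add: add.commute)

lemma excoeff_can_odd_rec':
  "qint (\<beta> + 1 + int i) * excoeff (can_odd (\<beta> - 1)) 0 (\<beta> - 1) (Suc i) =
     qint (2 + int i) * excoeff (can_even \<beta>) (- 1) \<beta> (Suc (Suc i))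
     + qint (\<beta> + 1 + int i) * excoeff (can_odd (\<beta> + 1)) (- 1) (\<beta> + 1) (Suc i)
     + qint (1 + int i) * excoeff (can_even (\<beta> + 2)) (- 1) (\<beta> + 2) i"
  using excoeff_can_odd_rec_Suc[of "\<beta> - 1" i] by (simp add: add.commute)

text \<open>For \<open>\<beta> = 2 t\<close> this is the Gaussian binomial coefficient of \<open>t + h\<close> over \<open>h\<close> in the variable \<open>q\<^sup>-\<^sup>4\<close>.\<close>

definition gbinom :: "int \<Rightarrow> nat \<Rightarrow> Qq" where
  "gbinom \<beta> h = (\<Prod>l<h. qq powi (- \<beta>) * qint (\<beta> + 2 + 2 * int l) / qint (2 + 2 * int l))"

lemma gbinom_0 [simp]: "gbinom \<beta> 0 = 1"
  by (simp add: gbinom_def)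

lemma gbinom_Suc:
  "gbinom \<beta> (Suc h) = gbinom \<beta> h * (qq powi (- \<beta>) * qint (\<beta> + 2 + 2 * int h) / qint (2 + 2 * int h))"
  by (simp add: gbinom_def)

lemma gbinom_Suc_mult:
  "qint (2 + 2 * int h) * gbinom \<beta> (Suc h) = gbinom \<beta> h * (qq powi (- \<beta>) * qint (\<beta> + 2 + 2 * int h))"
  by (subst gbinom_Suc) simp

lemma gbinom_Suc_minus_2:
  "qint (2 + 2 * int h) * gbinom (\<beta> - 2) (Suc h) = qq powi (2 + 2 * int h - \<beta>) * qint \<beta> * gbinom \<beta> h"
proof (induction h)
  case (Suc h)
  have nz: "qint (2 + 2 * int h) \<noteq> 0" "qint (4 + 2 * int h) \<noteq> 0"
    by simp_all
  have "qint (2 + 2 * int (Suc h)) * gbinom (\<beta> - 2) (Suc (Suc h)) =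
     gbinom (\<beta> - 2) (Suc h) * (qq powi (2 - \<beta>) * qint (\<beta> + 2 + 2 * int h))"
    using nz by (subst gbinom_Suc) (simp add: field_simps)
  also have "\<dots> = (qint (2 + 2 * int h) * gbinom (\<beta> - 2) (Suc h)) *
     (qq powi (2 - \<beta>) * qint (\<beta> + 2 + 2 * int h) / qint (2 + 2 * int h))"
    using nz by (simp add: field_simps)
  also have "\<dots> = (qq powi (2 + 2 * int h - \<beta>) * qq powi (2 - \<beta>)) * qint \<beta> * gbinom \<beta> h *
     (qint (\<beta> + 2 + 2 * int h) / qint (2 + 2 * int h))"
    unfolding Suc.IH by simp
  also have "qq powi (2 + 2 * int h - \<beta>) * qq powi (2 - \<beta>) =
      qq powi (2 + 2 * int (Suc h) - \<beta>) * qq powi (- \<beta>)"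
    by (simp add: algebra_simps flip: qq_powi_add)
  finally show ?case
    by (simp add: gbinom_Suc)
qed (simp add: gbinom_Suc)

text \<open>For \<open>\<beta> = 2 * t\<close> the Pascal rule of Gaussian binomials with weight
  \<open>q^(-4 * t)\<close>. It is kept for every \<open>\<beta>\<close> because the closed forms
  below are.\<close>

lemma gbinom_pascal: "gbinom \<beta> (Suc h) = gbinom (\<beta> - 2) (Suc h) + qq powi (- 2 * \<beta>) * gbinom \<beta> h"
proof -
  have "qq powi (- \<beta>) * qint (\<beta> + 2 + 2 * int h) =
      qq powi (- \<beta>) * (qq powi (2 + 2 * int h) * qint \<beta> + qq powi (- \<beta>) * qint (2 + 2 * int h))"
    using qint_add[of \<beta> "2 + 2 * int h"] by (simp add: algebra_simps)
  also have "\<dots> = qq powi (2 + 2 * int h - \<beta>) * qint \<beta> + qq powi (- 2 * \<beta>) * qint (2 + 2 * int h)"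
    unfolding distrib_left mult.assoc[symmetric] qq_powi_add[symmetric] by (simp add: algebra_simps)
  finally have *: "qq powi (- \<beta>) * qint (\<beta> + 2 + 2 * int h) = \<dots>" .
  have "qint (2 + 2 * int h) * gbinom \<beta> (Suc h) =
     qq powi (2 + 2 * int h - \<beta>) * qint \<beta> * gbinom \<beta> h + qint (2 + 2 * int h) * (qq powi (- 2 * \<beta>) * gbinom \<beta> h)"
    unfolding gbinom_Suc_mult * by (simp only: distrib_left distrib_right mult_ac)
  also have "\<dots> = qint (2 + 2 * int h) * gbinom (\<beta> - 2) (Suc h) + qint (2 + 2 * int h) * (qq powi (- 2 * \<beta>) * gbinom \<beta> h)"
    unfolding gbinom_Suc_minus_2 ..
  also have "\<dots> = qint (2 + 2 * int h) * (gbinom (\<beta> - 2) (Suc h) + qq powi (- 2 * \<beta>) * gbinom \<beta> h)"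
    by (simp only: distrib_left)
  finally show ?thesis
    by simp
qed

text \<open>The four values have to be proved together: the contiguity relations express a value at
  \<open>\<delta> = - 1\<close> by values of smaller index in both families. Passing from
  \<open>\<delta> = 0\<close> to \<open>- 1\<close> lowers the argument of \<open>gbinom\<close> by
  2, in accordance with \<open>gbinom_pascal\<close>.\<close>

definition even_closed :: "nat \<Rightarrow> int \<Rightarrow> bool" where
  "even_closed h \<beta> \<longleftrightarrow>
     excoeff (can_even \<beta>) 0 \<beta> (2 * h) = qq powi (- int (h * (2 * h + 1))) * gbinom \<beta> h
   \<and> excoeff (can_even \<beta>) (- 1) \<beta> (2 * h) = qq powi (- int (h * (2 * h + 1))) * gbinom (\<beta> - 2) h
   \<and> excoeff (can_odd \<beta>) 0 \<beta> (2 * h) = qq powi (- int h * (2 * int h - 1)) * gbinom (\<beta> + 1) h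
   \<and> excoeff (can_odd \<beta>) (- 1) \<beta> (2 * h) = qq powi (- int h * (2 * int h - 1)) * gbinom (\<beta> - 1) h"

definition odd_closed :: "nat \<Rightarrow> int \<Rightarrow> bool" where
  "odd_closed h \<beta> \<longleftrightarrow>
     excoeff (can_even \<beta>) 0 \<beta> (Suc (2 * h)) = qq powi (- int ((h + 1) * (2 * h + 1)) - \<beta>) * gbinom \<beta> h
   \<and> excoeff (can_even \<beta>) (- 1) \<beta> (Suc (2 * h)) = 0
   \<and> excoeff (can_odd \<beta>) 0 \<beta> (Suc (2 * h)) = qq powi (- int (2 * h * h + h + 1) - \<beta>) * gbinom (\<beta> + 1) h
   \<and> excoeff (can_odd \<beta>) (- 1) \<beta> (Suc (2 * h)) = 0"

text \<open>The closed form at \<open>\<delta> = 0\<close> for \<open>\<beta> - 1\<close> coincides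
  with the one at \<open>\<delta> = - 1\<close> for \<open>\<beta> + 1\<close>, so these terms of
  the contiguity relation cancel and the new value at \<open>\<delta> = - 1\<close> is 0. The value
  at \<open>\<delta> = 0\<close> is what then remains of the Pascal rule.\<close>

lemma excoeff_odd_minus:
  assumes "\<And>\<beta>. even_closed h \<beta>" and "\<And>h'. h = Suc h' \<Longrightarrow> (\<And>\<beta>. odd_closed h' \<beta>)"
  shows "odd_closed h \<beta>"
proof -
  note E = assms(1)[unfolded even_closed_def]
  have 1: "excoeff (can_even \<beta>) (- 1) \<beta> (Suc (2 * h)) = 0" for \<beta>
  proof (cases h)
    case 0
    then show ?thesis
      by (simp add: excoeff_def can_even_def qprod_len_Suc gcoeff_Suc)
  next
    case (Suc h')
    have "excoeff (can_odd (\<beta> - 1)) 0 (\<beta> - 1) (2 * h) = excoeff (can_odd (\<beta> + 1)) (- 1) (\<beta> + 1) (2 * h)"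
      using E[of "\<beta> - 1"] E[of "\<beta> + 1"] by simp
    moreover have "2 * h = Suc (Suc (2 * h'))"
      by (simp add: Suc)
    \<comment> \<open>The relation for \<open>can_odd\<close> has one more term, which vanishes by
      the preceding odd index.\<close>
    moreover have "excoeff (can_even (\<beta> + 2)) (- 1) (\<beta> + 2) (Suc (2 * h')) = 0"
      using assms(2)[OF Suc, of "\<beta> + 2"] unfolding odd_closed_def by blast
    moreover have "qint (2 + int (Suc (2 * h'))) \<noteq> 0"
      by simp
    ultimately show ?thesis
      using excoeff_can_odd_rec'[of \<beta> "Suc (2 * h')"] by (simp only: add_cancel_left_left mult_zero_right add_0_right mult_eq_0_iff) simp
  qed
  have 2: "excoeff (can_odd \<beta>) (- 1) \<beta> (Suc (2 * h)) = 0" for \<beta>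
  proof -
    have "excoeff (can_even (\<beta> - 1)) 0 (\<beta> - 1) (2 * h) = excoeff (can_even (\<beta> + 1)) (- 1) (\<beta> + 1) (2 * h)"
      using E[of "\<beta> - 1"] E[of "\<beta> + 1"] by simp
    moreover have "qint (1 + int (2 * h)) \<noteq> 0"
      by simp
    ultimately show ?thesis
      using excoeff_can_even_rec'[of \<beta> "2 * h"] by simp
  qed
  have "qq powi (- \<beta> - 2 * 0 - int (2 * h) - 1) * qq powi (- int (h * (2 * h + 1))) =
      qq powi (- int ((h + 1) * (2 * h + 1)) - \<beta>)"
    "qq powi (- \<beta> - 2 * 0 - int (2 * h) - 1) * qq powi (- int h * (2 * int h - 1)) =
      qq powi (- int (2 * h * h + h + 1) - \<beta>)"
    by (rule qq_powi_mult_eqI, simp add: algebra_simps)+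
  with 1 2 excoeff_pascal[of "can_even \<beta>" 0 \<beta> "2 * h"] excoeff_pascal[of "can_odd \<beta>" 0 \<beta> "2 * h"] E[of \<beta>]
  show ?thesis
    by (simp only: odd_closed_def mult.assoc[symmetric]) simp
qed

text \<open>Since odd indices give 0 at \<open>\<delta> = - 1\<close>, the contiguity relations
  leave one known term for \<open>can_odd\<close> and two for \<open>can_even\<close>. The latter
  share the factor \<open>gbinom \<beta> h\<close> and combine by \<open>qint_add'\<close>. The
  Pascal rules of \<open>excoeff\<close> and \<open>gbinom\<close> then match at
  \<open>\<delta> = 0\<close>.\<close>

lemma excoeff_even_Suc:
  assumes "\<And>\<beta>. even_closed h \<beta>" and "\<And>\<beta>. odd_closed h \<beta>"
  shows "even_closed (Suc h) \<beta>"
proof -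
  note E = assms(1)[unfolded even_closed_def]
  note O = assms(2)[unfolded odd_closed_def]
  have nz: "qint (2 + 2 * int h) \<noteq> 0"
    by simp
  have 1: "excoeff (can_odd \<beta>) (- 1) \<beta> (Suc (Suc (2 * h))) = qq powi (- int (Suc h) * (2 * int (Suc h) - 1)) * gbinom (\<beta> - 1) (Suc h)" for \<beta>
  proof -
    have "qint (2 + 2 * int h) * excoeff (can_odd \<beta>) (- 1) \<beta> (Suc (Suc (2 * h))) =
       qint (\<beta> + 1 + 2 * int h) * (qq powi (- int ((h + 1) * (2 * h + 1)) - (\<beta> - 1)) * gbinom (\<beta> - 1) h)"
      using excoeff_can_even_rec'[of \<beta> "Suc (2 * h)"] O[of "\<beta> - 1"] O[of "\<beta> + 1"]
      by (simp add: algebra_simps)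
    also have "qq powi (- int ((h + 1) * (2 * h + 1)) - (\<beta> - 1)) =
        qq powi (- int (Suc h) * (2 * int (Suc h) - 1)) * qq powi (- (\<beta> - 1))"
      by (rule qq_powi_mult_eqI[symmetric]) (simp add: algebra_simps)
    also have "qint (\<beta> + 1 + 2 * int h) * (qq powi (- int (Suc h) * (2 * int (Suc h) - 1)) * qq powi (- (\<beta> - 1)) * gbinom (\<beta> - 1) h)
       = qq powi (- int (Suc h) * (2 * int (Suc h) - 1)) * (qint (2 + 2 * int h) * gbinom (\<beta> - 1) (Suc h))"
      unfolding gbinom_Suc_mult by (simp add: algebra_simps)
    finally show ?thesis
      using nz by (simp add: mult.left_commute)
  qed
  have 2: "excoeff (can_even \<beta>) (- 1) \<beta> (Suc (Suc (2 * h))) = qq powi (- int (Suc h * (2 * Suc h + 1))) * gbinom (\<beta> - 2) (Suc h)" for \<beta>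
  proof -
    have a: "qint (2 + 2 * int h) * excoeff (can_even \<beta>) (- 1) \<beta> (Suc (Suc (2 * h))) =
       (qint (\<beta> + 1 + 2 * int h) * qq powi (- int (2 * h * h + h + 1) - (\<beta> - 1)) 
        - qint (1 + 2 * int h) * qq powi (- int (h * (2 * h + 1)))) * gbinom \<beta> h"
      using excoeff_can_odd_rec'[of \<beta> "2 * h"] O[of "\<beta> - 1"] O[of "\<beta> + 1"] E[of "\<beta> + 2"]
      by (simp add: algebra_simps)
    have "qq powi (- int (2 * h * h + h + 1) - (\<beta> - 1)) = qq powi (- int (h * (2 * h + 1))) * qq powi (- \<beta>)"
      by (rule qq_powi_mult_eqI[symmetric]) (simp add: algebra_simps)
    moreover have "qint (\<beta> + 1 + 2 * int h) * qq powi (- \<beta>) - qint (1 + 2 * int h) = qq powi (- \<beta> - 1 - 2 * int h) * qint \<beta>"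
    proof -
      have "qint (\<beta> + 1 + 2 * int h) * qq powi (- \<beta>) =
          qq powi (- (1 + 2 * int h)) * qq powi (- \<beta>) * qint \<beta> + qq powi \<beta> * qq powi (- \<beta>) * qint (1 + 2 * int h)"
        using qint_add'[of \<beta> "1 + 2 * int h"] by (simp add: algebra_simps)
      moreover have "qq powi (- (1 + 2 * int h)) * qq powi (- \<beta>) = qq powi (- \<beta> - 1 - 2 * int h)"
        by (rule qq_powi_mult_eqI) simp
      moreover have "qq powi \<beta> * qq powi (- \<beta>) = qq powi 0"
        by (rule qq_powi_mult_eqI) simp
      ultimately show ?thesis
        by simp
    qed
    moreover have "qq powi (- int (h * (2 * h + 1))) * qq powi (- \<beta> - 1 - 2 * int h) =
        qq powi (- int (Suc h * (2 * Suc h + 1))) * qq powi (2 + 2 * int h - \<beta>)"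
      by (rule qq_powi_mult_eq_multI) (simp add: algebra_simps)
    ultimately have "(qint (\<beta> + 1 + 2 * int h) * qq powi (- int (2 * h * h + h + 1) - (\<beta> - 1)) 
        - qint (1 + 2 * int h) * qq powi (- int (h * (2 * h + 1)))) * gbinom \<beta> h =
        qq powi (- int (Suc h * (2 * Suc h + 1))) * (qint (2 + 2 * int h) * gbinom (\<beta> - 2) (Suc h))"
      unfolding gbinom_Suc_minus_2 by algebra
    with a show ?thesis
      using nz by (simp add: mult.left_commute)
  qed
  have e: "2 * Suc h = Suc (Suc (2 * h))"
    by simp
  have 3: "excoeff (can_even \<beta>) 0 \<beta> (Suc (Suc (2 * h))) = qq powi (- int (Suc h * (2 * Suc h + 1))) * gbinom \<beta> (Suc h)"
  proof -
    have "qq powi (- \<beta> - int (Suc (2 * h)) - 1) * qq powi (- int ((h + 1) * (2 * h + 1)) - \<beta>) =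
      qq powi (- int (Suc h * (2 * Suc h + 1))) * qq powi (- 2 * \<beta>)"
      by (rule qq_powi_mult_eq_multI) (simp add: algebra_simps)
    then show ?thesis
      using excoeff_pascal[of "can_even \<beta>" 0 \<beta> "Suc (2 * h)"] 2[of \<beta>] O[of \<beta>] gbinom_pascal[of \<beta> h]
      by (simp add: algebra_simps)
  qed
  have 4: "excoeff (can_odd \<beta>) 0 \<beta> (Suc (Suc (2 * h))) = qq powi (- int (Suc h) * (2 * int (Suc h) - 1)) * gbinom (\<beta> + 1) (Suc h)"
  proof -
    have "qq powi (- \<beta> - int (Suc (2 * h)) - 1) * qq powi (- int (2 * h * h + h + 1) - \<beta>) =
      qq powi (- int (Suc h) * (2 * int (Suc h) - 1)) * qq powi (- 2 * (\<beta> + 1))"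
      by (rule qq_powi_mult_eq_multI) (simp add: algebra_simps)
    then show ?thesis
      using excoeff_pascal[of "can_odd \<beta>" 0 \<beta> "Suc (2 * h)"] 1[of \<beta>] O[of \<beta>] gbinom_pascal[of "\<beta> + 1" h]
      by (simp add: algebra_simps)
  qed
  show ?thesis
    using 1[of \<beta>] 2[of \<beta>] 3 4 unfolding even_closed_def e by blast
qed

lemma excoeff_closed: "even_closed h \<beta> \<and> odd_closed h \<beta>"
proof (induction h arbitrary: \<beta>)
  case 0
  have "even_closed 0 \<beta>" for \<beta>
    by (simp add: even_closed_def)
  then show ?case
    by (auto intro: excoeff_odd_minus)
next
  case (Suc h)
  then have "even_closed (Suc h) \<beta>" for \<beta>
    by (blast intro: excoeff_even_Suc)
  then show ?case
    using Suc by (blast intro: excoeff_odd_minus)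
qed

section \<open>Integrality\<close>

definition int_eval :: "int poly \<Rightarrow> Qq" where
  "int_eval f = poly (map_poly of_int f) (inverse qq)"

lemma int_eval_0 [simp]: "int_eval 0 = 0"
  by (simp add: int_eval_def)

lemma int_eval_pCons [simp]: "int_eval (pCons c f) = of_int c + inverse qq * int_eval f"
  by (simp add: int_eval_def map_poly_pCons)

lemma int_eval_add: "int_eval (f + g) = int_eval f + int_eval g"
  by (induction f g rule: poly_induct2) (simp_all add: algebra_simps)

lemma int_eval_smult: "int_eval (smult c f) = of_int c * int_eval f"
  by (induction f) (simp_all add: algebra_simps)

lemma int_eval_mult: "int_eval (f * g) = int_eval f * int_eval g"
  by (induction f) (simp_all add: int_eval_add int_eval_smult algebra_simps)

definition Z_qinv :: "Qq set" where
  "Z_qinv = range int_eval"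

lemma qinv_Z_eq: "qinv_Z = (*) (inverse qq) ` Z_qinv"
  by (auto simp: qinv_Z_def Z_qinv_def int_eval_def)

lemma Z_qinv_add: "x \<in> Z_qinv \<Longrightarrow> y \<in> Z_qinv \<Longrightarrow> x + y \<in> Z_qinv"
  by (auto simp: Z_qinv_def simp flip: int_eval_add)

lemma Z_qinv_mult: "x \<in> Z_qinv \<Longrightarrow> y \<in> Z_qinv \<Longrightarrow> x * y \<in> Z_qinv"
  by (auto simp: Z_qinv_def simp flip: int_eval_mult)

lemma Z_qinv_of_int: "of_int c \<in> Z_qinv"
  unfolding Z_qinv_def by (rule range_eqI[of _ _ "[:c:]"]) simp

lemma Z_qinv_0: "0 \<in> Z_qinv" and Z_qinv_1: "1 \<in> Z_qinv"
  using Z_qinv_of_int[of 0] Z_qinv_of_int[of 1] by simp_all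

lemma Z_qinv_inverse_qq: "inverse qq \<in> Z_qinv"
  unfolding Z_qinv_def by (rule range_eqI[of _ _ "[:0, 1:]"]) simp

lemma Z_qinv_powi: "z \<le> 0 \<Longrightarrow> qq powi z \<in> Z_qinv"
proof -
  have "inverse qq ^ n \<in> Z_qinv" for n
    by (induction n) (simp_all add: Z_qinv_1 Z_qinv_mult Z_qinv_inverse_qq)
  moreover assume "z \<le> 0"
  ultimately show ?thesis
    by (cases "z = 0") (auto simp: power_int_def power_inverse Z_qinv_1)
qed

lemma qinv_Z_add: "x \<in> qinv_Z \<Longrightarrow> y \<in> qinv_Z \<Longrightarrow> x + y \<in> qinv_Z"
  by (auto simp: qinv_Z_eq Z_qinv_add simp flip: distrib_left)

lemma qinv_Z_mult: "x \<in> qinv_Z \<Longrightarrow> y \<in> Z_qinv \<Longrightarrow> x * y \<in> qinv_Z"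
  by (auto simp: qinv_Z_eq Z_qinv_mult mult.assoc)

lemma qinv_Z_mult': "x \<in> Z_qinv \<Longrightarrow> y \<in> qinv_Z \<Longrightarrow> x * y \<in> qinv_Z"
  using qinv_Z_mult[of y x] by (simp add: mult.commute)

lemma qinv_Z_0: "0 \<in> qinv_Z"
  using Z_qinv_0 by (auto simp: qinv_Z_eq)

lemma qinv_Z_diff: "x \<in> qinv_Z \<Longrightarrow> y \<in> qinv_Z \<Longrightarrow> x - y \<in> qinv_Z"
  using qinv_Z_add[of x "y * of_int (- 1)"] qinv_Z_mult[of y "of_int (- 1)"] Z_qinv_of_int[of "- 1"]
  by simp

lemma qinv_Z_powi: "z < 0 \<Longrightarrow> qq powi z \<in> qinv_Z"
proof -
  assume "z < 0"
  then have "qq powi z = inverse qq * qq powi (z + 1)"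
    by (simp add: power_int_add)
  moreover have "qq powi (z + 1) \<in> Z_qinv"
    using \<open>z < 0\<close> by (intro Z_qinv_powi) simp
  ultimately show ?thesis
    unfolding qinv_Z_eq by blast
qed

lemma qinv_Z_subset_Z_qinv: "x \<in> qinv_Z \<Longrightarrow> x \<in> Z_qinv"
  by (auto simp: qinv_Z_eq Z_qinv_mult Z_qinv_inverse_qq)

lemma gbinom_Z_qinv: "gbinom (2 * int t) h \<in> Z_qinv"
proof (induction t arbitrary: h)
  case 0
  have "gbinom 0 h = 1"
    by (auto simp: gbinom_def intro!: prod.neutral)
  then show ?case
    by (simp add: Z_qinv_1)
next
  case (Suc t)
  show ?case
  proof (induction h)
    case (Suc h)
    have "2 * int (Suc t) - 2 = 2 * int t"
      by simp
    then show ?case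
      using gbinom_pascal[of "2 * int (Suc t)" h] Suc.IH \<open>\<And>h. gbinom (2 * int t) h \<in> Z_qinv\<close>
      by (auto intro!: Z_qinv_add Z_qinv_mult Z_qinv_powi)
  qed (simp add: Z_qinv_1)
qed

lemma gbinom_Z_qinv_even: "even \<beta> \<Longrightarrow> \<beta> \<ge> 0 \<Longrightarrow> gbinom \<beta> h \<in> Z_qinv"
  using gbinom_Z_qinv[of "nat (\<beta> div 2)" h] by simp

lemma excoeff_qinv_Z_lift:
  assumes "d 0 = 1" and "\<beta> \<ge> 0" and "\<And>i. i > 0 \<Longrightarrow> excoeff d 0 \<beta> i \<in> qinv_Z"
  shows "i > 0 \<Longrightarrow> excoeff d (int \<delta>) \<beta> i \<in> qinv_Z"
proof (induction \<delta> arbitrary: i)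
  case (Suc \<delta>)
  \<comment> \<open>The second conjunct is what the negative power of \<open>q\<close> multiplies in
    the next step; it is weaker because the value at index 0 is 1.\<close>
  have "excoeff d (int (Suc \<delta>)) \<beta> (Suc i) \<in> qinv_Z \<and> excoeff d (int (Suc \<delta>)) \<beta> i \<in> Z_qinv" for i
  proof (induction i)
    case 0
    then show ?case
      using excoeff_pascal[of d "int (Suc \<delta>)" \<beta> 0] Suc.IH[of 1] assms
      by (auto intro!: qinv_Z_add qinv_Z_powi simp: Z_qinv_1)
  next
    case (Suc i)
    then show ?case
      using excoeff_pascal[of d "int (Suc \<delta>)" \<beta> "Suc i"] \<open>\<And>i. 0 < i \<Longrightarrow> excoeff d (int \<delta>) \<beta> i \<in> qinv_Z\<close> assms
      by (auto intro!: qinv_Z_add qinv_Z_mult[OF qinv_Z_powi] intro: qinv_Z_subset_Z_qinv)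
  qed
  then show ?case
    using Suc.prems by (cases i) simp_all
qed (use assms in simp)

lemma parity_cases:
  fixes i :: nat
  obtains h where "i = 2 * h" | h where "i = Suc (2 * h)"
  by (metis oddE evenE Suc_eq_plus1)

text \<open>For even \<open>\<beta>\<close> the factor \<open>gbinom \<beta> h\<close> of the closed
  forms is integral, and the power of \<open>q\<close> in front of it is negative for every positive
  index.\<close>

lemma excoeff_can_even_qinv_Z:
  assumes "even \<beta>" "\<beta> \<ge> 0" "\<delta> \<ge> 0" "i > 0"
  shows "excoeff (can_even \<beta>) \<delta> \<beta> i \<in> qinv_Z"
proof -
  have "excoeff (can_even \<beta>) 0 \<beta> i \<in> qinv_Z" if "i > 0" for i
  proof (rule parity_cases[of i])
    fix h assume "i = 2 * h"
    with that have "- int (h * (2 * h + 1)) < 0"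
      by (simp only: of_nat_0_less_iff neg_less_0_iff_less) simp
    then show ?thesis
      unfolding \<open>i = 2 * h\<close> using excoeff_closed[of h \<beta>] assms unfolding even_closed_def
      by (metis qinv_Z_mult qinv_Z_powi gbinom_Z_qinv_even)
  next
    fix h assume "i = Suc (2 * h)"
    moreover have "0 < int ((h + 1) * (2 * h + 1))"
      by (simp only: of_nat_0_less_iff) simp
    then have "- int ((h + 1) * (2 * h + 1)) - \<beta> < 0"
      using assms by linarith
    ultimately show ?thesis
      using excoeff_closed[of h \<beta>] assms unfolding odd_closed_def
      by (metis qinv_Z_mult qinv_Z_powi gbinom_Z_qinv_even)
  qed
  from excoeff_qinv_Z_lift[OF _ _ this, of i "nat \<delta>"] assms show ?thesis
    by simp
qed

text \<open>Here the closed forms contain \<open>gbinom (\<beta> + 1) h\<close>, so odd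
  \<open>\<beta>\<close> is the integral case.\<close>

lemma excoeff_can_odd_qinv_Z:
  assumes "odd \<beta>" "\<beta> \<ge> 0" "\<delta> \<ge> 0" "i > 0"
  shows "excoeff (can_odd \<beta>) \<delta> \<beta> i \<in> qinv_Z"
proof -
  have W: "gbinom (\<beta> + 1) h \<in> Z_qinv" for h
    using assms by (intro gbinom_Z_qinv_even) simp_all
  have "excoeff (can_odd \<beta>) 0 \<beta> i \<in> qinv_Z" if "i > 0" for i
  proof (rule parity_cases[of i])
    fix h assume "i = 2 * h"
    with that have "h > 0" by simp
    then have "int h * 1 \<le> int h * (2 * int h - 1)"
      by (intro mult_left_mono) simp_all
    with \<open>h > 0\<close> have "- int h * (2 * int h - 1) < 0"
      by simp
    then show ?thesis
      unfolding \<open>i = 2 * h\<close> using excoeff_closed[of h \<beta>] W[of h] unfolding even_closed_def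
      by (metis qinv_Z_mult qinv_Z_powi)
  next
    fix h assume "i = Suc (2 * h)"
    moreover have "0 \<le> int (2 * h * h + h)"
      by simp
    then have "- int (2 * h * h + h + 1) - \<beta> < 0"
      using assms by linarith
    ultimately show ?thesis
      using excoeff_closed[of h \<beta>] W[of h] unfolding odd_closed_def
      by (metis qinv_Z_mult qinv_Z_powi)
  qed
  from excoeff_qinv_Z_lift[OF _ _ this, of i "nat \<delta>"] assms show ?thesis
    by simp
qed

text \<open>At \<open>M = 0\<close> numerators and denominators cancel and only negative powers of
  \<open>q\<close> remain; the Pascal rule raises \<open>M\<close>. These are the arguments of the
  \<open>y\<close>-factor, with \<open>M = m - c\<close>.\<close>

lemma gcoeff_qinv_Z:
  assumes "\<gamma> \<ge> 0"
  shows "gcoeff (int M + \<gamma>) (- \<gamma>) (Suc r) \<in> qinv_Z"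
proof (induction M arbitrary: r)
  case 0
  have "gcoeff \<gamma> (- \<gamma>) r \<in> Z_qinv \<and> gcoeff \<gamma> (- \<gamma>) (Suc r) \<in> qinv_Z"
  proof (induction r)
    case 0
    then show ?case
      using assms qinv_Z_powi[of "- \<gamma> - 1"] by (simp add: gcoeff_Suc Z_qinv_1)
  next
    case (Suc r)
    have "gcoeff \<gamma> (- \<gamma>) (Suc (Suc r)) = gcoeff \<gamma> (- \<gamma>) (Suc r) * qq powi (- \<gamma> - int (Suc r) - 1)"
      using qint_eq_0_iff[of "1 + int (Suc r)"] by (subst gcoeff_Suc) simp
    with Suc show ?case
      using assms by (auto intro!: qinv_Z_mult Z_qinv_powi intro: qinv_Z_subset_Z_qinv)
  qed
  then show ?case
    by simp
next
  case (Suc M)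
  show ?case
  proof (induction r)
    case 0
    then show ?case
      using gcoeff_pascal[of "int (Suc M) + \<gamma>" "- \<gamma>" 0] Suc[of 0] assms
      by (auto intro!: qinv_Z_add qinv_Z_powi simp: algebra_simps)
  next
    case (Suc r)
    have "int (Suc M) + \<gamma> - 1 = int M + \<gamma>"
      by simp
    then show ?case
      using gcoeff_pascal[of "int (Suc M) + \<gamma>" "- \<gamma>" "Suc r"] Suc \<open>\<And>r. gcoeff (int M + \<gamma>) (- \<gamma>) (Suc r) \<in> qinv_Z\<close> assms
      by (auto intro!: qinv_Z_add qinv_Z_mult' Z_qinv_powi)
  qed
qed

lemma gcoeff_neg_qinv_Z:
  assumes "\<gamma> \<ge> 0" "M \<ge> 0" "r > 0"
  shows "gcoeff (M + \<gamma>) (- \<gamma>) r \<in> qinv_Z"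
  using gcoeff_qinv_Z[of \<gamma> "nat M" "r - 1"] assms by simp

section \<open>The bar involution\<close>

lemma const_Qq_1 [simp]: "const_Qq 1 = 1"
  by (simp add: const_Qq_def flip: one_pCons)

lemma const_Qq_minus: "const_Qq (- c) = - const_Qq c"
  using const_Qq_add[of c "- c"] by (simp add: eq_neg_iff_add_eq_0 add.commute)

lemma bar_0 [simp]: "bar 0 = 0"
  using bar_const[of 0] by simp

lemma bar_1 [simp]: "bar 1 = 1"
  using bar_const[of 1] by simp

lemma bar_minus: "bar (- x) = - bar x"
  using bar_add[of x "- x"] by (simp add: eq_neg_iff_add_eq_0 add.commute)

lemma bar_diff: "bar (x - y) = bar x - bar y"
  using bar_add[of x "- y"] by (simp add: bar_minus)

lemma bar_inverse: "bar (inverse x) = inverse (bar x)"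
proof (cases "x = 0")
  case False
  then have "bar x * bar (inverse x) = 1"
    by (simp flip: bar_mult)
  then show ?thesis
    by (metis inverse_unique)
qed simp

lemma bar_divide: "bar (x / y) = bar x / bar y"
  by (simp add: divide_inverse bar_mult bar_inverse)

lemma bar_power: "bar (x ^ n) = bar x ^ n"
  by (induction n) (simp_all add: bar_mult)

lemma bar_powi: "bar (qq powi z) = qq powi (- z)"
proof (cases "z \<ge> 0")
  case True
  then show ?thesis
    by (cases "z = 0") (simp_all add: power_int_def bar_power power_inverse)
next
  case False
  then show ?thesis
    by (simp add: power_int_def bar_power power_inverse bar_inverse)
qed

lemma bar_qint [simp]: "bar (qint r) = qint r"
proof -
  have "bar (qint r) = (qq powi (- r) - qq powi r) / (inverse qq - qq)"
    by (simp add: qint_def bar_divide bar_diff bar_powi bar_inverse)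
  also have "\<dots> = qint r"
    using minus_divide_divide[of "qq powi r - qq powi (- r)" "qq - inverse qq"] by (simp add: qint_def)
  finally show ?thesis .
qed

lemma bar_prod: "bar (prod f A) = (\<Prod>x\<in>A. bar (f x))"
  by (induction A rule: infinite_finite_induct) (simp_all add: bar_mult)

lemma bar_qfact [simp]: "bar (qfact r) = qfact r"
  by (simp add: qfact_def bar_prod)

lemma bar_qprod_len [simp]: "bar (qprod_len x l) = qprod_len x l"
  by (simp add: qprod_len_def bar_prod)

lemma bar_can_even [simp]: "bar (can_even \<beta> k) = can_even \<beta> k"
  by (simp add: can_even_def bar_divide)

lemma bar_can_odd [simp]: "bar (can_odd \<beta> k) = can_odd \<beta> k"
  by (simp add: can_odd_def bar_divide bar_mult)

lemma of_int_eq_const_Qq: "of_int c = const_Qq (of_int c)"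
proof -
  have "of_nat n = const_Qq (of_nat n)" for n
    by (induction n) (simp_all add: const_Qq_add)
  then show ?thesis
    by (cases c rule: int_cases2) (simp_all add: const_Qq_minus)
qed

lemma int_eval_eq_subst_inv: "int_eval f = subst_inv (map_poly of_int f)"
  by (induction f) (simp_all add: map_poly_pCons of_int_eq_const_Qq)

lemma bar_subst_inv: "bar (subst_inv f) = to_fract f"
proof (induction f)
  case (pCons c f)
  have "to_fract (pCons c f) = const_Qq c + qq * to_fract f"
    using poly_map_const_Qq[of "pCons c f"] poly_map_const_Qq[of f] by (simp add: map_poly_pCons)
  with pCons show ?case
    by (simp add: bar_add bar_mult bar_inverse)
qed simp

text \<open>Clearing negative powers gives the reversed polynomial, which turns an equation in the
  field into one between polynomials.\<close>

lemma qq_power_subst_inv: "qq ^ degree f * subst_inv f = to_fract (reflect_poly f)"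
proof -
  define P where "P = map_poly const_Qq f"
  have deg: "degree P = degree f"
    unfolding P_def by (rule degree_map_poly) simp
  have "reflect_poly P = map_poly const_Qq (reflect_poly f)"
    by (rule poly_eqI) (simp add: coeff_reflect_poly deg[unfolded P_def] coeff_map_poly P_def)
  then have "to_fract (reflect_poly f) = poly (reflect_poly P) qq"
    by (simp add: poly_map_const_Qq)
  also have "\<dots> = qq ^ degree P * poly P (inverse qq)"
    by (rule poly_reflect_poly_nz) simp
  finally show ?thesis
    unfolding deg by (simp only: P_def subst_inv_def)
qed

text \<open>Invariance of \<open>q^(-1) f(q^(-1))\<close> means that it equals
  \<open>q f(q)\<close>. Multiplied by \<open>q^(deg f + 1)\<close>, the two sides are polynomials
  of degree at most \<open>deg f\<close> and, for nonzero \<open>f\<close>, of degree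
  \<open>2 deg f + 2\<close>.\<close>

lemma qinv_Z_bar_invariant:
  assumes "x \<in> qinv_Z" and "bar x = x"
  shows "x = 0"
proof -
  from assms(1) obtain f :: "int poly" where x: "x = inverse qq * int_eval f"
    by (auto simp: qinv_Z_eq Z_qinv_def)
  have X: "qq ^ n = to_fract (monom 1 n)" for n
    by (induction n) (simp_all add: qq_def monom_Suc to_fract_def fract_collapse flip: to_fract_mult)
  define g :: "rat poly" where "g = map_poly of_int f"
  have "qq * to_fract g = inverse qq * subst_inv g"
    using assms(2) unfolding x int_eval_eq_subst_inv g_def[symmetric]
    by (simp add: bar_mult bar_inverse bar_subst_inv)
  then have "qq * (qq * to_fract g) = subst_inv g"
    by (simp add: field_simps)
  then have "qq ^ degree g * (qq * (qq * to_fract g)) = to_fract (reflect_poly g)"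
    by (simp only: qq_power_subst_inv)
  moreover have "qq ^ degree g * (qq * (qq * to_fract g)) = qq ^ (degree g + 2) * to_fract g"
    by (simp add: power_add power2_eq_square)
  ultimately have "to_fract (monom 1 (degree g + 2) * g) = to_fract (reflect_poly g)"
    by (simp only: X to_fract_mult)
  then have eq: "monom 1 (degree g + 2) * g = reflect_poly g"
    by (simp only: to_fract_eq_iff)
  have "g = 0"
  proof (rule ccontr)
    assume "g \<noteq> 0"
    then have "degree (monom 1 (degree g + 2) * g) = degree g + 2 + degree g"
      by (subst degree_mult_eq) (simp_all add: degree_monom_eq monom_eq_0_iff)
    with eq degree_reflect_poly_le[of g] show False
      by simp
  qed
  then show ?thesis
    by (simp add: x int_eval_eq_subst_inv g_def)
qed

section \<open>Inversion\<close>

text \<open>The coefficients of the first formula of the theorem, with both parities in one sequence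
  so that inversion becomes a single convolution identity.\<close>

definition inv_coeff :: "int \<Rightarrow> nat \<Rightarrow> Qq" where
  "inv_coeff \<beta> k = (if odd k then qint \<beta> * qprod_len (\<beta> - int k + 2) (k - 1)
     else qprod_len (\<beta> - int k + 1) k) / qfact (int k)"

text \<open>The parameter of the element with index \<open>k\<close> is \<open>\<beta> + k\<close>, so for odd \<open>\<beta>\<close> it is even exactly when \<open>k\<close>
  is odd.\<close>

definition can_coeff :: "int \<Rightarrow> nat \<Rightarrow> nat \<Rightarrow> Qq" where
  "can_coeff \<beta> k = (if odd k then can_even (\<beta> + int k) else can_odd (\<beta> + int k))"

text \<open>The run in \<open>inv_coeff \<beta> k\<close> stops one step of 2 before the run in
  \<open>can_coeff \<beta> k (r - k)\<close> starts, so they join to a single run, of length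
  \<open>r - 1\<close> in both parities.\<close>

lemma inv_coeff_can_coeff:
  assumes "k \<le> r" "r > 0"
  shows "inv_coeff \<beta> k * can_coeff \<beta> k (r - k) * (qfact (int k) * qfact (int (r - k))) =
    (if odd k then qint \<beta> * qprod_len (\<beta> - int k + 2) (r - 1)
     else qint (\<beta> + int r - 1) * qprod_len (\<beta> - int k + 1) (r - 1))"
proof (cases "odd k")
  case True
  then have "k > 0"
    by (simp add: odd_pos)
  then have k: "k - 1 + (r - k) = r - 1"
    using assms by simp
  have "\<beta> - int k + 2 + 2 * int (k - 1) = \<beta> + int k"
    using \<open>k > 0\<close> by simp
  with k have "qprod_len (\<beta> - int k + 2) (r - 1) =
      qprod_len (\<beta> - int k + 2) (k - 1) * qprod_len (\<beta> + int k) (r - k)"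
    by (metis qprod_len_add)
  with True show ?thesis
    by (simp add: inv_coeff_def can_coeff_def can_even_def)
next
  case False
  show ?thesis
  \<comment> \<open>For \<open>k = r\<close> the coefficient \<open>can_odd _ 0 = 1\<close> supplies
    no factor \<open>[\<beta> + r - 1]\<close>; this factor is then the last one of the run in
    \<open>inv_coeff\<close>.\<close>
  proof (cases "k = r")
    case True
    have "qprod_len (\<beta> - int k + 1) k = qprod_len (\<beta> - int k + 1) (r - 1) * qint (\<beta> + int r - 1)"
    proof -
      have "\<beta> - int r + 1 + 2 * int (r - 1) = \<beta> + int r - 1" "Suc (r - 1) = r"
        using assms by simp_all
      then show ?thesis
        unfolding True by (metis qprod_len_Suc)
    qed
    with False True show ?thesis
      by (simp add: inv_coeff_def can_coeff_def)
  next
    case False': False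
    then have "k + (r - k - 1) = r - 1"
      using assms by simp
    then have "qprod_len (\<beta> - int k + 1) (r - 1) =
        qprod_len (\<beta> - int k + 1) k * qprod_len (\<beta> + int k + 1) (r - k - 1)"
      using qprod_len_add[of "\<beta> - int k + 1" k "r - k - 1"] by (simp add: algebra_simps)
    with False False' show ?thesis
      using assms by (simp add: inv_coeff_def can_coeff_def can_odd_def of_nat_diff)
  qed
qed

text \<open>The sum is telescoping: the partial sums have a closed product form, whose factor
  \<open>[r - k]\<close> vanishes for \<open>k = r\<close>.\<close>

lemma inv_coeff_can_coeff_partial_sum:
  assumes "r > 0"
  shows "k \<le> r \<Longrightarrow> (\<Sum>l\<le>k. (- 1) ^ l * inv_coeff \<beta> l * can_coeff \<beta> l (r - l)) *
      (qint (int r) * qfact (int k) * qfact (int (r - k))) =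
    qint (int r - int k) * (if odd k then - qprod_len (\<beta> - int k) r
      else qint (\<beta> + int r - 1 - int k) * qprod_len (\<beta> - int k + 1) (r - 1))"
proof (induction k)
  case 0
  then show ?case
    using inv_coeff_can_coeff[of 0 r \<beta>] assms by (simp add: algebra_simps)
next
  case (Suc k)
  define S where "S = (\<Sum>l\<le>k. (- 1) ^ l * inv_coeff \<beta> l * can_coeff \<beta> l (r - l))"
  define K where "K = int (Suc k)"
  have f1: "qfact K = qint K * qfact (int k)"
    using qfact_rec[of K] by (simp add: K_def)
  have f2: "qfact (int (r - k)) = qint (int r - int k) * qfact (int (r - Suc k))"
    using qfact_rec[of "int (r - k)"] Suc.prems by (simp add: of_nat_diff algebra_simps)
  have nz: "qint (int r - int k) \<noteq> 0"
    using Suc.prems by simp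
  \<comment> \<open>The factor \<open>[r - k]\<close> of the closed form cancels against the one in
    \<open>qfact (int (r - k))\<close>, so both summands carry the factorials of step
    \<open>Suc k\<close>.\<close>
  have IH: "S * (qint (int r) * qfact (int k) * qfact (int (r - Suc k))) =
      (if odd k then - qprod_len (\<beta> - int k) r
        else qint (\<beta> + int r - 1 - int k) * qprod_len (\<beta> - int k + 1) (r - 1))" (is "_ = ?X")
  proof -
    have "qint (int r - int k) * (S * (qint (int r) * qfact (int k) * qfact (int (r - Suc k)))) =
        qint (int r - int k) * ?X"
      using Suc.IH Suc.prems unfolding f2 S_def by (simp only: Suc_leD mult_ac)
    then show ?thesis
      using nz by simp
  qed
  have t: "inv_coeff \<beta> (Suc k) * can_coeff \<beta> (Suc k) (r - Suc k) * (qfact K * qfact (int (r - Suc k))) =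
    (if odd (Suc k) then qint \<beta> * qprod_len (\<beta> - K + 2) (r - 1)
     else qint (\<beta> + int r - 1) * qprod_len (\<beta> - K + 1) (r - 1))" (is "_ = ?T")
    unfolding K_def using inv_coeff_can_coeff[OF Suc.prems assms] .
  have "(\<Sum>l\<le>Suc k. (- 1) ^ l * inv_coeff \<beta> l * can_coeff \<beta> l (r - l)) *
      (qint (int r) * qfact (int (Suc k)) * qfact (int (r - Suc k)))
    = qint K * (S * (qint (int r) * qfact (int k) * qfact (int (r - Suc k))))
      + (- 1) ^ Suc k * qint (int r) * (inv_coeff \<beta> (Suc k) * can_coeff \<beta> (Suc k) (r - Suc k) * (qfact K * qfact (int (r - Suc k))))"
    unfolding sum.atMost_Suc S_def[symmetric] K_def[symmetric] distrib_right f1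
    by (simp only: mult_ac)
  also have "\<dots> = qint K * ?X + (- 1) ^ Suc k * qint (int r) * ?T"
    unfolding IH t ..
  also have "\<dots> = qint (int r - K) * (if odd (Suc k) then - qprod_len (\<beta> - K) r
      else qint (\<beta> + int r - 1 - K) * qprod_len (\<beta> - K + 1) (r - 1))"
  proof (cases "odd k")
    case True
    have 1: "qint (int r) * qint (\<beta> + int r - 1) =
        qint K * qint (\<beta> + 2 * int r - 1 - K) + qint (int r - K) * qint (\<beta> + int r - 1 - K)"
      by (rule qint_exchange_eqI) simp_all
    have "qprod_len (\<beta> - int k) r = qprod_len (\<beta> - K + 1) (r - 1) * qint (\<beta> + 2 * int r - 1 - K)"
      using qprod_len_Suc[of "\<beta> - int k" "r - 1"] assms
      by (simp add: K_def of_nat_diff algebra_simps)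
    moreover have "qint K * - (A * qint (\<beta> + 2 * int r - 1 - K)) + qint (int r) * (qint (\<beta> + int r - 1) * A) =
        qint (int r - K) * (qint (\<beta> + int r - 1 - K) * A)" for A
      using 1 by algebra
    ultimately show ?thesis
      using True by simp
  next
    case False
    have 1: "qint (int r) * qint \<beta> = qint K * qint (\<beta> + int r - K) + qint (int r - K) * qint (\<beta> - K)"
      by (rule qint_exchange_eqI) simp_all
    have 2: "qprod_len (\<beta> - K) r = qint (\<beta> - K) * qprod_len (\<beta> - K + 2) (r - 1)"
      using qprod_len_Suc_left[of "\<beta> - K" "r - 1"] assms by simp
    have 3: "\<beta> + int r - 1 - int k = \<beta> + int r - K" "\<beta> - int k + 1 = \<beta> - K + 2"
      by (simp_all add: K_def)
    have "qint K * (qint (\<beta> + int r - K) * A) - qint (int r) * (qint \<beta> * A) =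
        qint (int r - K) * - (qint (\<beta> - K) * A)" for A
      using 1 by algebra
    with False show ?thesis
      unfolding 2 3 by simp
  qed
  finally show ?case
    by (simp only: K_def)
qed

lemma inv_coeff_can_coeff_inverse:
  assumes "r > 0"
  shows "(\<Sum>k\<le>r. inv_coeff \<beta> k * ((- 1) ^ (r - k) * can_coeff \<beta> k (r - k))) = 0"
proof -
  have "(\<Sum>l\<le>r. (- 1) ^ l * inv_coeff \<beta> l * can_coeff \<beta> l (r - l)) = 0"
    using inv_coeff_can_coeff_partial_sum[OF assms, of r \<beta>] assms by simp
  moreover have "(\<Sum>k\<le>r. inv_coeff \<beta> k * ((- 1) ^ (r - k) * can_coeff \<beta> k (r - k))) =
      (- 1) ^ r * (\<Sum>l\<le>r. (- 1) ^ l * inv_coeff \<beta> l * can_coeff \<beta> l (r - l))"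
    unfolding sum_distrib_left
  proof (rule sum.cong)
    fix k assume "k \<in> {..r}"
    then have "(- 1 :: Qq) ^ r = (- 1) ^ (r - k) * (- 1) ^ k"
      by (simp flip: power_add)
    moreover have "(- 1 :: Qq) ^ k * (- 1) ^ k = 1"
      by (simp flip: power_add)
    ultimately show "inv_coeff \<beta> k * ((- 1) ^ (r - k) * can_coeff \<beta> k (r - k)) =
        (- 1) ^ r * ((- 1) ^ k * inv_coeff \<beta> k * can_coeff \<beta> k (r - k))"
      by (simp add: mult.assoc)
  qed simp
  ultimately show ?thesis
    by simp
qed

lemma inv_coeff_0 [simp]: "inv_coeff \<beta> 0 = 1" and can_coeff_0 [simp]: "can_coeff \<beta> k 0 = 1"
  by (simp_all add: inv_coeff_def can_coeff_def)

section \<open>Relations in the quantum group\<close>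

lemma fconst_commute: "fconst c * x = x * fconst c"
proof (induction x rule: update_induct)
  case const
  then show ?case
    by simp
next
  case (update f a b)
  have "Poly_Mapping.update a b f = f + Poly_Mapping.single a b"
    using update(1) by (intro poly_mapping_eqI) (auto simp: lookup_update lookup_add lookup_single in_keys_iff)
  with update show ?case
    by (simp add: distrib_left distrib_right fconst_def mult_single mult.commute)
qed

lemma scal_add: "scal (c + d) = scal c + scal d"
  by transfer (simp add: Uq_eq_def fconst_def single_add Uq_ideal.zero)

lemma scal_mult: "scal (c * d) = scal c * scal d"
  by transfer (simp add: Uq_eq_def fconst_def mult_single Uq_ideal.zero)

lemma scal_1 [simp]: "scal 1 = 1"
  by transfer (simp add: Uq_eq_def fconst_def Uq_ideal.zero)

lemma scal_0 [simp]: "scal 0 = 0"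
  by transfer (simp add: Uq_eq_def fconst_def Uq_ideal.zero)

lemma scal_commute: "scal c * x = x * scal c"
  by transfer (simp add: Uq_eq_def fconst_commute Uq_ideal.zero)

lemma scal_mult_left_commute: "x * (scal c * y) = scal c * (x * y)"
  by (metis mult.assoc scal_commute)

lemma Uq_rel: "r \<in> Uq_rels \<Longrightarrow> r \<in> Uq_ideal"
  using Uq_ideal.rel[of r 1 1] by simp

lemma Kinv_K: "Kinv i * K i = 1"
  by transfer (auto simp: Uq_eq_def Uq_rels_def intro!: Uq_rel)

lemma K_F_Kinv: "K i * F j * Kinv i = scal (qq powi (- cartan i j)) * F j"
  by transfer (unfold Uq_eq_def Uq_rels_def, intro Uq_rel, unfold Uq_rels_def, blast)

lemma qq_mult_powi: "qq * qq powi s = qq powi (s + 1)"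
  by (simp add: power_int_add)

lemma K_F: "K i * F j = scal (qq powi (- cartan i j)) * F j * K i"
  using arg_cong[OF K_F_Kinv, of "\<lambda>x. x * K i" i j] by (simp add: mult.assoc Kinv_K)

lemma E_F_commute: "i \<noteq> j \<Longrightarrow> E i * F j = F j * E i"
proof (transfer, unfold Uq_eq_def, intro Uq_rel)
  fix i j :: idx
  assume "i \<noteq> j"
  then have "fgen (GE i) * fgen (GF j) - fgen (GF j) * fgen (GE i) =
      fgen (GE i) * fgen (GF j) - fgen (GF j) * fgen (GE i)
        - (if i = j then fconst (inverse (qq - inverse qq)) * (fgen (GK i) - fgen (GKinv i)) else 0)"
    by simp
  then show "fgen (GE i) * fgen (GF j) - fgen (GF j) * fgen (GE i) \<in> Uq_rels"
    unfolding Uq_rels_def by blast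
qed

lemma E_F_same: "E i * F i = F i * E i + scal (inverse (qq - inverse qq)) * (K i - Kinv i)"
proof (transfer, unfold Uq_eq_def, intro Uq_rel)
  fix i :: idx
  have "fgen (GE i) * fgen (GF i) - (fgen (GF i) * fgen (GE i)
        + fconst (inverse (qq - inverse qq)) * (fgen (GK i) - fgen (GKinv i))) =
      fgen (GE i) * fgen (GF i) - fgen (GF i) * fgen (GE i)
        - (if i = i then fconst (inverse (qq - inverse qq)) * (fgen (GK i) - fgen (GKinv i)) else 0)"
    by simp
  then show "fgen (GE i) * fgen (GF i) - (fgen (GF i) * fgen (GE i)
        + fconst (inverse (qq - inverse qq)) * (fgen (GK i) - fgen (GKinv i))) \<in> Uq_rels"
    unfolding Uq_rels_def by blast
qed

lemma dpow_0 [simp]: "dpow x 0 = 1"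
  by (simp add: dpow_def)

lemma dpow_neg [simp]: "r < 0 \<Longrightarrow> dpow x r = 0"
  by (simp add: dpow_def)

text \<open>Valid for all integers: at \<open>r = - 1\<close> the factor \<open>[0]\<close> matches
  \<open>dpow x (- 1) = 0\<close>, which avoids boundary cases for the monomials.\<close>

lemma mult_dpow: "x * dpow x r = scal (qint (r + 1)) * dpow x (r + 1)"
proof (cases "r < 0")
  case True
  then show ?thesis
    by (cases "r = - 1") simp_all
next
  case False
  then have "qfact (r + 1) = qint (r + 1) * qfact r" "qint (r + 1) \<noteq> 0"
    by (simp_all add: qfact_rec)
  then have *: "scal (qint (r + 1)) * scal (inverse (qfact (r + 1))) = scal (inverse (qfact r))"
    by (simp add: mult.assoc[symmetric] flip: scal_mult)
  from False have "dpow x (r + 1) = scal (inverse (qfact (r + 1))) * (x * x ^ nat r)"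
    by (simp add: dpow_def nat_add_distrib)
  then have "scal (qint (r + 1)) * dpow x (r + 1) = scal (inverse (qfact r)) * (x * x ^ nat r)"
    by (simp only: mult.assoc[symmetric] *)
  with False show ?thesis
    by (simp add: dpow_def scal_mult_left_commute[of x])
qed

section \<open>Modules\<close>

context Uq_module
begin

abbreviation scale :: "Qq \<Rightarrow> 'v \<Rightarrow> 'v" (infixr "\<cdot>" 75) where
  "c \<cdot> v \<equiv> act (scal c) v"

sublocale vs: vector_space "\<lambda>c v. c \<cdot> v"
  by unfold_locales (simp_all add: act_add_right scal_add act_add_left scal_mult act_mult act_one)

lemma act_zero_right [simp]: "act x 0 = 0"
  using act_add_right[of x 0 0] by simp

lemma act_zero_left [simp]: "act 0 v = 0"
  using act_add_left[of 0 0 v] by simp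

declare act_one [simp]

lemma act_diff_left: "act (x - y) v = act x v - act y v"
  using act_add_left[of "x - y" y v] by simp

lemma act_diff_right: "act x (v - w) = act x v - act x w"
  using act_add_right[of x "v - w" w] by simp

lemma act_sum: "act x (sum f A) = (\<Sum>i\<in>A. act x (f i))"
  by (induction A rule: infinite_finite_induct) (simp_all add: act_add_right)

lemma act_scale: "act x (c \<cdot> v) = c \<cdot> act x v"
  by (simp add: scal_commute flip: act_mult)

lemmas act_scales = act_scale[of "E i" for i] act_scale[of "F i" for i] act_scale[of "K i" for i]
  act_scale[of "Kinv i" for i] act_scale[of "dpow x r" for x r] act_scale[of "x ^ r" for x r]

lemma act_dpow_step: "act x (act (dpow x r) v) = qint (r + 1) \<cdot> act (dpow x (r + 1)) v"
  by (simp add: mult_dpow flip: act_mult)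

text \<open>Both \<open>B\<^sub>1\<close> and \<open>B\<^sub>2\<close> act on suitable families of monomials \<open>v\<close> in this way: the summand \<open>F\<^sub>i\<close> keeps
  the second index of \<open>v\<close> and the summand with \<open>E\<^bsub>\<tau>i\<^esub>\<close> raises it.\<close>

lemma dpow_expand:
  assumes "\<And>a i. i \<le> a \<Longrightarrow> act x (v a i) =
      qint (1 + int a - int i) \<cdot> v (Suc a) i
      + (qq powi (2 * int a - D - int i) * qint (N + int i + 1)) \<cdot> v (Suc a) (Suc i)"
  shows "act (dpow x (int a)) (v 0 0) = (\<Sum>i\<le>a. gcoeff (D - int a) (N - D + int a) i \<cdot> v a i)"
proof (induction a)
  case 0
  then show ?case
    by (simp add: act_one)
next
  case (Suc a)
  define C where "C = gcoeff (D - int a) (N - D + int a)"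
  define C' where "C' = gcoeff (D - int (Suc a)) (N - D + int (Suc a))"
  \<comment> \<open>Raising \<open>a\<close> keeps the sum \<open>N\<close> of the two arguments of
    \<open>gcoeff\<close>, so only powers of \<open>q\<close> appear.\<close>
  have C': "C' i = qq powi (int i) * C i" for i
    using gcoeff_translate[of "D - int a" "- 1" "N - D + int a" i]
    by (simp add: C_def C'_def algebra_simps)
  have coeff0: "C 0 * qint (1 + int a - int 0) = qint (1 + int a) * C' 0"
    by (simp add: C_def C'_def)
  \<comment> \<open>Comparison of the coefficients of \<open>v (Suc a) (Suc i)\<close>: the
    recursion of \<open>gcoeff\<close> expresses the \<open>E\<close>-contribution by
    \<open>C (Suc i)\<close>, and \<open>qint_add'\<close> splits \<open>[1 + a]\<close>.\<close>
  have coeff: "C (Suc i) * qint (1 + int a - int (Suc i))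
      + C i * (qq powi (2 * int a - D - int i) * qint (N + int i + 1)) = qint (1 + int a) * C' (Suc i)" for i
  proof -
    have "C (Suc i) * qint (1 + int i) = C i * (qq powi (int a - D - int i - 1) * qint (N + int i + 1))"
      using qint_eq_0_iff[of "1 + int i"] by (simp add: C_def gcoeff_Suc algebra_simps)
    then have "qq powi (1 + int a) * (C (Suc i) * qint (1 + int i)) =
        C i * ((qq powi (1 + int a) * qq powi (int a - D - int i - 1)) * qint (N + int i + 1))"
      by (simp add: mult_ac)
    also have "qq powi (1 + int a) * qq powi (int a - D - int i - 1) = qq powi (2 * int a - D - int i)"
      by (rule qq_powi_mult_eqI) simp
    finally have 1: "C i * (qq powi (2 * int a - D - int i) * qint (N + int i + 1)) =
        qq powi (1 + int a) * (C (Suc i) * qint (1 + int i))" ..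
    have "qint (1 + int a) = qq powi (- int (Suc i)) * qint (1 + int a - int (Suc i))
        + qq powi (1 + int a - int (Suc i)) * qint (int (Suc i))"
      using qint_add'[of "1 + int a - int (Suc i)" "int (Suc i)"] by (simp only: diff_add_cancel)
    then have "qq powi (int (Suc i)) * qint (1 + int a) =
        (qq powi (int (Suc i)) * qq powi (- int (Suc i))) * qint (1 + int a - int (Suc i))
        + (qq powi (int (Suc i)) * qq powi (1 + int a - int (Suc i))) * qint (int (Suc i))"
      by (simp only: distrib_left mult.assoc)
    also have "qq powi (int (Suc i)) * qq powi (- int (Suc i)) = qq powi 0"
      by (rule qq_powi_mult_eqI) simp
    also have "qq powi (int (Suc i)) * qq powi (1 + int a - int (Suc i)) = qq powi (1 + int a)"
      by (rule qq_powi_mult_eqI) simp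
    finally have 2: "qq powi (int (Suc i)) * qint (1 + int a) =
        qint (1 + int a - int (Suc i)) + qq powi (1 + int a) * qint (1 + int i)"
      by simp
    have "qint (1 + int a) * C' (Suc i) = C (Suc i) * (qq powi (int (Suc i)) * qint (1 + int a))"
      unfolding C' by (simp only: mult_ac)
    then show ?thesis
      unfolding 1 2 by (simp only: distrib_left mult_ac)
  qed
  have "qint (1 + int a) \<cdot> act (dpow x (int (Suc a))) (v 0 0) = act x (act (dpow x (int a)) (v 0 0))"
    by (simp add: act_dpow_step add.commute)
  also have "\<dots> = (\<Sum>i\<le>a. C i \<cdot> act x (v a i))"
    unfolding Suc.IH act_sum C_def act_scale ..
  also have "\<dots> = (\<Sum>i\<le>a. (C i * qint (1 + int a - int i)) \<cdot> v (Suc a) i)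
      + (\<Sum>i\<le>a. (C i * (qq powi (2 * int a - D - int i) * qint (N + int i + 1))) \<cdot> v (Suc a) (Suc i))"
    unfolding sum.distrib[symmetric]
    by (rule sum.cong) (simp_all add: assms act_add_right)
  also have "(\<Sum>i\<le>a. (C i * qint (1 + int a - int i)) \<cdot> v (Suc a) i) =
      (\<Sum>i\<le>Suc a. (C i * qint (1 + int a - int i)) \<cdot> v (Suc a) i)"
    by simp
  also have "\<dots> = (C 0 * qint (1 + int a - int 0)) \<cdot> v (Suc a) 0
      + (\<Sum>i\<le>a. (C (Suc i) * qint (1 + int a - int (Suc i))) \<cdot> v (Suc a) (Suc i))"
    by (rule sum.atMost_Suc_shift)
  finally have "qint (1 + int a) \<cdot> act (dpow x (int (Suc a))) (v 0 0) =
      (C 0 * qint (1 + int a - int 0)) \<cdot> v (Suc a) 0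
      + (\<Sum>i\<le>a. (C (Suc i) * qint (1 + int a - int (Suc i))
          + C i * (qq powi (2 * int a - D - int i) * qint (N + int i + 1))) \<cdot> v (Suc a) (Suc i))"
    by (simp only: scal_add act_add_left sum.distrib add.assoc)
  also have "\<dots> = qint (1 + int a) \<cdot> (C' 0 \<cdot> v (Suc a) 0 + (\<Sum>i\<le>a. C' (Suc i) \<cdot> v (Suc a) (Suc i)))"
    unfolding coeff0 coeff by (simp only: act_add_right act_sum scal_mult act_mult)
  also have "C' 0 \<cdot> v (Suc a) 0 + (\<Sum>i\<le>a. C' (Suc i) \<cdot> v (Suc a) (Suc i)) = (\<Sum>i\<le>Suc a. C' i \<cdot> v (Suc a) i)"
    by (rule sum.atMost_Suc_shift[symmetric])
  finally show ?case
    unfolding C'_def by (simp only: vs.scale_left_imp_eq[of "qint (1 + int a)"] vs.scale_cancel_left) simp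
qed

section \<open>Weight vectors and the commutation of \<open>E\<close> with divided powers of
  \<open>F\<close>\<close>

definition weight :: "'v \<Rightarrow> int \<Rightarrow> int \<Rightarrow> bool" where
  "weight v s t \<longleftrightarrow> act (K I1) v = qq powi s \<cdot> v \<and> act (K I2) v = qq powi t \<cdot> v"

lemma weight_0 [simp]: "weight 0 s t"
  by (simp add: weight_def)

lemma weight_scale: "weight v s t \<Longrightarrow> weight (c \<cdot> v) s t"
  by (simp add: weight_def act_scales mult.commute)

lemma act_K_F: "act (K i) (act (F j) v) = qq powi (- cartan i j) \<cdot> act (F j) (act (K i) v)"
  by (simp add: K_F flip: act_mult) (simp add: mult.assoc)

lemma weight_F1: "weight v s t \<Longrightarrow> weight (act (F I1) v) (s - 2) (t + 1)"
  by (simp add: weight_def act_K_F act_scales cartan_def qq_powi_eq_iff qq_mult_powi flip: qq_powi_add)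

lemma weight_F2: "weight v s t \<Longrightarrow> weight (act (F I2) v) (s + 1) (t - 2)"
  by (simp add: weight_def act_K_F act_scales cartan_def qq_powi_eq_iff qq_mult_powi flip: qq_powi_add)

lemma weight_dpow_F1: "weight v s t \<Longrightarrow> weight (act (dpow (F I1) r) v) (s - 2 * r) (t + r)"
proof (cases "r < 0")
  case False
  assume v: "weight v s t"
  have "weight (act (dpow (F I1) (int k)) v) (s - 2 * int k) (t + int k)" for k
  proof (induction k)
    case (Suc k)
    have "weight (inverse (qint (int k + 1)) \<cdot> act (F I1) (act (dpow (F I1) (int k)) v)) (s - 2 * int k - 2) (t + int k + 1)"
      by (intro weight_scale weight_F1 Suc)
    then show ?case
      using qint_eq_0_iff[of "int k + 1"] by (simp add: act_dpow_step add_ac algebra_simps)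
  qed (simp add: act_one v)
  from this[of "nat r"] False show ?thesis
    by simp
qed simp

lemma weight_dpow_F2: "weight v s t \<Longrightarrow> weight (act (dpow (F I2) r) v) (s + r) (t - 2 * r)"
proof (cases "r < 0")
  case False
  assume v: "weight v s t"
  have "weight (act (dpow (F I2) (int k)) v) (s + int k) (t - 2 * int k)" for k
  proof (induction k)
    case (Suc k)
    have "weight (inverse (qint (int k + 1)) \<cdot> act (F I2) (act (dpow (F I2) (int k)) v)) (s + int k + 1) (t - 2 * int k - 2)"
      by (intro weight_scale weight_F2 Suc)
    then show ?case
      using qint_eq_0_iff[of "int k + 1"] by (simp add: act_dpow_step add_ac algebra_simps)
  qed (simp add: act_one v)
  from this[of "nat r"] False show ?thesis
    by simp
qed simp

lemma act_Kinv: "act (K i) v = qq powi s \<cdot> v \<Longrightarrow> act (Kinv i) v = qq powi (- s) \<cdot> v"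
proof -
  assume K: "act (K i) v = qq powi s \<cdot> v"
  have "qq powi s \<cdot> act (Kinv i) v = act (Kinv i) (act (K i) v)"
    by (simp add: K act_scales)
  also have "\<dots> = v"
    by (simp add: Kinv_K act_one flip: act_mult)
  finally have "qq powi (- s) \<cdot> (qq powi s \<cdot> act (Kinv i) v) = qq powi (- s) \<cdot> v"
    by simp
  then show ?thesis
    by (simp flip: qq_powi_add)
qed

lemma act_E_F_other: "i \<noteq> j \<Longrightarrow> act (E i) (act (F j) v) = act (F j) (act (E i) v)"
  by (simp add: E_F_commute flip: act_mult)

lemma act_E_F_same:
  assumes "act (K i) v = qq powi s \<cdot> v"
  shows "act (E i) (act (F i) v) = act (F i) (act (E i) v) + qint s \<cdot> v"
proof -
  have "act (E i) (act (F i) v) = act (F i) (act (E i) v)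
      + inverse (qq - inverse qq) \<cdot> (qq powi s \<cdot> v - qq powi (- s) \<cdot> v)"
    by (simp add: E_F_same act_add_left act_diff_left assms act_Kinv[OF assms] flip: act_mult)
      (simp add: act_mult act_diff_left assms act_Kinv[OF assms])
  also have "inverse (qq - inverse qq) \<cdot> (qq powi s \<cdot> v - qq powi (- s) \<cdot> v) = qint s \<cdot> v"
    by (simp add: qint_def divide_inverse mult.commute flip: vs.scale_left_diff_distrib)
  finally show ?thesis .
qed

lemma act_E_dpow_F_other: "i \<noteq> j \<Longrightarrow> act (E i) (act (dpow (F j) r) v) = act (dpow (F j) r) (act (E i) v)"
proof (cases "r < 0")
  case False
  assume "i \<noteq> j"
  have "act (E i) (act (F j ^ k) v) = act (F j ^ k) (act (E i) v)" for k
    by (induction k) (simp_all add: act_one act_mult act_E_F_other[OF \<open>i \<noteq> j\<close>])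
  with False show ?thesis
    by (simp add: dpow_def act_mult act_scales)
qed simp

lemma K_dpow_F_same:
  assumes "act (K i) v = qq powi s \<cdot> v"
  shows "act (K i) (act (dpow (F i) (int k)) v) = qq powi (s - 2 * int k) \<cdot> act (dpow (F i) (int k)) v"
proof -
  have "act (K i) (act (F i ^ k) v) = qq powi (s - 2 * int k) \<cdot> act (F i ^ k) v"
  proof (induction k)
    case (Suc k)
    then show ?case
      by (simp add: act_mult act_K_F act_scales cartan_def algebra_simps flip: qq_powi_add)
  qed (simp add: assms act_one)
  then show ?thesis
    by (simp add: dpow_def act_mult act_scales mult.commute)
qed

text \<open>The commutator of \<open>E i\<close> with the divided power involves \<open>K i\<close>
  only, so the eigenvalue of \<open>v\<close> determines it. The induction step is
  \<open>[k + 1] [s - k] = [k] [s - k + 1] + [s - 2 k]\<close>.\<close>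

lemma act_E_dpow_F_same:
  assumes v: "act (K i) v = qq powi s \<cdot> v"
  shows "act (E i) (act (dpow (F i) r) v) =
    act (dpow (F i) r) (act (E i) v) + qint (s - r + 1) \<cdot> act (dpow (F i) (r - 1)) v"
proof (cases "r < 0")
  case False
  have "act (E i) (act (dpow (F i) (int k)) v) =
    act (dpow (F i) (int k)) (act (E i) v) + qint (s - int k + 1) \<cdot> act (dpow (F i) (int k - 1)) v" for k
  proof (induction k)
    case (Suc k)
    define G where "G k = act (dpow (F i) k)" for k
    have "qint (int k + 1) \<cdot> act (E i) (G (int k + 1) v) = act (E i) (act (F i) (G (int k) v))"
      by (simp add: G_def act_dpow_step act_scales)
    also have "\<dots> = act (F i) (act (E i) (G (int k) v)) + qint (s - 2 * int k) \<cdot> G (int k) v"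
      unfolding G_def by (rule act_E_F_same[OF K_dpow_F_same[OF v]])
    also have "\<dots> = qint (int k + 1) \<cdot> G (int k + 1) (act (E i) v)
        + ((qint (s - int k + 1) * qint (int k)) \<cdot> G (int k) v + qint (s - 2 * int k) \<cdot> G (int k) v)"
      by (simp add: Suc.IH G_def act_add_right act_scales act_dpow_step)
    also have "(qint (s - int k + 1) * qint (int k)) \<cdot> G (int k) v + qint (s - 2 * int k) \<cdot> G (int k) v =
        (qint (int k + 1) * qint (s - int k)) \<cdot> G (int k) v"
    proof -
      have "qint (int k + 1) * qint (s - int k) =
          qint (int k) * qint (s - int k + 1) + qint 1 * qint (s - 2 * int k)"
        by (rule qint_exchange_eqI) simp_all
      then have "qint (int k + 1) * qint (s - int k) = qint (s - int k + 1) * qint (int k) + qint (s - 2 * int k)"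
        by (simp add: mult.commute)
      then show ?thesis
        by (simp only: vs.scale_left_distrib)
    qed
    finally have "qint (int k + 1) \<cdot> act (E i) (G (int k + 1) v) =
        qint (int k + 1) \<cdot> (G (int k + 1) (act (E i) v) + qint (s - int k) \<cdot> G (int k) v)"
      by (simp add: act_add_right)
    then have "act (E i) (G (int k + 1) v) = G (int k + 1) (act (E i) v) + qint (s - int k) \<cdot> G (int k) v"
      using qint_eq_0_iff[of "int k + 1"] by (simp only: vs.scale_cancel_left) simp
    then show ?case
      by (simp add: G_def add.commute)
  qed (simp add: act_one)
  from this[of "nat r"] False show ?thesis
    by simp
qed simp

end

context simple_highest_weight_module
begin

section \<open>Monomials\<close>

abbreviation Fm :: "int \<Rightarrow> int \<Rightarrow> int \<Rightarrow> 'v" where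
  "Fm \<equiv> F_mon act \<eta>"

lemma Fm_eq: "Fm a b c = act (dpow (F I1) a) (act (dpow (F I2) b) (act (dpow (F I1) c) \<eta>))"
  by (simp add: F_mon_def act_mult)

lemma Fm_neg [simp]: "a < 0 \<Longrightarrow> Fm a b c = 0" "b < 0 \<Longrightarrow> Fm a b c = 0" "c < 0 \<Longrightarrow> Fm a b c = 0"
  by (simp_all add: Fm_eq)

lemma Fm_nonzero: "Fm a b c \<noteq> 0 \<Longrightarrow> 0 \<le> a \<and> 0 \<le> b \<and> 0 \<le> c"
  using Fm_neg by (meson not_le)

lemma weight_\<eta>: "weight \<eta> m n"
  by (simp add: weight_def hw_K1 hw_K2)

lemma weight_F2F1: "weight (act (dpow (F I2) b) (act (dpow (F I1) c) \<eta>)) (m + b - 2 * c) (n - 2 * b + c)"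
  using weight_dpow_F2[OF weight_dpow_F1[OF weight_\<eta>, of c], of b] by (simp add: algebra_simps)

lemma weight_Fm: "weight (Fm a b c) (m - 2 * a + b - 2 * c) (n + a - 2 * b + c)"
  using weight_dpow_F1[OF weight_F2F1, of a b c] by (simp add: Fm_eq algebra_simps)

lemma F1_Fm: "act (F I1) (Fm a b c) = qint (a + 1) \<cdot> Fm (a + 1) b c"
  by (simp add: Fm_eq act_dpow_step)

lemma F2_Fm: "act (F I2) (Fm 0 b c) = qint (b + 1) \<cdot> Fm 0 (b + 1) c"
  by (simp add: Fm_eq act_dpow_step)

lemma E2_Fm: "act (E I2) (Fm a b c) = qint (n + c - b + 1) \<cdot> Fm a (b - 1) c"
proof -
  have "act (E I2) (act (dpow (F I1) c) \<eta>) = 0"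
    by (simp add: act_E_dpow_F_other hw_E)
  moreover have "act (K I2) (act (dpow (F I1) c) \<eta>) = qq powi (n + c) \<cdot> act (dpow (F I1) c) \<eta>"
    using weight_dpow_F1[OF weight_\<eta>, of c] by (simp add: weight_def)
  ultimately show ?thesis
    by (simp only: Fm_eq act_E_dpow_F_same act_E_dpow_F_other idx.distinct not_False_eq_True act_scales
        act_zero_right add_0)
qed

lemma E1_Fm:
  "act (E I1) (Fm a b c) =
     qint (m - c + 1) \<cdot> Fm a b (c - 1) + qint (m - 2 * c + b - a + 1) \<cdot> Fm (a - 1) b c"
proof -
  have "act (E I1) (act (dpow (F I1) c) \<eta>) = qint (m - c + 1) \<cdot> act (dpow (F I1) (c - 1)) \<eta>"
    by (simp add: act_E_dpow_F_same[OF hw_K1] hw_E)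
  moreover have "act (K I1) (act (dpow (F I2) b) (act (dpow (F I1) c) \<eta>)) =
      qq powi (m + b - 2 * c) \<cdot> act (dpow (F I2) b) (act (dpow (F I1) c) \<eta>)"
    using weight_F2F1[of b c] by (simp add: weight_def)
  moreover have "m + b - 2 * c - a + 1 = m - 2 * c + b - a + 1"
    by simp
  ultimately show ?thesis
    by (simp only: Fm_eq act_E_dpow_F_same act_E_dpow_F_other idx.distinct not_False_eq_True act_scales)
qed

section \<open>Expansion of \<open>B\<close>-monomials in \<open>F\<close>-monomials\<close>

lemma B1_Fm:
  "act (B \<sigma> I1) (Fm a b c) = qint (a + 1) \<cdot> Fm (a + 1) b c
     + (qq powi (\<sigma> I1 - (m - 2 * a + b - 2 * c)) * qint (n + c - b + 1)) \<cdot> Fm a (b - 1) c"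
proof -
  have "act (Kinv I1) (Fm a b c) = qq powi (- (m - 2 * a + b - 2 * c)) \<cdot> Fm a b c"
    by (rule act_Kinv) (use weight_Fm[of a b c] in \<open>simp add: weight_def\<close>)
  then have "act (B \<sigma> I1) (Fm a b c) = qint (a + 1) \<cdot> Fm (a + 1) b c
     + (qq powi \<sigma> I1 * (qq powi (- (m - 2 * a + b - 2 * c)) * qint (n + c - b + 1))) \<cdot> Fm a (b - 1) c"
    by (simp only: B_def act_add_left act_mult tau.simps F1_Fm act_scales E2_Fm vs.scale_scale)
  also have "qq powi \<sigma> I1 * (qq powi (- (m - 2 * a + b - 2 * c)) * qint (n + c - b + 1)) =
      qq powi (\<sigma> I1 - (m - 2 * a + b - 2 * c)) * qint (n + c - b + 1)"
    unfolding mult.assoc[symmetric] by (subst qq_powi_mult_eqI[OF refl]) (simp only: diff_conv_add_uminus)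
  finally show ?thesis .
qed

text \<open>With left exponent 0, \<open>F I2\<close> simply raises \<open>b\<close>, and the second
  term of \<open>E1_Fm\<close> disappears.\<close>

lemma B2_Fm:
  "act (B \<sigma> I2) (Fm 0 b c) = qint (b + 1) \<cdot> Fm 0 (b + 1) c
     + (qq powi (\<sigma> I2 - (n - 2 * b + c)) * qint (m - c + 1)) \<cdot> Fm 0 b (c - 1)"
proof -
  have "act (Kinv I2) (Fm 0 b c) = qq powi (- (n - 2 * b + c)) \<cdot> Fm 0 b c"
    by (rule act_Kinv) (use weight_Fm[of 0 b c] in \<open>simp add: weight_def\<close>)
  moreover have "act (E I1) (Fm 0 b c) = qint (m - c + 1) \<cdot> Fm 0 b (c - 1)"
    by (simp add: E1_Fm)
  ultimately have "act (B \<sigma> I2) (Fm 0 b c) = qint (b + 1) \<cdot> Fm 0 (b + 1) c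
     + (qq powi \<sigma> I2 * (qq powi (- (n - 2 * b + c)) * qint (m - c + 1))) \<cdot> Fm 0 b (c - 1)"
    by (simp only: B_def act_add_left act_mult tau.simps F2_Fm act_scales vs.scale_scale)
  also have "qq powi \<sigma> I2 * (qq powi (- (n - 2 * b + c)) * qint (m - c + 1)) =
      qq powi (\<sigma> I2 - (n - 2 * b + c)) * qint (m - c + 1)"
    unfolding mult.assoc[symmetric] by (subst qq_powi_mult_eqI[OF refl]) (simp only: diff_conv_add_uminus)
  finally show ?thesis .
qed

text \<open>\<open>E I2\<close> annihilates \<open>F1^(c) \<eta>\<close>, so
  \<open>B \<sigma> I1\<close> acts on it as \<open>F I1\<close>. Since \<open>B1_Fm\<close> raises
  the left exponent, the proof passes through the exponents \<open>1, 0, c\<close>.\<close>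

lemma dpow_B1_hw: "act (dpow (B \<sigma> I1) (int c)) \<eta> = Fm 0 0 (int c)"
proof (induction c)
  case (Suc c)
  have "qint (int c + 1) \<cdot> act (dpow (B \<sigma> I1) (int c + 1)) \<eta> = act (B \<sigma> I1) (Fm 0 0 (int c))"
    by (simp add: Suc flip: act_dpow_step)
  also have "\<dots> = qint 1 \<cdot> Fm 1 0 (int c)"
    by (simp add: B1_Fm)
  also have "\<dots> = act (F I1) (Fm 0 0 (int c))"
    by (simp add: F1_Fm)
  also have "\<dots> = qint (int c + 1) \<cdot> Fm 0 0 (int c + 1)"
    by (simp add: Fm_eq act_dpow_step)
  finally have "act (dpow (B \<sigma> I1) (int c + 1)) \<eta> = Fm 0 0 (int c + 1)"
    by (simp only: vs.scale_cancel_left qint_eq_0_iff) simp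
  then show ?case
    by (simp add: add.commute)
qed (simp add: Fm_eq)

lemma dpow_B2_Fm:
  "act (dpow (B \<sigma> I2) (int b)) (Fm 0 0 c) =
    (\<Sum>j\<le>b. gcoeff (n + c - \<sigma> I2 - int b) (m - c - (n + c - \<sigma> I2) + int b) j \<cdot> Fm 0 (int b - int j) (c - int j))"
proof -
  have "act (dpow (B \<sigma> I2) (int b)) (Fm 0 (int 0 - int 0) (c - int 0)) =
    (\<Sum>j\<le>b. gcoeff (n + c - \<sigma> I2 - int b) (m - c - (n + c - \<sigma> I2) + int b) j \<cdot> Fm 0 (int b - int j) (c - int j))"
  \<comment> \<open>Here \<open>v a i = Fm 0 (a - i) (c - i)\<close>,
    \<open>D = n + c - \<sigma> I2\<close> and \<open>N = m - c\<close>.\<close>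
  proof (rule dpow_expand)
    fix a i :: nat
    have "1 + int a - int i = int a - int i + 1"
      "2 * int a - (n + c - \<sigma> I2) - int i = \<sigma> I2 - (n - 2 * (int a - int i) + (c - int i))"
      "m - c + int i + 1 = m - (c - int i) + 1" "int (Suc a) - int i = int a - int i + 1"
      "int (Suc a) - int (Suc i) = int a - int i" "c - int (Suc i) = c - int i - 1"
      by simp_all
    then show "act (B \<sigma> I2) (Fm 0 (int a - int i) (c - int i)) =
        qint (1 + int a - int i) \<cdot> Fm 0 (int (Suc a) - int i) (c - int i)
        + (qq powi (2 * int a - (n + c - \<sigma> I2) - int i) * qint (m - c + int i + 1)) \<cdot>
          Fm 0 (int (Suc a) - int (Suc i)) (c - int (Suc i))"
      by (simp only: B2_Fm)
  qed
  then show ?thesis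
    by simp
qed

lemma dpow_B1_Fm:
  "act (dpow (B \<sigma> I1) (int a)) (Fm 0 b c) =
    (\<Sum>i\<le>a. gcoeff (m + b - 2 * c - \<sigma> I1 - int a) (n + c - b - (m + b - 2 * c - \<sigma> I1) + int a) i \<cdot>
      Fm (int a - int i) (b - int i) c)"
proof -
  have "act (dpow (B \<sigma> I1) (int a)) (Fm (int 0 - int 0) (b - int 0) c) =
    (\<Sum>i\<le>a. gcoeff (m + b - 2 * c - \<sigma> I1 - int a) (n + c - b - (m + b - 2 * c - \<sigma> I1) + int a) i \<cdot>
      Fm (int a - int i) (b - int i) c)"
  \<comment> \<open>Here \<open>v a i = Fm (a - i) (b - i) c\<close>,
    \<open>D = m + b - 2 * c - \<sigma> I1\<close> and \<open>N = n + c - b\<close>.\<close>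
  proof (rule dpow_expand)
    fix a i :: nat
    have "1 + int a - int i = int a - int i + 1"
      "2 * int a - (m + b - 2 * c - \<sigma> I1) - int i = \<sigma> I1 - (m - 2 * (int a - int i) + (b - int i) - 2 * c)"
      "n + c - b + int i + 1 = n + c - (b - int i) + 1" "int (Suc a) - int i = int a - int i + 1"
      "int (Suc a) - int (Suc i) = int a - int i" "b - int (Suc i) = b - int i - 1"
      by simp_all
    then show "act (B \<sigma> I1) (Fm (int a - int i) (b - int i) c) =
        qint (1 + int a - int i) \<cdot> Fm (int (Suc a) - int i) (b - int i) c
        + (qq powi (2 * int a - (m + b - 2 * c - \<sigma> I1) - int i) * qint (n + c - b + int i + 1)) \<cdot>
          Fm (int (Suc a) - int (Suc i)) (b - int (Suc i)) c"
      by (simp only: B1_Fm)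
  qed
  then show ?thesis
    by simp
qed

text \<open>\<open>B \<sigma> I1\<close> acts after \<open>B \<sigma> I2\<close> has lowered
  \<open>b\<close> and \<open>c\<close> by \<open>j\<close>. This moves \<open>\<delta>\<close> to
  \<open>\<delta> + j\<close> and \<open>\<beta>\<close> to \<open>\<beta> - j\<close>, and
  \<open>gcoeff_translate\<close> turns it into the mixed power of \<open>q\<close>. The sum of the
  parameters being 1 allows the second factor to be expressed by \<open>\<gamma>\<close>.\<close>

lemma B_mon_expand:
  assumes "c \<le> b" and "\<sigma> I1 + \<sigma> I2 = 1"
    and \<beta>: "\<beta> = n - m + int a - 2 * int b + 3 * int c + \<sigma> I1"
    and \<delta>: "\<delta> = m + int b - 2 * int c - \<sigma> I1 - int a"
    and \<gamma>: "\<gamma> = \<beta> + int b - int a - int c - 1"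
  shows "B_mon \<sigma> act \<eta> (int a) (int b) (int c) =
    (\<Sum>i\<le>a. \<Sum>j\<le>c. (gcoeff \<delta> \<beta> i * qq powi (- int i * int j) * gcoeff (m - int c + \<gamma>) (- \<gamma>) j) \<cdot>
      Fm (int a - int i) (int b - int i - int j) (int c - int j))"
proof -
  have *: "n + int c - \<sigma> I2 - int b = m - int c + \<gamma>" "m - int c - (n + int c - \<sigma> I2) + int b = - \<gamma>"
    using assms(2) by (simp_all add: \<beta> \<gamma>)
  have "B_mon \<sigma> act \<eta> (int a) (int b) (int c) =
      act (dpow (B \<sigma> I1) (int a)) (act (dpow (B \<sigma> I2) (int b)) (Fm 0 0 (int c)))"
    by (simp add: B_mon_def act_mult dpow_B1_hw)
  also have "act (dpow (B \<sigma> I2) (int b)) (Fm 0 0 (int c)) =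
      (\<Sum>j\<le>b. gcoeff (m - int c + \<gamma>) (- \<gamma>) j \<cdot> Fm 0 (int b - int j) (int c - int j))"
    by (simp only: dpow_B2_Fm *)
  also have "\<dots> = (\<Sum>j\<le>c. gcoeff (m - int c + \<gamma>) (- \<gamma>) j \<cdot> Fm 0 (int b - int j) (int c - int j))"
    using assms(1) by (intro sum.mono_neutral_right) auto
  also have "act (dpow (B \<sigma> I1) (int a)) \<dots> = (\<Sum>j\<le>c. \<Sum>i\<le>a.
      (gcoeff \<delta> \<beta> i * qq powi (- int i * int j) * gcoeff (m - int c + \<gamma>) (- \<gamma>) j) \<cdot>
      Fm (int a - int i) (int b - int i - int j) (int c - int j))"
    unfolding act_sum
  proof (rule sum.cong)
    fix j
    have 1: "m + (int b - int j) - 2 * (int c - int j) - \<sigma> I1 - int a = \<delta> + int j"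
      "n + (int c - int j) - (int b - int j) - (m + (int b - int j) - 2 * (int c - int j) - \<sigma> I1) + int a = \<beta> - int j"
      by (simp_all add: \<beta> \<delta>)
    have 2: "gcoeff (\<delta> + int j) (\<beta> - int j) i = qq powi (- int i * int j) * gcoeff \<delta> \<beta> i" for i
      unfolding gcoeff_translate by (simp add: mult.commute)
    have 3: "int b - int j - int i = int b - int i - int j" for i
      by simp
    show "act (dpow (B \<sigma> I1) (int a)) (gcoeff (m - int c + \<gamma>) (- \<gamma>) j \<cdot> Fm 0 (int b - int j) (int c - int j)) =
      (\<Sum>i\<le>a. (gcoeff \<delta> \<beta> i * qq powi (- int i * int j) * gcoeff (m - int c + \<gamma>) (- \<gamma>) j) \<cdot>
        Fm (int a - int i) (int b - int i - int j) (int c - int j))"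
      unfolding act_scales dpow_B1_Fm 1 2 3 act_sum vs.scale_scale by (simp only: mult_ac)
  qed simp
  finally show ?thesis
    by (subst sum.swap)
qed

section \<open>Linear independence of monomials\<close>

lemma sum_Fm_shift:
  assumes "A \<ge> 1"
  shows "(\<Sum>c\<in>{0..A}. u c \<cdot> Fm (A - c) b (c - 1)) = (\<Sum>c\<in>{0..A - 1}. u (c + 1) \<cdot> Fm (A - 1 - c) b c)"
proof -
  have "(\<Sum>c\<in>{0..A}. u c \<cdot> Fm (A - c) b (c - 1)) = (\<Sum>c\<in>{1..A}. u c \<cdot> Fm (A - c) b (c - 1))"
    by (rule sum.mono_neutral_right) auto
  also have "\<dots> = (\<Sum>c\<in>{0..A - 1}. u (c + 1) \<cdot> Fm (A - 1 - c) b c)"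
    by (rule sum.reindex_bij_witness[where i = "\<lambda>c. c + 1" and j = "\<lambda>c. c - 1"]) auto
  finally show ?thesis .
qed

lemma sum_Fm_top:
  "(\<Sum>c\<in>{0..A}. u c \<cdot> Fm (A - c - 1) b c) = (\<Sum>c\<in>{0..A - 1}. u c \<cdot> Fm (A - 1 - c) b c)"
proof -
  have "(\<Sum>c\<in>{0..A}. u c \<cdot> Fm (A - c - 1) b c) = (\<Sum>c\<in>{0..A - 1}. u c \<cdot> Fm (A - c - 1) b c)"
    by (rule sum.mono_neutral_right) auto
  then show ?thesis
    by (simp add: algebra_simps)
qed

lemma E2_sum_Fm:
  "act (E I2) (\<Sum>c\<in>X. g c \<cdot> Fm (A - c) b c) =
     (\<Sum>c\<in>X. (g c * qint (n + c - b + 1)) \<cdot> Fm (A - c) (b - 1) c)"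
  by (simp add: act_sum act_scales E2_Fm)

lemma E1_sum_Fm:
  assumes "A \<ge> 1"
  shows "act (E I1) (\<Sum>c\<in>{0..A}. g c \<cdot> Fm (A - c) b c) =
     (\<Sum>c\<in>{0..A - 1}. (g (c + 1) * qint (m - c) + g c * qint (m - c + b - A + 1)) \<cdot> Fm (A - 1 - c) b c)"
proof -
  have "m - 2 * c + b - (A - c) + 1 = m - c + b - A + 1" for c
    by simp
  then have "act (E I1) (\<Sum>c\<in>{0..A}. g c \<cdot> Fm (A - c) b c) =
     (\<Sum>c\<in>{0..A}. (g c * qint (m - c + 1)) \<cdot> Fm (A - c) b (c - 1))
     + (\<Sum>c\<in>{0..A}. (g c * qint (m - c + b - A + 1)) \<cdot> Fm (A - c - 1) b c)"
    by (simp only: act_sum act_scales E1_Fm act_add_right sum.distrib vs.scale_scale)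
  moreover have "m - (c + 1) + 1 = m - c" for c
    by simp
  ultimately show ?thesis
    by (simp only: sum_Fm_shift[OF assms] sum_Fm_top vs.scale_left_distrib sum.distrib)
qed

text \<open>If \<open>b > A\<close> then \<open>E\<^sub>2\<close> reduces \<open>b\<close>. If \<open>b = A\<close> then \<open>E\<^sub>1\<close> and \<open>E\<^sub>1 E\<^sub>2\<close> yield two linear relations between \<open>g c\<close> and
  \<open>g (c + 1)\<close> with determinant \<open>[m + n - A + 2]\<close>.\<close>

lemma Fm_independent_aux:
  assumes "t = nat (A + b)" "0 \<le> A" "A \<le> b" "m \<ge> 0" "n \<ge> 0"
    and "\<And>c. g c \<noteq> 0 \<Longrightarrow> 0 \<le> c \<and> c \<le> A \<and> c \<le> m \<and> b - n \<le> c"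
    and "(\<Sum>c\<in>{0..A}. g c \<cdot> Fm (A - c) b c) = 0"
  shows "g c = 0"
  using assms
proof (induction t arbitrary: A b g c rule: less_induct)
  case (less t)
  note supp = less.prems(6) and eq0 = less.prems(7)
  \<comment> \<open>Coefficients after applying \<open>E I2\<close>. The added factor is nonzero on
    the support of \<open>g\<close> because \<open>b - n \<le> c\<close> there.\<close>
  define h where "h c = g c * qint (n + c - b + 1)" for c
  have h: "h c = 0 \<longleftrightarrow> g c = 0" for c
    using supp[of c] by (cases "g c = 0") (auto simp: h_def)
  have E2: "(\<Sum>c\<in>{0..A}. h c \<cdot> Fm (A - c) (b - 1) c) = 0"
    unfolding h_def E2_sum_Fm[symmetric] eq0 by simp
  show ?case
  proof (cases "b > A")
    case True
    have "h c = 0"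
      by (rule less.IH[OF _ refl _ _ _ _ _ E2]) (use less.prems True h in \<open>force+\<close>)
    then show ?thesis
      by (simp add: h)
  next
    case False
    with less.prems have b: "b = A"
      by simp
    show ?thesis
    proof (cases "A = 0")
      case True
      then have "g 0 \<cdot> \<eta> = 0"
        using eq0 by (simp add: b Fm_eq)
      then have "g 0 = 0"
        using hw_nonzero by simp
      then show ?thesis
        using supp[of c] True by force
    next
      case False
      with less.prems have A: "A \<ge> 1"
        by simp
      define g2 where "g2 c = (if 0 \<le> c \<and> c \<le> A - 1 then (h (c + 1) + h c) * qint (m - c) else 0)" for c
      have "act (E I1) (\<Sum>c\<in>{0..A}. h c \<cdot> Fm (A - c) (b - 1) c) = 0"
        unfolding E2 by simp
      moreover have "m - c + (b - 1) - A + 1 = m - c" for c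
        by (simp add: b)
      ultimately have E12: "(\<Sum>c\<in>{0..A - 1}. g2 c \<cdot> Fm (A - 1 - c) (b - 1) c) = 0"
        unfolding E1_sum_Fm[OF A] by (simp add: g2_def distrib_right)
      have g2: "g2 c = 0" for c
      proof (rule less.IH[OF _ refl _ _ _ _ _ E12])
        fix c assume c: "g2 c \<noteq> 0"
        then have "c \<noteq> m" "0 \<le> c" "c \<le> A - 1" "h c \<noteq> 0 \<or> h (c + 1) \<noteq> 0"
          by (auto simp: g2_def split: if_splits)
        with supp[of c] supp[of "c + 1"] show "0 \<le> c \<and> c \<le> A - 1 \<and> c \<le> m \<and> b - 1 - n \<le> c"
          unfolding h by auto
      qed (use less.prems A b in auto)
      then have eq2: "h (c + 1) + h c = 0" if "0 \<le> c" "c \<le> A - 1" "c \<noteq> m" for c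
        using that spec[of "\<lambda>c. g2 c = 0" c] by (auto simp: g2_def)
      show ?thesis
      \<comment> \<open>If \<open>A > n\<close>, applying \<open>E I1\<close> alone may produce the
        index \<open>b - n - 1\<close>, outside the support allowed by the induction hypothesis, so
        only the relation from \<open>E I1\<close> after \<open>E I2\<close> is available. It
        suffices: \<open>h\<close> vanishes at \<open>A - n - 1\<close>, and vanishing propagates
        upwards.\<close>
      proof (cases "A > n")
        case True
        have "h (A - n - 1 + int k) = 0" for k
        proof (induction k)
          case 0
          show ?case
            using supp[of "A - n - 1"] by (auto simp: h b)
        next
          case (Suc k)
          define d where "d = A - n - 1 + int k"
          have d: "A - n - 1 + int (Suc k) = d + 1"
            by (simp add: d_def)
          show ?case
          proof (rule ccontr)
            assume "h (A - n - 1 + int (Suc k)) \<noteq> 0"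
            then have "h (d + 1) \<noteq> 0"
              by (simp only: d not_False_eq_True)
            with supp[of "d + 1"] have "d + 1 \<le> A" "d + 1 \<le> m"
              unfolding h by auto
            moreover have "0 \<le> d"
              using True by (simp add: d_def)
            ultimately have "h (d + 1) + h d = 0"
              by (intro eq2) auto
            moreover have "h d = 0"
              unfolding d_def by (rule Suc)
            ultimately show False
              using \<open>h (d + 1) \<noteq> 0\<close> by simp
          qed
        qed
        from this[of "nat (c - (A - n - 1))"] show ?thesis
          using supp[of c] by (cases "c \<ge> A - n - 1") (auto simp: h b)
      next
        case An: False
        define g1 where "g1 c = (if 0 \<le> c \<and> c \<le> A - 1 then g (c + 1) * qint (m - c) + g c * qint (m - c + 1) else 0)" for c
        have "act (E I1) (\<Sum>c\<in>{0..A}. g c \<cdot> Fm (A - c) b c) = 0"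
          unfolding eq0 by simp
        moreover have "m - c + b - A + 1 = m - c + 1" for c
          by (simp add: b)
        ultimately have E1: "(\<Sum>c\<in>{0..A - 1}. g1 c \<cdot> Fm (A - 1 - c) b c) = 0"
          unfolding E1_sum_Fm[OF A] by (simp add: g1_def)
        have g1: "g1 c = 0" for c
        proof (rule less.IH[OF _ refl _ _ _ _ _ E1])
          fix c assume c: "g1 c \<noteq> 0"
          then have "0 \<le> c" "c \<le> A - 1" "g c \<noteq> 0 \<or> g (c + 1) \<noteq> 0"
            by (auto simp: g1_def split: if_splits)
          with supp[of c] supp[of "c + 1"] An show "0 \<le> c \<and> c \<le> A - 1 \<and> c \<le> m \<and> b - n \<le> c"
            by (auto simp: b)
        qed (use less.prems A b in auto)
        have eq1: "g (c + 1) * qint (m - c) + g c * qint (m - c + 1) = 0" if "0 \<le> c" "c \<le> A - 1" for c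
          using that g1[of c] by (simp add: g1_def)
        \<comment> \<open>For \<open>c < m\<close> both relations are available, and the determinant
          is nonzero as \<open>A \<le> n\<close>. For \<open>c = m\<close> the support gives
          \<open>g (c + 1) = 0\<close>, and the first relation reduces to
          \<open>g m * [1] = 0\<close>.\<close>
        have pair: "g c = 0 \<and> g (c + 1) = 0" if c: "0 \<le> c" "c \<le> A - 1" for c
        proof (cases "c < m")
          case True
          have 1: "g (c + 1) * qint (m - c) + g c * qint (m - c + 1) = 0"
            by (rule eq1[OF c])
          have 2: "g (c + 1) * qint (n + c - A + 2) + g c * qint (n + c - A + 1) = 0"
            using eq2[OF c] True by (simp add: h_def b algebra_simps)
          have 3: "qint (m - c + 1) * qint (n + c - A + 2) =
              qint 1 * qint (m + n - A + 2) + qint (m - c) * qint (n + c - A + 1)"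
            by (rule qint_exchange_eqI) simp_all
          have "g c * qint (m + n - A + 2) = 0"
            using 1 2 3[unfolded qint_1] by algebra
          then have "g c = 0"
            using An less.prems by simp
          with 1 True show ?thesis
            by simp
        next
          case False
          then have "g (c + 1) = 0"
            using supp[of "c + 1"] by force
          moreover from False have "g c = 0"
            using supp[of c] eq1[OF c] \<open>g (c + 1) = 0\<close> by (cases "c = m") force+
          ultimately show ?thesis
            by simp
        qed
        show ?thesis
          using supp[of c] pair[of c] pair[of "c - 1"] A by (cases "c = A") force+
      qed
    qed
  qed
qed

lemma Fm_independent:
  assumes "0 \<le> A" "A \<le> b" "m \<ge> 0" "n \<ge> 0"
    and "\<And>c. g c \<noteq> 0 \<Longrightarrow> 0 \<le> c \<and> c \<le> A \<and> c \<le> m \<and> b - n \<le> c"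
    and "(\<Sum>c\<in>{0..A}. g c \<cdot> Fm (A - c) b c) = 0"
  shows "g c = 0"
  using Fm_independent_aux[OF refl assms] .

end

section \<open>The icanonical basis\<close>

lemma sum_triangle:
  fixes F :: "nat \<Rightarrow> nat \<Rightarrow> 'a::comm_monoid_add"
  shows "(\<Sum>k\<le>a. \<Sum>l\<le>a - k. F k (k + l)) = (\<Sum>r\<le>a. \<Sum>k\<le>r. F k r)"
proof -
  have "(\<Sum>k\<le>a. \<Sum>l\<le>a - k. F k (k + l)) = (\<Sum>(k, l)\<in>(SIGMA k:{..a}. {..a - k}). F k (k + l))"
    by (rule sum.Sigma) auto
  also have "\<dots> = (\<Sum>(r, k)\<in>(SIGMA r:{..a}. {..r}). F k r)"
    by (rule sum.reindex_bij_witness[where i = "\<lambda>(r, k). (k, r - k)" and j = "\<lambda>(k, l). (k + l, k)"]) auto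
  also have "\<dots> = (\<Sum>r\<le>a. \<Sum>k\<le>r. F k r)"
    by (rule sum.Sigma[symmetric]) auto
  finally show ?thesis .
qed

locale icanonical_setting = simple_highest_weight_module act m n \<eta>
  for act :: "Uq \<Rightarrow> 'v::ab_group_add \<Rightarrow> 'v" and m n \<eta> +
  fixes \<sigma> :: "idx \<Rightarrow> int" and \<psi> :: "Uq \<Rightarrow> Uq" and \<psi>L :: "'v \<Rightarrow> 'v"
  assumes \<sigma>: "(\<sigma> I1, \<sigma> I2) \<in> {(1, 0), (0, 1)}"
    and m_nonneg: "m \<ge> 0" and n_nonneg: "n \<ge> 0"
    and psi: "is_psi_Ui \<sigma> \<psi>"
    and psiL: "is_psi_module \<sigma> \<psi> act \<eta> \<psi>L"
begin

lemma psiL_add: "\<psi>L (v + w) = \<psi>L v + \<psi>L w"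
  and psiL_scale: "\<psi>L (x \<cdot> v) = bar x \<cdot> \<psi>L v"
  and psiL_act: "u \<in> Ui \<sigma> \<Longrightarrow> \<psi>L (act u \<eta>) = act (\<psi> u) \<eta>"
  using psiL by (simp_all add: is_psi_module_def)

lemma psiL_0 [simp]: "\<psi>L 0 = 0"
  using psiL_add[of 0 0] by simp

lemma psiL_diff: "\<psi>L (v - w) = \<psi>L v - \<psi>L w"
  using psiL_add[of "v - w" w] by (simp add: algebra_simps)

lemma psiL_sum: "\<psi>L (sum f X) = (\<Sum>x\<in>X. \<psi>L (f x))"
  by (induction X rule: infinite_finite_induct) (simp_all add: psiL_add)

lemma psi_mult: "x \<in> Ui \<sigma> \<Longrightarrow> y \<in> Ui \<sigma> \<Longrightarrow> \<psi> (x * y) = \<psi> x * \<psi> y"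
  and psi_scal: "\<psi> (scal z) = scal (bar z)"
  and psi_B: "\<psi> (B \<sigma> i) = B \<sigma> i"
  using psi by (simp_all add: is_psi_Ui_def)

lemma psi_dpow_B: "dpow (B \<sigma> i) r \<in> Ui \<sigma> \<and> \<psi> (dpow (B \<sigma> i) r) = dpow (B \<sigma> i) r"
proof -
  have pow: "B \<sigma> i ^ k \<in> Ui \<sigma> \<and> \<psi> (B \<sigma> i ^ k) = B \<sigma> i ^ k" for k
  proof (induction k)
    case 0
    then show ?case
      using Ui.scal[of 1 \<sigma>] psi_scal[of 1] by simp
  next
    case (Suc k)
    then show ?case
      by (simp add: Ui.mult Ui.B psi_mult psi_B)
  qed
  show ?thesis
  proof (cases "r < 0")
    case True
    then show ?thesis
      using Ui.scal[of 0 \<sigma>] psi_scal[of 0] by simp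
  next
    case False
    then show ?thesis
      using pow[of "nat r"] by (simp add: dpow_def Ui.mult Ui.scal psi_mult psi_scal bar_inverse)
  qed
qed

lemma psiL_B_mon: "\<psi>L (B_mon \<sigma> act \<eta> a b c) = B_mon \<sigma> act \<eta> a b c"
  unfolding B_mon_def using psi_dpow_B by (subst psiL_act) (auto simp: psi_mult Ui.mult)

lemma \<sigma>_sum: "\<sigma> I1 + \<sigma> I2 = 1"
  using \<sigma> by auto

section \<open>Triangularity of \<open>\<psi>L\<close> and uniqueness, for a fixed triple
  \<open>a\<close>, \<open>b\<close>, \<open>c\<close>\<close>

context
  fixes a b c :: nat
  assumes b: "a + c \<le> b" and c: "int c \<le> m" and bc: "int b - int c \<le> n"
begin

definition Fv :: "nat \<times> nat \<Rightarrow> 'v" where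
  "Fv p = Fm (int a - int (fst p)) (int b - int (fst p) - int (snd p)) (int c - int (snd p))"

definition level :: "nat \<times> nat \<Rightarrow> nat" where
  "level p = fst p + snd p"

definition T :: "(nat \<times> nat) set" where
  "T = {..a} \<times> {..c}"

definition filt :: "nat \<Rightarrow> 'v set" where
  "filt s = vs.span {Fv p | p. p \<in> T \<and> s \<le> level p}"

lemma finite_T [simp]: "finite T"
  by (simp add: T_def)

lemma filt_Fv: "p \<in> T \<Longrightarrow> s \<le> level p \<Longrightarrow> Fv p \<in> filt s"
  unfolding filt_def by (rule vs.span_base) blast

lemmas filt_add = vs.span_add[of _ "{Fv p | p. p \<in> T \<and> s \<le> level p}" for s, folded filt_def]
lemmas filt_diff = vs.span_diff[of _ "{Fv p | p. p \<in> T \<and> s \<le> level p}" for s, folded filt_def]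
lemmas filt_scale = vs.span_scale[of _ "{Fv p | p. p \<in> T \<and> s \<le> level p}" for s, folded filt_def]
lemmas filt_sum = vs.span_sum[of _ _ "{Fv p | p. p \<in> T \<and> s \<le> level p}" for s, folded filt_def]
lemmas filt_0 = vs.span_zero[of "{Fv p | p. p \<in> T \<and> s \<le> level p}" for s, folded filt_def]
lemmas filt_neg = vs.span_neg[of _ "{Fv p | p. p \<in> T \<and> s \<le> level p}" for s, folded filt_def]

lemma filt_induct [consumes 1, case_names zero step]:
  assumes "v \<in> filt s" and "P 0"
    and "\<And>x p w. p \<in> T \<Longrightarrow> s \<le> level p \<Longrightarrow> P w \<Longrightarrow> P (x \<cdot> Fv p + w)"
  shows "P v"
  using assms(1) unfolding filt_def
  by (rule vs.span_induct_alt) (use assms(2,3) in auto)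

lemma filt_mono: "s \<le> t \<Longrightarrow> filt t \<subseteq> filt s"
  unfolding filt_def by (rule vs.span_mono) (blast intro: order_trans)

text \<open>\<open>B_mon_expand\<close> for the shifted exponents has leading coefficient 1, and its
  other terms sit at shifts \<open>(x + i, y + j)\<close> of higher level.\<close>

lemma B_mon_Fv:
  assumes "p \<in> T"
  shows "B_mon \<sigma> act \<eta> (int a - int (fst p)) (int b - int (fst p) - int (snd p)) (int c - int (snd p)) - Fv p
    \<in> filt (Suc (level p))"
proof -
  obtain x y where p: "p = (x, y)" "x \<le> a" "y \<le> c"
    using assms by (auto simp: T_def)
  have le: "c - y \<le> b - x - y"
    using b p by simp
  have nat: "int a - int x = int (a - x)" "int b - int x - int y = int (b - x - y)" "int c - int y = int (c - y)"
    using b p by simp_all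
  obtain C where C0: "C 0 0 = 1" and C:
    "B_mon \<sigma> act \<eta> (int (a - x)) (int (b - x - y)) (int (c - y)) =
      (\<Sum>i\<le>a - x. \<Sum>j\<le>c - y. C i j \<cdot>
        Fm (int (a - x) - int i) (int (b - x - y) - int i - int j) (int (c - y) - int j))"
    by (rule that[OF _ B_mon_expand[OF le \<sigma>_sum refl refl refl]]) simp
  have Fv: "Fm (int (a - x) - int i) (int (b - x - y) - int i - int j) (int (c - y) - int j) = Fv (x + i, y + j)" for i j
    unfolding nat[symmetric] Fv_def by (simp add: algebra_simps)
  have "B_mon \<sigma> act \<eta> (int (a - x)) (int (b - x - y)) (int (c - y)) =
      (\<Sum>(i, j)\<in>{..a - x} \<times> {..c - y}. C i j \<cdot> Fv (x + i, y + j))"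
    unfolding C Fv sum.cartesian_product ..
  also have "\<dots> = Fv p + (\<Sum>(i, j)\<in>{..a - x} \<times> {..c - y} - {(0, 0)}. C i j \<cdot> Fv (x + i, y + j))"
    by (subst sum.remove[where x = "(0, 0)"]) (simp_all add: C0 p)
  finally have "B_mon \<sigma> act \<eta> (int (a - x)) (int (b - x - y)) (int (c - y)) - Fv p =
      (\<Sum>(i, j)\<in>{..a - x} \<times> {..c - y} - {(0, 0)}. C i j \<cdot> Fv (x + i, y + j))"
    by simp
  also have "\<dots> \<in> filt (Suc (level p))"
    by (rule filt_sum) (use p in \<open>auto intro!: filt_scale filt_Fv simp: T_def level_def\<close>)
  finally show ?thesis
    by (simp only: p fst_conv snd_conv nat)
qed

lemma psiL_filt:
  assumes "\<And>p. p \<in> T \<Longrightarrow> s \<le> level p \<Longrightarrow> \<psi>L (Fv p) - Fv p \<in> filt (Suc (level p))" and "v \<in> filt s"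
  shows "\<psi>L v \<in> filt s"
  using assms(2)
proof (induction rule: filt_induct)
  case zero
  then show ?case
    by (simp add: filt_0)
next
  case (step x p w)
  have "\<psi>L (Fv p) - Fv p \<in> filt s"
    using assms(1)[OF step(1,2)] filt_mono[of s "Suc (level p)"] step(2) by auto
  then have "(\<psi>L (Fv p) - Fv p) + Fv p \<in> filt s"
    using filt_Fv[OF step(1,2)] by (rule filt_add)
  with step show ?case
    by (simp add: psiL_add psiL_scale filt_add filt_scale)
qed

text \<open>The \<open>B\<close>-monomial with leading term \<open>Fv p\<close> is fixed by
  \<open>\<psi>L\<close>, so the difference is \<open>w - \<psi>L w\<close> for its tail
  \<open>w\<close>. Descending induction on the level ensures that \<open>\<psi>L w\<close> stays in
  the same filtration step.\<close>

lemma psiL_Fv: "p \<in> T \<Longrightarrow> \<psi>L (Fv p) - Fv p \<in> filt (Suc (level p))"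
proof (induction "a + c - level p" arbitrary: p rule: less_induct)
  case less
  define w where "w = B_mon \<sigma> act \<eta> (int a - int (fst p)) (int b - int (fst p) - int (snd p)) (int c - int (snd p)) - Fv p"
  have w: "w \<in> filt (Suc (level p))"
    unfolding w_def by (rule B_mon_Fv) fact
  have "\<psi>L w \<in> filt (Suc (level p))"
  proof (rule psiL_filt[OF _ w])
    fix p' assume "p' \<in> T" "Suc (level p) \<le> level p'"
    moreover from \<open>p' \<in> T\<close> have "level p' \<le> a + c"
      by (auto simp: T_def level_def)
    ultimately show "\<psi>L (Fv p') - Fv p' \<in> filt (Suc (level p'))"
      by (intro less) auto
  qed
  moreover have "\<psi>L (w + Fv p) = w + Fv p"
    by (simp add: w_def psiL_B_mon)
  then have "\<psi>L (Fv p) - Fv p = w - \<psi>L w"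
    by (simp add: psiL_add algebra_simps)
  ultimately show ?case
    using w filt_diff by simp
qed

lemma K_Fv: "act (K I1) (Fv p) = qq powi (m - 2 * int a + int b - 2 * int c + int (level p)) \<cdot> Fv p"
proof -
  have "m - 2 * (int a - int (fst p)) + (int b - int (fst p) - int (snd p)) - 2 * (int c - int (snd p)) =
      m - 2 * int a + int b - 2 * int c + int (level p)"
    by (simp add: level_def)
  with weight_Fm show ?thesis
    unfolding Fv_def weight_def by metis
qed

text \<open>Different levels have different weights, so a vector of level \<open>s\<close> cannot be a combination of
  monomials of higher levels.\<close>

lemma filt_weight_eq_0:
  "v \<in> filt s' \<Longrightarrow> s < s' \<Longrightarrow>
   act (K I1) v = qq powi (m - 2 * int a + int b - 2 * int c + int s) \<cdot> v \<Longrightarrow> v = 0"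
proof (induction "Suc (a + c) - s'" arbitrary: s' v)
  case 0
  then have "{Fv p | p. p \<in> T \<and> s' \<le> level p} = {}"
    by (auto simp: T_def level_def)
  then have "filt s' = {0}"
    by (simp only: filt_def vs.span_empty)
  with 0 show ?case
    by simp
next
  case (Suc d)
  define \<kappa> where "\<kappa> s = qq powi (m - 2 * int a + int b - 2 * int c + int s)" for s
  have K: "act (K I1) (Fv p) = \<kappa> (level p) \<cdot> Fv p" for p
    unfolding \<kappa>_def by (rule K_Fv)
  \<comment> \<open>Subtracting the eigenvalue of level \<open>s'\<close> kills that level, while on
    \<open>v\<close> itself the difference is a nonzero scalar.\<close>
  have "act (K I1) v - \<kappa> s' \<cdot> v \<in> filt (Suc s')"
    using Suc.prems(1)
  proof (induction rule: filt_induct)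
    case zero
    then show ?case
      by (simp add: filt_0)
  next
    case (step x p w)
    have "act (K I1) (x \<cdot> Fv p + w) - \<kappa> s' \<cdot> (x \<cdot> Fv p + w) =
        (x * (\<kappa> (level p) - \<kappa> s')) \<cdot> Fv p + (act (K I1) w - \<kappa> s' \<cdot> w)"
      by (simp add: act_add_right act_scales K vs.scale_left_diff_distrib algebra_simps)
    moreover have "(x * (\<kappa> (level p) - \<kappa> s')) \<cdot> Fv p \<in> filt (Suc s')"
    proof (cases "level p = s'")
      case False
      with step show ?thesis
        by (intro filt_scale filt_Fv) auto
    qed (simp add: filt_0)
    ultimately show ?case
      using step filt_add by simp
  qed
  also have "act (K I1) v - \<kappa> s' \<cdot> v = (\<kappa> s - \<kappa> s') \<cdot> v"
    using Suc.prems(3) by (simp add: \<kappa>_def vs.scale_left_diff_distrib)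
  finally have "inverse (\<kappa> s - \<kappa> s') \<cdot> (\<kappa> s - \<kappa> s') \<cdot> v \<in> filt (Suc s')"
    by (rule filt_scale)
  moreover have "\<kappa> s - \<kappa> s' \<noteq> 0"
    using Suc.prems(2) by (simp add: \<kappa>_def qq_powi_eq_iff)
  ultimately have "v \<in> filt (Suc s')"
    by simp
  then show ?case
    using Suc by (intro Suc.hyps(1)[of "Suc s'"]) auto
qed

text \<open>By weights the sum itself is 0. Within one level the exponents of \<open>F I1\<close>
  add up to \<open>A = a + c - s\<close> and that of \<open>F I2\<close> is \<open>b - s\<close>, so
  \<open>Fm_independent\<close> applies with index \<open>c - y\<close>; its bounds come from
  \<open>c \<le> m\<close> and \<open>b - c \<le> n\<close>.\<close>

lemma level_independent:
  assumes "(\<Sum>p | p \<in> T \<and> level p = s. h p \<cdot> Fv p) \<in> filt (Suc s)" and "p \<in> T" "level p = s"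
  shows "h p = 0"
proof -
  let ?Ts = "{p \<in> T. level p = s}"
  have "act (K I1) (\<Sum>p\<in>?Ts. h p \<cdot> Fv p) =
      qq powi (m - 2 * int a + int b - 2 * int c + int s) \<cdot> (\<Sum>p\<in>?Ts. h p \<cdot> Fv p)"
    unfolding act_sum by (rule sum.cong) (auto simp: act_scales K_Fv mult.commute)
  from filt_weight_eq_0[OF assms(1) _ this] have eq0: "(\<Sum>p\<in>?Ts. h p \<cdot> Fv p) = 0"
    by simp
  define A where "A = int a + int c - int s"
  \<comment> \<open>The values \<open>c - y\<close> for the pairs \<open>(x, y)\<close> of level
    \<open>s\<close> in \<open>T\<close>; elsewhere \<open>g\<close> is 0.\<close>
  define C where "C = {c'. 0 \<le> c' \<and> c' \<le> int c \<and> int c - c' \<le> int s \<and> int s - (int c - c') \<le> int a}"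
  define g where "g c' = (if c' \<in> C then h (nat (int s - int c + c'), nat (int c - c')) else 0)" for c'
  have "level p \<le> a + c"
    using assms(2) by (auto simp: T_def level_def)
  then have A: "0 \<le> A"
    using assms(3) by (simp add: A_def)
  have "C \<subseteq> {0..A}"
    by (auto simp: C_def A_def)
  then have "(\<Sum>c'\<in>{0..A}. g c' \<cdot> Fm (A - c') (int b - int s) c') = (\<Sum>c'\<in>C. g c' \<cdot> Fm (A - c') (int b - int s) c')"
    by (intro sum.mono_neutral_right) (auto simp: g_def)
  also have "\<dots> = (\<Sum>p\<in>?Ts. h p \<cdot> Fv p)"
  proof (rule sum.reindex_bij_witness[where i = "\<lambda>p. int c - int (snd p)"
        and j = "\<lambda>c'. (nat (int s - int c + c'), nat (int c - c'))"])
    fix c' assume c': "c' \<in> C"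
    then have "int a - (int s - int c + c') = A - c'" "int b - (int s - int c + c') - (int c - c') = int b - int s"
      "int c - (int c - c') = c'" "int (nat (int s - int c + c')) = int s - int c + c'" "int (nat (int c - c')) = int c - c'"
      by (auto simp: C_def A_def)
    then show "h (nat (int s - int c + c'), nat (int c - c')) \<cdot> Fv (nat (int s - int c + c'), nat (int c - c')) =
        g c' \<cdot> Fm (A - c') (int b - int s) c'"
      using c' by (simp only: Fv_def fst_conv snd_conv g_def if_True)
  qed (auto simp: C_def T_def level_def)
  finally have g0: "(\<Sum>c'\<in>{0..A}. g c' \<cdot> Fm (A - c') (int b - int s) c') = 0"
    using eq0 by simp
  have "g (int c - int (snd p)) = 0"
  proof (rule Fm_independent[OF A _ m_nonneg n_nonneg _ g0])
    show "A \<le> int b - int s"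
      using b by (simp add: A_def)
    fix c' assume "g c' \<noteq> 0"
    then have "c' \<in> C"
      by (auto simp: g_def split: if_splits)
    then show "0 \<le> c' \<and> c' \<le> A \<and> c' \<le> m \<and> int b - int s - n \<le> c'"
      using c bc by (auto simp: C_def A_def)
  qed
  moreover have "int c - int (snd p) \<in> C" "nat (int s - int (snd p)) = fst p"
    using assms(2,3) by (auto simp: C_def T_def level_def)
  ultimately show ?thesis
    by (simp add: g_def)
qed

text \<open>Once all lower levels vanish, triangularity makes \<open>\<psi>L\<close> act on the
  coefficients of the next level by \<open>bar\<close> alone, modulo higher levels. They are thus
  bar-invariant elements of \<open>qinv_Z\<close>.\<close>

lemma psiL_invariant_eq_0:
  assumes g: "\<And>p. g p \<in> qinv_Z" and inv: "\<psi>L (\<Sum>p\<in>T. g p \<cdot> Fv p) = (\<Sum>p\<in>T. g p \<cdot> Fv p)"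
  shows "p \<in> T \<Longrightarrow> g p = 0"
proof (induction "level p" arbitrary: p rule: less_induct)
  case less
  define s where "s = level p"
  define h where "h p = bar (g p) - g p" for p
  have "\<psi>L (g p \<cdot> Fv p) - g p \<cdot> Fv p - (if level p = s then h p \<cdot> Fv p else 0) \<in> filt (Suc s)" if "p \<in> T" for p
  proof -
    have eq: "\<psi>L (g p \<cdot> Fv p) - g p \<cdot> Fv p - h p \<cdot> Fv p = bar (g p) \<cdot> (\<psi>L (Fv p) - Fv p)"
      by (simp add: psiL_scale h_def act_diff_right vs.scale_left_diff_distrib)
    consider "level p < s" | "level p = s" | "level p > s"
      by linarith
    then show ?thesis
    proof cases
      case 1
      then have "g p = 0"
        using less.hyps that by (simp add: s_def)
      with 1 show ?thesis
        by (simp add: filt_0)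
    next
      case 2
      then show ?thesis
        using psiL_Fv[OF that] by (simp add: eq filt_scale)
    next
      case 3
      have "bar (g p) \<cdot> (\<psi>L (Fv p) - Fv p) + h p \<cdot> Fv p \<in> filt (Suc s)"
        using psiL_Fv[OF that] filt_mono[of "Suc s" "Suc (level p)"] 3 that
        by (intro filt_add filt_scale filt_Fv) auto
      with 3 show ?thesis
        by (simp flip: eq)
    qed
  qed
  then have "(\<Sum>p\<in>T. \<psi>L (g p \<cdot> Fv p) - g p \<cdot> Fv p - (if level p = s then h p \<cdot> Fv p else 0)) \<in> filt (Suc s)"
    by (rule filt_sum)
  also have "(\<Sum>p\<in>T. \<psi>L (g p \<cdot> Fv p) - g p \<cdot> Fv p - (if level p = s then h p \<cdot> Fv p else 0)) =
      - (\<Sum>p | p \<in> T \<and> level p = s. h p \<cdot> Fv p)"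
    using inv by (simp add: sum_subtractf psiL_sum sum.inter_filter)
  finally have "(\<Sum>p | p \<in> T \<and> level p = s. h p \<cdot> Fv p) \<in> filt (Suc s)"
    using filt_neg by fastforce
  then have "h p = 0"
    using less.prems by (rule level_independent) (simp add: s_def)
  then show ?case
    using qinv_Z_bar_invariant[OF g] by (simp add: h_def)
qed

text \<open>The arbitrary finite index sets can be replaced by \<open>T\<close>, since every other
  term has a negative exponent and vanishes.\<close>

lemma icanonical_coset_iff:
  "v \<in> icanonical_coset act \<eta> (int a) (int b) (int c) \<longleftrightarrow>
     (\<exists>g. (\<forall>p. g p \<in> qinv_Z) \<and> g (0, 0) = 0 \<and> v = Fv (0, 0) + (\<Sum>p\<in>T. g p \<cdot> Fv p))"
proof
  assume "v \<in> icanonical_coset act \<eta> (int a) (int b) (int c)"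
  then obtain S g0 where S: "finite S" "S \<subseteq> {(x, y). 0 \<le> x \<and> 0 \<le> y \<and> (x, y) \<noteq> (0, 0)}" "g0 ` S \<subseteq> qinv_Z"
    and v: "v = Fm (int a) (int b) (int c) + (\<Sum>(x, y)\<in>S. g0 (x, y) \<cdot> Fm (int a - x) (int b - x - y) (int c - y))"
    unfolding icanonical_coset_def by blast
  define g where "g p = (if (int (fst p), int (snd p)) \<in> S then g0 (int (fst p), int (snd p)) else 0)" for p :: "nat \<times> nat"
  have "g p \<in> qinv_Z" for p
    using S(3) by (auto simp: g_def qinv_Z_0)
  moreover have "g (0, 0) = 0"
    using S(2) by (auto simp: g_def)
  moreover have "(\<Sum>(x, y)\<in>S. g0 (x, y) \<cdot> Fm (int a - x) (int b - x - y) (int c - y)) = (\<Sum>p\<in>T. g p \<cdot> Fv p)"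
  proof -
    have "(\<Sum>(x, y)\<in>S. g0 (x, y) \<cdot> Fm (int a - x) (int b - x - y) (int c - y)) =
        (\<Sum>(x, y)\<in>{p \<in> S. fst p \<le> int a \<and> snd p \<le> int c}. g0 (x, y) \<cdot> Fm (int a - x) (int b - x - y) (int c - y))"
      using S(1) by (intro sum.mono_neutral_right) (auto dest!: Fm_nonzero)
    also have "\<dots> = (\<Sum>p\<in>{p \<in> T. (int (fst p), int (snd p)) \<in> S}. g p \<cdot> Fv p)"
      by (rule sum.reindex_bij_witness[where i = "\<lambda>p. (int (fst p), int (snd p))"
            and j = "\<lambda>p. (nat (fst p), nat (snd p))"]) (use S(2) in \<open>auto simp: T_def Fv_def g_def\<close>)
    also have "\<dots> = (\<Sum>p\<in>T. g p \<cdot> Fv p)"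
      by (rule sum.mono_neutral_left) (auto simp: g_def)
    finally show ?thesis .
  qed
  ultimately show "\<exists>g. (\<forall>p. g p \<in> qinv_Z) \<and> g (0, 0) = 0 \<and> v = Fv (0, 0) + (\<Sum>p\<in>T. g p \<cdot> Fv p)"
    unfolding v by (intro exI[of _ g]) (simp add: Fv_def)
next
  assume "\<exists>g. (\<forall>p. g p \<in> qinv_Z) \<and> g (0, 0) = 0 \<and> v = Fv (0, 0) + (\<Sum>p\<in>T. g p \<cdot> Fv p)"
  then obtain g where g: "\<And>p. g p \<in> qinv_Z" "g (0, 0) = 0" and v: "v = Fv (0, 0) + (\<Sum>p\<in>T. g p \<cdot> Fv p)"
    by blast
  define S where "S = (\<lambda>p. (int (fst p), int (snd p))) ` (T - {(0, 0)})"
  define g0 where "g0 p = g (nat (fst p), nat (snd p))" for p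
  have "(\<Sum>p\<in>T. g p \<cdot> Fv p) = (\<Sum>p\<in>T - {(0, 0)}. g p \<cdot> Fv p)"
    using g(2) by (intro sum.mono_neutral_right) auto
  also have "\<dots> = (\<Sum>(x, y)\<in>S. g0 (x, y) \<cdot> Fm (int a - x) (int b - x - y) (int c - y))"
    by (rule sum.reindex_bij_witness[where j = "\<lambda>p. (int (fst p), int (snd p))"
          and i = "\<lambda>p. (nat (fst p), nat (snd p))"]) (auto simp: S_def T_def Fv_def g0_def)
  finally have "v = Fm (int a) (int b) (int c)
      + (\<Sum>(x, y)\<in>S. g0 (x, y) \<cdot> Fm (int a - x) (int b - x - y) (int c - y))"
    by (simp add: v Fv_def)
  moreover have "finite S" "S \<subseteq> {(x, y). 0 \<le> x \<and> 0 \<le> y \<and> (x, y) \<noteq> (0, 0)}" "g0 ` S \<subseteq> qinv_Z"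
    using g(1) by (auto simp: S_def g0_def)
  ultimately show "v \<in> icanonical_coset act \<eta> (int a) (int b) (int c)"
    unfolding icanonical_coset_def by blast
qed

lemma icanonical_eqI:
  assumes "\<psi>L v = v" and "v \<in> icanonical_coset act \<eta> (int a) (int b) (int c)"
  shows "icanonical act \<eta> \<psi>L (int a) (int b) (int c) = v"
  unfolding icanonical_def
proof (rule the_equality)
  show "\<psi>L v = v \<and> v \<in> icanonical_coset act \<eta> (int a) (int b) (int c)"
    using assms by simp
next
  fix w
  assume w: "\<psi>L w = w \<and> w \<in> icanonical_coset act \<eta> (int a) (int b) (int c)"
  from w obtain g where g: "\<And>p. g p \<in> qinv_Z" "w = Fv (0, 0) + (\<Sum>p\<in>T. g p \<cdot> Fv p)"
    by (auto simp: icanonical_coset_iff)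
  from assms obtain g' where g': "\<And>p. g' p \<in> qinv_Z" "v = Fv (0, 0) + (\<Sum>p\<in>T. g' p \<cdot> Fv p)"
    by (auto simp: icanonical_coset_iff)
  have eq: "w - v = (\<Sum>p\<in>T. (g p - g' p) \<cdot> Fv p)"
    by (simp add: g(2) g'(2) vs.scale_left_diff_distrib sum_subtractf)
  have "g p - g' p = 0" if "p \<in> T" for p
  proof (rule psiL_invariant_eq_0[OF _ _ that])
    show "g p - g' p \<in> qinv_Z" for p
      by (intro qinv_Z_diff g g')
    show "\<psi>L (\<Sum>p\<in>T. (g p - g' p) \<cdot> Fv p) = (\<Sum>p\<in>T. (g p - g' p) \<cdot> Fv p)"
      using w assms(1) unfolding eq[symmetric] by (simp add: psiL_diff)
  qed
  then have "w - v = 0"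
    unfolding eq by (intro sum.neutral) simp
  then show "w = v"
    by simp
qed

text \<open>Passing to \<open>(a - k, b - k)\<close> keeps \<open>\<delta>\<close> and adds
  \<open>k\<close> to \<open>\<beta>\<close> and \<open>\<gamma>\<close>. The
  \<open>y\<close>-factor thereby gains \<open>q^(- k * j)\<close>, which completes
  \<open>q^(- i * j)\<close> to a power depending only on the total shift \<open>k + i\<close>; so
  the sum over \<open>k\<close> reaches the \<open>x\<close>-factor alone.\<close>

lemma B_mon_combination:
  assumes \<beta>: "\<beta> = n - m + int a - 2 * int b + 3 * int c + \<sigma> I1"
    and \<delta>: "\<delta> = m + int b - 2 * int c - \<sigma> I1 - int a"
    and \<gamma>: "\<gamma> = \<beta> + int b - int a - int c - 1"
  shows "(\<Sum>k\<le>a. ((- 1) ^ k * d k) \<cdot> B_mon \<sigma> act \<eta> (int a - int k) (int b - int k) (int c)) =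
    (\<Sum>p\<in>T. (excoeff d \<delta> \<beta> (fst p) * qq powi (- int (fst p) * int (snd p)) * gcoeff (m - int c + \<gamma>) (- \<gamma>) (snd p)) \<cdot> Fv p)"
proof -
  define f where "f k x = (\<Sum>j\<le>c. ((- 1) ^ k * d k * gcoeff \<delta> (\<beta> + int k) (x - k) *
      qq powi (- int x * int j) * gcoeff (m - int c + \<gamma>) (- \<gamma>) j) \<cdot> Fv (x, j))" for k x
  have "((- 1) ^ k * d k) \<cdot> B_mon \<sigma> act \<eta> (int a - int k) (int b - int k) (int c) = (\<Sum>i\<le>a - k. f k (k + i))"
    if k: "k \<le> a" for k
  proof -
    have nat: "int a - int k = int (a - k)" "int b - int k = int (b - k)"
      using k b by simp_all
    have eqs: "\<beta> + int k = n - m + int (a - k) - 2 * int (b - k) + 3 * int c + \<sigma> I1"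
      "\<delta> = m + int (b - k) - 2 * int c - \<sigma> I1 - int (a - k)"
      "\<gamma> + int k = \<beta> + int k + int (b - k) - int (a - k) - int c - 1"
      unfolding nat[symmetric] by (simp_all add: \<beta> \<delta> \<gamma>)
    have le: "c \<le> b - k"
      using k b by simp
    have coeff: "(- 1) ^ k * d k * (gcoeff \<delta> (\<beta> + int k) i * qq powi (- int i * int j) *
        gcoeff (m - int c + (\<gamma> + int k)) (- (\<gamma> + int k)) j) =
      (- 1) ^ k * d k * gcoeff \<delta> (\<beta> + int k) (k + i - k) *
        qq powi (- int (k + i) * int j) * gcoeff (m - int c + \<gamma>) (- \<gamma>) j" for i j
    proof -
      have "gcoeff (m - int c + (\<gamma> + int k)) (- (\<gamma> + int k)) j = qq powi (- int k * int j) * gcoeff (m - int c + \<gamma>) (- \<gamma>) j"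
        using gcoeff_translate[of "m - int c + \<gamma>" "int k" "- \<gamma>" j] by (simp add: algebra_simps)
      moreover have "qq powi (- int (k + i) * int j) = qq powi (- int i * int j) * qq powi (- int k * int j)"
        by (rule qq_powi_mult_eqI[symmetric]) (simp add: algebra_simps)
      ultimately show ?thesis
        by (simp add: mult_ac)
    qed
    have Fv: "Fm (int (a - k) - int i) (int (b - k) - int i - int j) (int c - int j) = Fv (k + i, j)" for i j
      unfolding nat[symmetric] Fv_def by (simp add: algebra_simps)
    show ?thesis
      unfolding nat B_mon_expand[OF le \<sigma>_sum eqs] f_def Fv act_sum vs.scale_scale coeff ..
  qed
  then have "(\<Sum>k\<le>a. ((- 1) ^ k * d k) \<cdot> B_mon \<sigma> act \<eta> (int a - int k) (int b - int k) (int c)) =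
      (\<Sum>k\<le>a. \<Sum>i\<le>a - k. f k (k + i))"
    by simp
  also have "\<dots> = (\<Sum>x\<le>a. \<Sum>k\<le>x. f k x)"
    by (rule sum_triangle)
  also have "\<dots> = (\<Sum>x\<le>a. \<Sum>j\<le>c. (excoeff d \<delta> \<beta> x * qq powi (- int x * int j) * gcoeff (m - int c + \<gamma>) (- \<gamma>) j) \<cdot> Fv (x, j))"
  proof (rule sum.cong)
    fix x
    have "(\<Sum>k\<le>x. f k x) = (\<Sum>j\<le>c. \<Sum>k\<le>x. ((- 1) ^ k * d k * gcoeff \<delta> (\<beta> + int k) (x - k) *
      qq powi (- int x * int j) * gcoeff (m - int c + \<gamma>) (- \<gamma>) j) \<cdot> Fv (x, j))"
      unfolding f_def by (rule sum.swap)
    then show "(\<Sum>k\<le>x. f k x) = (\<Sum>j\<le>c. (excoeff d \<delta> \<beta> x * qq powi (- int x * int j) * gcoeff (m - int c + \<gamma>) (- \<gamma>) j) \<cdot> Fv (x, j))"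
      by (simp only: excoeff_def sum_distrib_right vs.scale_sum_left)
  qed simp
  also have "\<dots> = (\<Sum>p\<in>T. (excoeff d \<delta> \<beta> (fst p) * qq powi (- int (fst p) * int (snd p)) * gcoeff (m - int c + \<gamma>) (- \<gamma>) (snd p)) \<cdot> Fv p)"
    unfolding T_def sum.cartesian_product by (rule sum.cong) auto
  finally show ?thesis .
qed

text \<open>Abstract in \<open>d\<close> because both parities of the parameter occur in the
  inversion.\<close>

lemma icanonical_eq:
  assumes \<beta>: "\<beta> = n - m + int a - 2 * int b + 3 * int c + \<sigma> I1"
    and "\<beta> > 0" and b': "a + c < b"
    and d: "d 0 = 1" "\<And>k. bar (d k) = d k" "\<And>\<delta> i. \<delta> \<ge> 0 \<Longrightarrow> i > 0 \<Longrightarrow> excoeff d \<delta> \<beta> i \<in> qinv_Z"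
  shows "icanonical act \<eta> \<psi>L (int a) (int b) (int c) =
    (\<Sum>k\<le>a. ((- 1) ^ k * d k) \<cdot> B_mon \<sigma> act \<eta> (int a - int k) (int b - int k) (int c))"
proof (rule icanonical_eqI)
  show "\<psi>L (\<Sum>k\<le>a. ((- 1) ^ k * d k) \<cdot> B_mon \<sigma> act \<eta> (int a - int k) (int b - int k) (int c)) =
    (\<Sum>k\<le>a. ((- 1) ^ k * d k) \<cdot> B_mon \<sigma> act \<eta> (int a - int k) (int b - int k) (int c))"
    by (simp add: psiL_sum psiL_scale psiL_B_mon bar_mult bar_power bar_minus d)
next
  define \<delta> where "\<delta> = m + int b - 2 * int c - \<sigma> I1 - int a"
  define \<gamma> where "\<gamma> = \<beta> + int b - int a - int c - 1"
  define g where "g p = excoeff d \<delta> \<beta> (fst p) * qq powi (- int (fst p) * int (snd p)) * gcoeff (m - int c + \<gamma>) (- \<gamma>) (snd p)" for p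
  \<comment> \<open>Strictness of \<open>a + c < b\<close> matters when
    \<open>\<sigma> I1 = 1\<close> and \<open>m = c\<close>.\<close>
  have \<delta>: "\<delta> \<ge> 0"
    using \<sigma> c b' by (auto simp: \<delta>_def)
  have \<gamma>: "\<gamma> \<ge> 0"
    using \<open>\<beta> > 0\<close> b' by (simp add: \<gamma>_def)
  have g0: "g (0, 0) = 1"
    by (simp add: g_def d)
  have g: "g p \<in> qinv_Z" if "p \<noteq> (0, 0)" for p
  proof -
    have q: "qq powi (- int (fst p) * int (snd p)) \<in> Z_qinv"
      by (rule Z_qinv_powi) simp
    have C: "snd p > 0 \<Longrightarrow> gcoeff (m - int c + \<gamma>) (- \<gamma>) (snd p) \<in> qinv_Z"
      using c \<gamma> by (intro gcoeff_neg_qinv_Z) auto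
    then have C': "gcoeff (m - int c + \<gamma>) (- \<gamma>) (snd p) \<in> Z_qinv"
      by (cases "snd p = 0") (auto simp: Z_qinv_1 intro: qinv_Z_subset_Z_qinv)
    show ?thesis
    proof (cases "fst p > 0")
      case True
      then show ?thesis
        unfolding g_def using d(3)[OF \<delta> True] q C' by (intro qinv_Z_mult)
    next
      case False
      then have "snd p > 0"
        using that by (cases p) auto
      with False show ?thesis
        unfolding g_def using d(1) q C by (intro qinv_Z_mult') (auto simp: Z_qinv_1)
    qed
  qed
  have "(\<Sum>p\<in>T. g p \<cdot> Fv p) = g (0, 0) \<cdot> Fv (0, 0) + (\<Sum>p\<in>T - {(0, 0)}. g p \<cdot> Fv p)"
    by (rule sum.remove) (simp_all add: T_def)
  also have "(\<Sum>p\<in>T - {(0, 0)}. g p \<cdot> Fv p) = (\<Sum>p\<in>T - {(0, 0)}. (g((0, 0) := 0)) p \<cdot> Fv p)"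
    by (rule sum.cong) auto
  also have "\<dots> = (\<Sum>p\<in>T. (g((0, 0) := 0)) p \<cdot> Fv p)"
    by (rule sum.mono_neutral_left) auto
  finally have "(\<Sum>p\<in>T. g p \<cdot> Fv p) = Fv (0, 0) + (\<Sum>p\<in>T. (g((0, 0) := 0)) p \<cdot> Fv p)"
    by (simp add: g0)
  moreover have "(g((0, 0) := 0)) p \<in> qinv_Z" for p
    using g by (simp add: qinv_Z_0)
  ultimately show "(\<Sum>k\<le>a. ((- 1) ^ k * d k) \<cdot> B_mon \<sigma> act \<eta> (int a - int k) (int b - int k) (int c))
    \<in> icanonical_coset act \<eta> (int a) (int b) (int c)"
    unfolding icanonical_coset_iff B_mon_combination[OF \<beta> \<delta>_def \<gamma>_def] g_def[symmetric]
    by (intro exI[of _ "g((0, 0) := 0)"]) simp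
qed

end

end

section \<open>Inversion in the module and the two formulas\<close>

lemma sum_int_if:
  fixes f :: "int \<Rightarrow> 'a::comm_monoid_add"
  shows "(\<Sum>k | 0 \<le> k \<and> k \<le> int a \<and> P k. f k) = (\<Sum>k\<le>a. if P (int k) then f (int k) else 0)"
proof -
  have "(\<Sum>k | 0 \<le> k \<and> k \<le> int a \<and> P k. f k) = (\<Sum>k | k \<in> {..a} \<and> P (int k). f (int k))"
    by (rule sum.reindex_bij_witness[where i = int and j = nat]) auto
  also have "\<dots> = (\<Sum>k\<le>a. if P (int k) then f (int k) else 0)"
    by (rule sum.inter_filter) simp
  finally show ?thesis .
qed

context icanonical_setting
begin

text \<open>The shift by \<open>k\<close> preserves the inequalities and turns
  \<open>\<beta>\<close> into \<open>\<beta> + k\<close>, for which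
  \<open>can_coeff \<beta> k\<close> selects the integral family.\<close>

lemma icanonical_can_coeff:
  assumes "a + c < b" "int c \<le> m" "int b - int c \<le> n"
    and \<beta>: "\<beta> = n - m + int a - 2 * int b + 3 * int c + \<sigma> I1" and "\<beta> > 0" "odd \<beta>" and k: "k \<le> a"
  shows "icanonical act \<eta> \<psi>L (int a - int k) (int b - int k) (int c) =
    (\<Sum>l\<le>a - k. ((- 1) ^ l * can_coeff \<beta> k l) \<cdot> B_mon \<sigma> act \<eta> (int a - int (k + l)) (int b - int (k + l)) (int c))"
proof -
  have nat: "int a - int k = int (a - k)" "int b - int k = int (b - k)"
    using k assms(1) by simp_all
  have \<beta>k: "\<beta> + int k = n - m + int (a - k) - 2 * int (b - k) + 3 * int c + \<sigma> I1"
    unfolding nat[symmetric] by (simp add: \<beta>)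
  have "icanonical act \<eta> \<psi>L (int (a - k)) (int (b - k)) (int c) =
    (\<Sum>l\<le>a - k. ((- 1) ^ l * can_coeff \<beta> k l) \<cdot> B_mon \<sigma> act \<eta> (int (a - k) - int l) (int (b - k) - int l) (int c))"
  proof (rule icanonical_eq[OF _ _ _ \<beta>k])
    show "excoeff (can_coeff \<beta> k) \<delta> (\<beta> + int k) i \<in> qinv_Z" if "\<delta> \<ge> 0" "i > 0" for \<delta> i
      using that \<open>\<beta> > 0\<close> \<open>odd \<beta>\<close>
      by (cases "odd k") (auto simp: can_coeff_def[abs_def] intro!: excoeff_can_even_qinv_Z excoeff_can_odd_qinv_Z)
  qed (use assms k in \<open>auto simp: can_coeff_def\<close>)
  then show ?thesis
    unfolding nat[symmetric] by (simp add: algebra_simps)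
qed

text \<open>After collecting by the total shift \<open>r = k + l\<close>, every coefficient with
  \<open>r > 0\<close> vanishes by \<open>inv_coeff_can_coeff_inverse\<close>.\<close>

lemma B_mon_eq_sum_icanonical:
  assumes "a + c < b" "int c \<le> m" "int b - int c \<le> n"
    and "\<beta> = n - m + int a - 2 * int b + 3 * int c + \<sigma> I1" and "\<beta> > 0" "odd \<beta>"
  shows "B_mon \<sigma> act \<eta> (int a) (int b) (int c) =
    (\<Sum>k\<le>a. inv_coeff \<beta> k \<cdot> icanonical act \<eta> \<psi>L (int a - int k) (int b - int k) (int c))"
proof -
  define X where "X r = B_mon \<sigma> act \<eta> (int a - int r) (int b - int r) (int c)" for r
  have "(\<Sum>k\<le>a. inv_coeff \<beta> k \<cdot> icanonical act \<eta> \<psi>L (int a - int k) (int b - int k) (int c)) =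
      (\<Sum>k\<le>a. \<Sum>l\<le>a - k. (inv_coeff \<beta> k * ((- 1) ^ (k + l - k) * can_coeff \<beta> k (k + l - k))) \<cdot> X (k + l))"
    by (rule sum.cong) (simp_all add: icanonical_can_coeff[OF assms] act_sum X_def)
  also have "\<dots> = (\<Sum>r\<le>a. \<Sum>k\<le>r. (inv_coeff \<beta> k * ((- 1) ^ (r - k) * can_coeff \<beta> k (r - k))) \<cdot> X r)"
    by (rule sum_triangle)
  also have "\<dots> = (\<Sum>r\<le>a. (if r = 0 then 1 else 0) \<cdot> X r)"
  proof (rule sum.cong)
    fix r
    have "(\<Sum>k\<le>r. inv_coeff \<beta> k * ((- 1) ^ (r - k) * can_coeff \<beta> k (r - k))) = (if r = 0 then 1 else 0)"
      using inv_coeff_can_coeff_inverse[of r \<beta>] by simp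
    then show "(\<Sum>k\<le>r. (inv_coeff \<beta> k * ((- 1) ^ (r - k) * can_coeff \<beta> k (r - k))) \<cdot> X r) = (if r = 0 then 1 else 0) \<cdot> X r"
      by (simp only: vs.scale_sum_left[symmetric])
  qed simp
  also have "\<dots> = (\<Sum>r\<in>{0}. (if r = 0 then 1 else 0) \<cdot> X r)"
    by (rule sum.mono_neutral_right) auto
  finally show ?thesis
    by (simp add: X_def)
qed

end

theorem theorem6p9:
  fixes act :: "Uq \<Rightarrow> 'v::ab_group_add \<Rightarrow> 'v" and \<eta> :: 'v
    and \<sigma> :: "idx \<Rightarrow> int" and \<psi> :: "Uq \<Rightarrow> Uq" and \<psi>L :: "'v \<Rightarrow> 'v"
    and m n a b c \<beta> :: int
  assumes "(\<sigma> I1, \<sigma> I2) \<in> {(1, 0), (0, 1)}"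
    and "m \<ge> 0" and "n \<ge> 0" and "a \<ge> 0" and "b \<ge> 0" and "c \<ge> 0"
    and "simple_highest_weight_module act m n \<eta>"
    and "is_psi_Ui \<sigma> \<psi>"
    and "is_psi_module \<sigma> \<psi> act \<eta> \<psi>L"
    and "m \<ge> c" and "n - b + c \<ge> 0"
    and "\<beta> = n - m + a - 2 * b + 3 * c + \<sigma> I1"
    and "\<beta> > 0" and "odd \<beta>" and "b > a + c"
  shows "(B_mon \<sigma> act \<eta> a b c =
           act (scal (qint \<beta>))
             (\<Sum>k | 0 \<le> k \<and> k \<le> a \<and> odd k.
               act (scal (qprod (\<beta> - k + 2) (\<beta> + k - 2) / qfact k))
                 (icanonical act \<eta> \<psi>L (a - k) (b - k) c))
         + (\<Sum>k | 0 \<le> k \<and> k \<le> a \<and> even k.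
             act (scal (qprod (\<beta> - k + 1) (\<beta> + k - 1) / qfact k))
               (icanonical act \<eta> \<psi>L (a - k) (b - k) c)))
       \<and> icanonical act \<eta> \<psi>L a b c =
           (\<Sum>k\<in>{0..a}.
             act (scal ((-1) ^ nat k *
                 (if k = 0 then 1
                  else qint (\<beta> + k - 1) * qprod (\<beta> + 1) (\<beta> + 2 * k - 3) / qfact k)))
               (B_mon \<sigma> act \<eta> (a - k) (b - k) c))"
proof -
  interpret simple_highest_weight_module act m n \<eta>
    by fact
  interpret icanonical_setting act m n \<eta> \<sigma> \<psi> \<psi>L
    by unfold_locales (use assms in auto)
  obtain a' b' c' :: nat where nat: "a = int a'" "b = int b'" "c = int c'"
    using assms(4-6) by (metis nonneg_int_cases)
  have *: "a' + c' < b'" "int c' \<le> m" "int b' - int c' \<le> n"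
    "\<beta> = n - m + int a' - 2 * int b' + 3 * int c' + \<sigma> I1" "\<beta> > 0" "odd \<beta>"
    using assms by (auto simp: nat)
  define ic where "ic k = icanonical act \<eta> \<psi>L (a - k) (b - k) c" for k
  have odd: "qint \<beta> \<cdot> (qprod (\<beta> - int k + 2) (\<beta> + int k - 2) / qfact (int k)) \<cdot> v = inv_coeff \<beta> k \<cdot> v"
    if "odd k" for k v
  proof -
    have "int (k - 1) = int k - 1"
      using odd_pos[OF that] by simp
    then have "qprod (\<beta> - int k + 2) (\<beta> + int k - 2) = qprod_len (\<beta> - int k + 2) (k - 1)"
      by (intro qprod_eq_qprod_len) simp
    with that show ?thesis
      by (simp add: inv_coeff_def)
  qed
  have even: "qprod (\<beta> - int k + 1) (\<beta> + int k - 1) / qfact (int k) = inv_coeff \<beta> k" if "even k" for k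
    using that qprod_eq_qprod_len[of "\<beta> + int k - 1" "\<beta> - int k + 1" k] by (simp add: inv_coeff_def)
  have "B_mon \<sigma> act \<eta> a b c = (\<Sum>k\<le>a'. inv_coeff \<beta> k \<cdot> ic (int k))"
    using B_mon_eq_sum_icanonical[OF *] by (simp add: nat ic_def)
  also have "\<dots> = (\<Sum>k\<le>a'. (if odd (int k) then
        qint \<beta> \<cdot> (qprod (\<beta> - int k + 2) (\<beta> + int k - 2) / qfact (int k)) \<cdot> ic (int k) else 0)
      + (if even (int k) then (qprod (\<beta> - int k + 1) (\<beta> + int k - 1) / qfact (int k)) \<cdot> ic (int k) else 0))"
    by (rule sum.cong) (auto simp: odd even simp del: vs.scale_scale)
  also have "\<dots> = (\<Sum>k | 0 \<le> k \<and> k \<le> a \<and> odd k. qint \<beta> \<cdot> (qprod (\<beta> - k + 2) (\<beta> + k - 2) / qfact k) \<cdot> ic k)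
      + (\<Sum>k | 0 \<le> k \<and> k \<le> a \<and> even k. (qprod (\<beta> - k + 1) (\<beta> + k - 1) / qfact k) \<cdot> ic k)"
    unfolding nat(1) sum_int_if sum.distrib ..
  finally have 1: "B_mon \<sigma> act \<eta> a b c =
      qint \<beta> \<cdot> (\<Sum>k | 0 \<le> k \<and> k \<le> a \<and> odd k. (qprod (\<beta> - k + 2) (\<beta> + k - 2) / qfact k) \<cdot> ic k)
      + (\<Sum>k | 0 \<le> k \<and> k \<le> a \<and> even k. (qprod (\<beta> - k + 1) (\<beta> + k - 1) / qfact k) \<cdot> ic k)"
    unfolding act_sum .
  have coeff: "(if int k = 0 then 1 else qint (\<beta> + int k - 1) * qprod (\<beta> + 1) (\<beta> + 2 * int k - 3) / qfact (int k)) = can_odd \<beta> k" for k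
    using qprod_eq_qprod_len[of "\<beta> + 2 * int k - 3" "\<beta> + 1" "k - 1"]
    by (cases "k = 0") (simp_all add: can_odd_def of_nat_diff)
  have "icanonical act \<eta> \<psi>L a b c =
      (\<Sum>k\<le>a'. ((- 1) ^ k * can_odd \<beta> k) \<cdot> B_mon \<sigma> act \<eta> (a - int k) (b - int k) c)"
    using icanonical_can_coeff[OF *, of 0] by (simp add: nat can_coeff_def)
  also have "\<dots> = (\<Sum>k\<le>a'. ((-1) ^ nat (int k) *
      (if int k = 0 then 1 else qint (\<beta> + int k - 1) * qprod (\<beta> + 1) (\<beta> + 2 * int k - 3) / qfact (int k)))
        \<cdot> B_mon \<sigma> act \<eta> (a - int k) (b - int k) c)"
    by (simp only: coeff nat_int)
  also have "\<dots> = (\<Sum>k\<in>{0..a}. ((-1) ^ nat k *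
      (if k = 0 then 1 else qint (\<beta> + k - 1) * qprod (\<beta> + 1) (\<beta> + 2 * k - 3) / qfact k))
        \<cdot> B_mon \<sigma> act \<eta> (a - k) (b - k) c)"
    by (rule sum.reindex_bij_witness[where i = nat and j = int]) (auto simp: nat)
  finally show ?thesis
    using 1 unfolding ic_def by blast
qed

end
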